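(* Let $0\le d_1<\cdots<d_a<e_1<\cdots<e_b$ be integers, let $s_1,\dots,s_a,t_1,\dots,t_b$ be nonnegative integers, and let $V_1=\bigoplus_{i=1}^a\mathcal{O}_{\mathbb{P}^n}(d_i)^{s_i}$ and $V_2=\bigoplus_{j=1}^b\mathcal{O}_{\mathbb{P}^n}(e_j)^{t_j}$. If $$\max\left\{\sum_{i=1}^a s_i\binom{d_i+n}{n},\ \sum_{j=1}^b t_j\binom{e_j+n}{n}\right\}\ \ge\ \frac14\binom{d_a+n}{n}\binom{e_b+n}{n}\sum_{i=1}^a\binom{d_i+n}{n}^2,$$ then a general map $M:V_1\to V_2$ induces a maximal rank map $H^0(V_1)\to H^0(V_2)$.
   Context: $\mathbb{P}^n$ ($n\ge 1$) is projective space over $\mathbb{C}$. "General" means: for every $M$ in some nonempty Zariski open subset of $\operatorname{Hom}(V_1,V_2)$. A linear map has maximal rank if it is injective or surjective. *)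

theory Defs
  imports Complex_Main "HOL-Library.Function_Algebras"
begin

text \<open>
  The projective space over the complex numbers is the classical variety: its points are the
  classes of nonzero vectors up to scaling, with the Zariski topology.  A vector of \<open>C^(n+1)\<close> is a
  function on \<open>nat\<close> that vanishes above \<open>n\<close>.  A point is thus a punctured line, and the cone over a
  set \<open>U\<close> of points is \<open>\<Union>U\<close>.
\<close>

type_synonym vec = "nat \<Rightarrow> complex"
type_synonym point = "vec set"

definition vecs :: "nat \<Rightarrow> vec set" where
  "vecs n = {x. \<forall>i>n. x i = 0}"

definition proportional :: "nat \<Rightarrow> (vec \<times> vec) set" where
  "proportional n =
     {(x, y). x \<in> vecs n - {0} \<and> y \<in> vecs n - {0} \<and> (\<exists>c. c \<noteq> 0 \<and> y = (\<lambda>i. c * x i))}"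

definition proj_space :: "nat \<Rightarrow> point set" where
  "proj_space n = (vecs n - {0}) // proportional n"

definition exponents :: "nat \<Rightarrow> nat \<Rightarrow> (nat \<Rightarrow> nat) set" where
  "exponents n k = {\<alpha>. (\<forall>i>n. \<alpha> i = 0) \<and> (\<Sum>i\<le>n. \<alpha> i) = k}"

text \<open>
  Homogeneous polynomials of degree \<open>k\<close> in the variables \<open>x 0, ..., x n\<close>, as polynomial functions
  (nothing is lost over an infinite field).
\<close>

definition forms :: "nat \<Rightarrow> nat \<Rightarrow> (vec \<Rightarrow> complex) set" where
  "forms n k = {f. \<exists>c. f = (\<lambda>x. \<Sum>\<alpha>\<in>exponents n k. c \<alpha> * (\<Prod>i\<le>n. x i ^ \<alpha> i))}"

definition proj_open :: "nat \<Rightarrow> point set \<Rightarrow> bool" where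
  "proj_open n U \<longleftrightarrow>
     (\<exists>F \<subseteq> (\<Union>k. forms n k). U = {P \<in> proj_space n. \<exists>f\<in>F. \<exists>x\<in>P. f x \<noteq> 0})"

text \<open>
  Sections of \<open>O(k)\<close> over \<open>U\<close>: functions on the cone over \<open>U\<close> that are locally quotients of forms,
  the degree of the numerator exceeding that of the denominator by \<open>k\<close>.  Here and below, functions
  are set to zero outside their domain, so that pointwise operations give the module structures.
  The structure sheaf is the case \<open>k = 0\<close>.
\<close>

definition twist :: "nat \<Rightarrow> nat \<Rightarrow> point set \<Rightarrow> (vec \<Rightarrow> complex) set" where
  "twist n k U =
     {f. (\<forall>x. x \<notin> \<Union>U \<longrightarrow> f x = 0) \<and>
         (\<forall>P\<in>U. \<exists>W. proj_open n W \<and> P \<in> W \<and> W \<subseteq> U \<and>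
            (\<exists>m. \<exists>p\<in>forms n (m + k). \<exists>q\<in>forms n m.
               \<forall>x\<in>\<Union>W. q x \<noteq> 0 \<and> f x = p x / q x))}"

text \<open>
  The direct sum of the sheaves \<open>O(d i)^(s i)\<close> for \<open>i = 1, ..., a\<close>.  The component \<open>(i, k)\<close> of a
  section is its component in the \<open>k\<close>-th copy of \<open>O(d i)\<close>.
\<close>

type_synonym section_fun = "nat \<times> nat \<Rightarrow> vec \<Rightarrow> complex"
type_synonym presheaf = "point set \<Rightarrow> section_fun set"

definition sum_of_twists ::
    "nat \<Rightarrow> nat \<Rightarrow> (nat \<Rightarrow> nat) \<Rightarrow> (nat \<Rightarrow> nat) \<Rightarrow> presheaf" where
  "sum_of_twists n a d s U =
     {\<sigma>. \<forall>i k. if i \<in> {1..a} \<and> k \<in> {1..s i} then \<sigma> (i, k) \<in> twist n (d i) U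
               else \<sigma> (i, k) = 0}"

definition restr :: "point set \<Rightarrow> section_fun \<Rightarrow> section_fun" where
  "restr U \<sigma> = (\<lambda>\<iota> x. if x \<in> \<Union>U then \<sigma> \<iota> x else 0)"

definition smul :: "(vec \<Rightarrow> complex) \<Rightarrow> section_fun \<Rightarrow> section_fun" where
  "smul f \<sigma> = (\<lambda>\<iota> x. f x * \<sigma> \<iota> x)"

text \<open>Morphisms of sheaves of modules over the structure sheaf.\<close>

type_synonym sheaf_map = "point set \<Rightarrow> section_fun \<Rightarrow> section_fun"

definition sheaf_hom :: "nat \<Rightarrow> presheaf \<Rightarrow> presheaf \<Rightarrow> sheaf_map set" where
  "sheaf_hom n V W =
     {M. (\<forall>U. proj_open n U \<longrightarrow>
            (\<forall>\<sigma>\<in>V U. M U \<sigma> \<in> W U) \<and>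
            (\<forall>\<sigma>\<in>V U. \<forall>\<tau>\<in>V U. M U (\<sigma> + \<tau>) = M U \<sigma> + M U \<tau>) \<and>
            (\<forall>f\<in>twist n 0 U. \<forall>\<sigma>\<in>V U. M U (smul f \<sigma>) = smul f (M U \<sigma>))) \<and>
         (\<forall>U U'. proj_open n U \<and> proj_open n U' \<and> U' \<subseteq> U \<longrightarrow>
            (\<forall>\<sigma>\<in>V U. M U' (restr U' \<sigma>) = restr U' (M U \<sigma>))) \<and>
         (\<forall>U \<sigma>. \<not> (proj_open n U \<and> \<sigma> \<in> V U) \<longrightarrow> M U \<sigma> = 0)}"

definition hom_scale :: "complex \<Rightarrow> sheaf_map \<Rightarrow> sheaf_map" where
  "hom_scale c M = (\<lambda>U \<sigma> \<iota> x. c * M U \<sigma> \<iota> x)"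

definition global_sections :: "nat \<Rightarrow> presheaf \<Rightarrow> section_fun set" where
  "global_sections n V = V (proj_space n)"

definition on_global_sections :: "nat \<Rightarrow> sheaf_map \<Rightarrow> section_fun \<Rightarrow> section_fun" where
  "on_global_sections n M = M (proj_space n)"

text \<open>
  The Zariski topology of a finite-dimensional complex vector space \<open>H\<close> with scalar multiplication
  \<open>sc\<close>, without a choice of basis: the polynomial functions are the algebra generated by the linear
  functionals.
\<close>

inductive_set polynomial_functions ::
    "(complex \<Rightarrow> 'v \<Rightarrow> 'v) \<Rightarrow> 'v::ab_group_add set \<Rightarrow> ('v \<Rightarrow> complex) set"
  for sc :: "complex \<Rightarrow> 'v \<Rightarrow> 'v" and H :: "'v set" where
  linear: "l \<in> polynomial_functions sc H"
    if "\<forall>v\<in>H. \<forall>w\<in>H. l (v + w) = l v + l w" and "\<forall>c. \<forall>v\<in>H. l (sc c v) = c * l v"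
| const: "(\<lambda>_. c) \<in> polynomial_functions sc H"
| add: "(\<lambda>v. f v + g v) \<in> polynomial_functions sc H"
    if "f \<in> polynomial_functions sc H" and "g \<in> polynomial_functions sc H"
| mult: "(\<lambda>v. f v * g v) \<in> polynomial_functions sc H"
    if "f \<in> polynomial_functions sc H" and "g \<in> polynomial_functions sc H"

definition zariski_open_in ::
    "(complex \<Rightarrow> 'v \<Rightarrow> 'v) \<Rightarrow> 'v::ab_group_add set \<Rightarrow> 'v set \<Rightarrow> bool" where
  "zariski_open_in sc H A \<longleftrightarrow>
     (\<exists>F \<subseteq> polynomial_functions sc H. A = {v \<in> H. \<exists>f\<in>F. f v \<noteq> 0})"

definition general_in_Hom ::
    "nat \<Rightarrow> presheaf \<Rightarrow> presheaf \<Rightarrow> (sheaf_map \<Rightarrow> bool) \<Rightarrow> bool" where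
  "general_in_Hom n V W Q \<longleftrightarrow>
     (\<exists>A. zariski_open_in hom_scale (sheaf_hom n V W) A \<and> A \<noteq> {} \<and> (\<forall>M\<in>A. Q M))"

definition maximal_rank :: "('x \<Rightarrow> 'y) \<Rightarrow> 'x set \<Rightarrow> 'y set \<Rightarrow> bool" where
  "maximal_rank f X Y \<longleftrightarrow> inj_on f X \<or> f ` X = Y"

end

theory Submission
  imports Defs "HOL-Computational_Algebra.Fundamental_Theorem_Algebra"
    "Jordan_Normal_Form.Determinant" "HOL-Library.FuncSet"
begin

text \<open>
  Maximal rank is an open condition, witnessed by the Gram determinant of the matrix of a morphism
  on global sections with the matrix of a fixed one, so it suffices to find one morphism of maximal
  rank.  It is found with integer coefficients, by a dimension count that is carried out as a count
  of points over the field with \<open>p\<close> elements for a large prime \<open>p\<close>.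

  For injectivity, stratify the vectors \<open>k\<close> in the source by the spans \<open>R\<^sub>i\<close> of their components of
  degree \<open>d\<^sub>i\<close>.  With \<open>r\<^sub>i = dim R\<^sub>i\<close> and \<open>D\<^sub>i = dim S\<^sub>d\<^sub>i\<close>, a stratum has dimension at most
  \<open>\<Sum> r\<^sub>i (D\<^sub>i - r\<^sub>i) + s\<^sub>i r\<^sub>i\<close>, and the matrices that kill a given \<open>k\<close> have codimension \<open>\<Sum> t\<^sub>j dim (R)\<^sub>e\<^sub>j\<close>,
  where \<open>(R)\<close> is the ideal generated by the \<open>R\<^sub>i\<close>.  A proper nonzero subspace \<open>R\<close> of \<open>S\<^sub>d\<close> occupies a
  strictly larger proportion of \<open>S\<^sub>e\<close> than of \<open>S\<^sub>d\<close>; by integrality the gain is at least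
  \<open>1 / (dim S\<^sub>d dim S\<^sub>e)\<close>, and the hypothesis makes this gain outweigh \<open>\<Sum> r\<^sub>i (D\<^sub>i - r\<^sub>i) \<le> \<Sum> D\<^sub>i\<^sup>2 / 4\<close>.
  Passing to leading monomials reduces the growth of ideals to the growth of shadows of sets of
  monomials.  Surjectivity is the dual statement, with contraction in place of multiplication.
\<close>

section \<open>Shadows of sets of monomials\<close>

text \<open>Over the field with \<open>p\<close> elements a stratum is a finite set and its
  dimension is an exponent of \<open>p\<close>, so no geometry of strata is needed. The price is a
  factor, the number of types. Types are families of sets of monomials, hence bounded in number by
  the degrees alone, and \<open>p\<close> is chosen after them.

  The way back to characteristic zero has two steps. A matrix of integers that kills only multiples
  of \<open>p\<close> modulo \<open>p\<close> kills no nonzero integer vector. Its Gram determinant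
  is then a nonzero integer, because squares are nonnegative, and stays nonzero as a complex number.
  Replacing one of the two factors of the Gram matrix by the matrix of a variable morphism gives a
  polynomial function on Hom.

  The two halves are not mirror images. For injectivity the spans in all degrees \<open>d i\<close>
  enter the type. For surjectivity the type is the set of leads in degree \<open>d a\<close> only:
  leads are closed under division, so those in degree \<open>d a\<close> bound the lead sets in the
  lower degrees from below.\<close>

definition unit_exp :: "nat \<Rightarrow> nat \<Rightarrow> nat" where
  "unit_exp i = (\<lambda>j. if j = i then 1 else 0)"

definition up_shadow :: "nat \<Rightarrow> nat \<Rightarrow> (nat \<Rightarrow> nat) set \<Rightarrow> (nat \<Rightarrow> nat) set" where
  "up_shadow n k Y = {\<alpha> + \<gamma> | \<alpha> \<gamma>. \<alpha> \<in> Y \<and> \<gamma> \<in> exponents n k}"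

section \<open>Exponent vectors of a fixed degree\<close>

lemma exponents_subset_bounded: "exponents n k \<subseteq> {\<alpha>. (\<forall>i>n. \<alpha> i = 0) \<and> (\<forall>i\<le>n. \<alpha> i \<le> k)}"
  by (auto simp: exponents_def intro: member_le_sum)

lemma exponents_le: "\<alpha> \<in> exponents n k \<Longrightarrow> \<alpha> i \<le> k"
  using exponents_subset_bounded[of n k] by (cases "i \<le> n") auto

lemma finite_exponents [simp]: "finite (exponents n k)"
proof -
  have "finite {\<alpha>. \<forall>i. (i \<in> {..n} \<longrightarrow> \<alpha> i \<in> {..k}) \<and> (i \<notin> {..n} \<longrightarrow> \<alpha> i = 0)}"
    by (rule finite_set_of_finite_funs) auto
  thus ?thesis
    by (rule finite_subset[rotated]) (auto simp: exponents_le, auto simp: exponents_def)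
qed

lemma exponents_0: "exponents n 0 = {0}"
  by (auto simp: exponents_def fun_eq_iff) (metis atMost_iff not_le)

lemma exponents_add:
  "\<alpha> \<in> exponents n k \<Longrightarrow> \<gamma> \<in> exponents n m \<Longrightarrow> \<alpha> + \<gamma> \<in> exponents n (k + m)"
  by (auto simp: exponents_def sum.distrib)

lemma exponents_diff:
  assumes "\<alpha> \<in> exponents n k" "\<beta> \<in> exponents n m" "\<alpha> \<le> \<beta>"
  shows "\<beta> - \<alpha> \<in> exponents n (m - k)" "\<beta> = \<alpha> + (\<beta> - \<alpha>)" "k \<le> m"
proof -
  have le: "\<alpha> i \<le> \<beta> i" for i using assms(3) by (simp add: le_fun_def)
  have "(\<Sum>i\<le>n. (\<beta> - \<alpha>) i) = (\<Sum>i\<le>n. \<beta> i) - (\<Sum>i\<le>n. \<alpha> i)"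
    using le by (simp add: sum_subtractf_nat)
  thus "\<beta> - \<alpha> \<in> exponents n (m - k)" using assms by (auto simp: exponents_def)
  show "\<beta> = \<alpha> + (\<beta> - \<alpha>)" using le by (auto simp: fun_eq_iff)
  show "k \<le> m" using assms le by (auto simp: exponents_def intro: sum_mono)
qed

lemma unit_exp_in: "i \<le> n \<Longrightarrow> unit_exp i \<in> exponents n 1"
  by (auto simp: exponents_def unit_exp_def)

lemma exponents_remove_unit:
  assumes "\<beta> \<in> exponents n (Suc k)" "\<beta> i > 0"
  shows "i \<le> n" "\<beta> - unit_exp i \<in> exponents n k" "\<beta> = (\<beta> - unit_exp i) + unit_exp i"
proof -
  show i: "i \<le> n" using assms by (auto simp: exponents_def) (metis not_le less_numeral_extra(3))
  have "unit_exp i \<le> \<beta>" using assms by (auto simp: le_fun_def unit_exp_def)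
  from exponents_diff[OF unit_exp_in[OF i] assms(1) this]
  show "\<beta> - unit_exp i \<in> exponents n k" "\<beta> = (\<beta> - unit_exp i) + unit_exp i"
    by (auto simp: add.commute)
qed

lemma exponents_Suc_pos:
  assumes "\<beta> \<in> exponents n (Suc k)" obtains i where "i \<le> n" "\<beta> i > 0"
proof -
  have "\<exists>i\<le>n. \<beta> i > 0"
  proof (rule ccontr)
    assume "\<not> ?thesis"
    hence "(\<Sum>i\<le>n. \<beta> i) = 0" by auto
    thus False using assms by (auto simp: exponents_def)
  qed
  thus ?thesis using that by auto
qed

text \<open>A monomial of degree \<open>k + m\<close> gives up one variable at a time until degree
  \<open>k\<close> is left.\<close>

lemma exponents_split:
  assumes "\<beta> \<in> exponents n (k + m)"
  obtains \<alpha> \<gamma> where "\<alpha> \<in> exponents n k" "\<gamma> \<in> exponents n m" "\<beta> = \<alpha> + \<gamma>"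
proof -
  have "\<exists>\<alpha> \<gamma>. \<alpha> \<in> exponents n k \<and> \<gamma> \<in> exponents n m \<and> \<beta> = \<alpha> + \<gamma>"
    using assms
  proof (induction m arbitrary: \<beta>)
    case 0
    thus ?case by (auto simp: exponents_0)
  next
    case (Suc m)
    then obtain i where i: "i \<le> n" "\<beta> i > 0" using exponents_Suc_pos by (metis add_Suc_right)
    have b: "\<beta> - unit_exp i \<in> exponents n (k + m)" "\<beta> = (\<beta> - unit_exp i) + unit_exp i"
      using exponents_remove_unit(2,3)[of \<beta> n "k + m" i] Suc.prems i by auto
    obtain \<alpha> \<gamma> where *: "\<alpha> \<in> exponents n k" "\<gamma> \<in> exponents n m" "\<beta> - unit_exp i = \<alpha> + \<gamma>"
      using Suc.IH[OF b(1)] by blast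
    have "\<gamma> + unit_exp i \<in> exponents n (m + 1)"
      using exponents_add[OF *(2) unit_exp_in[OF i(1)]] .
    moreover have "\<beta> = \<alpha> + (\<gamma> + unit_exp i)" using b(2) *(3) by (simp add: add.assoc)
    ultimately show ?case using *(1) by (metis Suc_eq_plus1)
  qed
  thus ?thesis using that by blast
qed

lemma exponents_nonempty: "exponents n k \<noteq> {}"
proof -
  have "(\<lambda>i. if i = 0 then k else 0) \<in> exponents n k" by (auto simp: exponents_def)
  thus ?thesis by blast
qed

lemma card_exponents_pos: "card (exponents n k) > 0"
  using exponents_nonempty by (simp add: card_gt_0_iff)

section \<open>Shadows and their composition\<close>

lemma up_shadow_subset:
  assumes "Y \<subseteq> exponents n d" shows "up_shadow n k Y \<subseteq> exponents n (d + k)"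
  using assms exponents_add by (auto simp: up_shadow_def)

lemma up_shadowI: "\<alpha> \<in> Y \<Longrightarrow> \<gamma> \<in> exponents n k \<Longrightarrow> \<alpha> + \<gamma> \<in> up_shadow n k Y"
  unfolding up_shadow_def by blast

lemma up_shadowE:
  assumes "\<beta> \<in> up_shadow n k Y"
  obtains \<alpha> \<gamma> where "\<alpha> \<in> Y" "\<gamma> \<in> exponents n k" "\<beta> = \<alpha> + \<gamma>"
  using assms unfolding up_shadow_def by blast

lemma up_shadow_full: "up_shadow n k (exponents n d) = exponents n (d + k)"
proof
  show "exponents n (d + k) \<subseteq> up_shadow n k (exponents n d)"
    by (auto elim!: exponents_split intro: up_shadowI simp del: plus_fun_apply)
qed (rule up_shadow_subset[OF order.refl])

lemma up_shadow_add: "up_shadow n (k + m) Y = up_shadow n m (up_shadow n k Y)"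
proof (intro equalityI subsetI)
  fix \<beta> assume "\<beta> \<in> up_shadow n (k + m) Y"
  then obtain \<alpha> \<delta> where 1: "\<alpha> \<in> Y" "\<delta> \<in> exponents n (k + m)" "\<beta> = \<alpha> + \<delta>"
    by (rule up_shadowE)
  from 1(2) obtain \<gamma> \<epsilon> where "\<gamma> \<in> exponents n k" "\<epsilon> \<in> exponents n m" "\<delta> = \<gamma> + \<epsilon>"
    by (rule exponents_split)
  with 1 show "\<beta> \<in> up_shadow n m (up_shadow n k Y)"
    by (simp only: add.assoc[symmetric] up_shadowI)
next
  fix \<beta> assume "\<beta> \<in> up_shadow n m (up_shadow n k Y)"
  then obtain \<alpha> \<gamma> \<epsilon> where "\<alpha> \<in> Y" "\<gamma> \<in> exponents n k" "\<epsilon> \<in> exponents n m" "\<beta> = \<alpha> + \<gamma> + \<epsilon>"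
    by (elim up_shadowE) blast
  thus "\<beta> \<in> up_shadow n (k + m) Y"
    by (simp only: add.assoc up_shadowI exponents_add)
qed

lemma up_shadow_0 [simp]: "up_shadow n 0 Y = Y"
  by (auto simp: up_shadow_def exponents_0)

lemma sum_exponents: "\<alpha> \<in> exponents n d \<Longrightarrow> (\<Sum>i\<le>n. \<alpha> i) = d"
  by (simp add: exponents_def)

text \<open>Weighting the cover relation of \<open>\<alpha>\<close> and \<open>\<alpha> + unit_exp i\<close> by \<open>\<alpha> i + 1\<close> makes it biregular: the
  weights above a monomial of degree \<open>d\<close> add up to \<open>d + n + 1\<close>, those below a monomial of degree
  \<open>d + 1\<close> to \<open>d + 1\<close>.\<close>

lemma up_shadow_1_weight:
  assumes Y: "Y \<subseteq> exponents n d"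
  defines "I \<equiv> (\<lambda>(\<alpha>, i). (\<alpha> + unit_exp i, i)) ` (Y \<times> {..n})"
  shows "(d + n + 1) * card Y = (\<Sum>(\<beta>, i)\<in>I. \<beta> i)"
    and "(\<Sum>(\<beta>, i)\<in>up_shadow n 1 Y \<times> {..n}. \<beta> i) = (d + 1) * card (up_shadow n 1 Y)"
    and "I \<subseteq> up_shadow n 1 Y \<times> {..n}" and "finite (up_shadow n 1 Y)"
proof -
  have inj: "inj_on (\<lambda>(\<alpha>, i). (\<alpha> + unit_exp i, i)) (Y \<times> {..n})" by (auto simp: inj_on_def)
  have "(\<Sum>(\<beta>, i)\<in>I. \<beta> i) = (\<Sum>(\<alpha>, i)\<in>Y \<times> {..n}. \<alpha> i + 1)"
    unfolding I_def by (subst sum.reindex[OF inj]) (auto simp: unit_exp_def intro!: sum.cong)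
  also have "\<dots> = (\<Sum>\<alpha>\<in>Y. \<Sum>i\<le>n. \<alpha> i + 1)" by (simp add: sum.cartesian_product)
  also have "\<dots> = (\<Sum>\<alpha>\<in>Y. d + n + 1)"
    using Y by (intro sum.cong refl, subst sum.distrib) (auto dest!: sum_exponents)
  finally show "(d + n + 1) * card Y = (\<Sum>(\<beta>, i)\<in>I. \<beta> i)" by simp
  have sub: "up_shadow n 1 Y \<subseteq> exponents n (d + 1)" by (rule up_shadow_subset[OF Y])
  show "finite (up_shadow n 1 Y)" using sub finite_subset finite_exponents by blast
  have "(\<Sum>(\<beta>, i)\<in>up_shadow n 1 Y \<times> {..n}. \<beta> i) = (\<Sum>\<beta>\<in>up_shadow n 1 Y. \<Sum>i\<le>n. \<beta> i)"
    by (simp add: sum.cartesian_product)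
  also have "\<dots> = (\<Sum>\<beta>\<in>up_shadow n 1 Y. d + 1)"
    using sub sum_exponents by (intro sum.cong) auto
  finally show "(\<Sum>(\<beta>, i)\<in>up_shadow n 1 Y \<times> {..n}. \<beta> i) = (d + 1) * card (up_shadow n 1 Y)"
    by simp
  show "I \<subseteq> up_shadow n 1 Y \<times> {..n}"
    using unit_exp_in by (auto simp: I_def up_shadow_def)
qed

text \<open>The weighted covers that start in \<open>Y\<close> are among those that end in the
  shadow. By \<open>card_exponents_Suc\<close> the two factors are in the ratio of the numbers of
  monomials, so the shadow is at least as dense in degree \<open>d + 1\<close> as \<open>Y\<close>
  is in degree \<open>d\<close>.\<close>

lemma up_shadow_1_le:
  assumes "Y \<subseteq> exponents n d"
  shows "(d + n + 1) * card Y \<le> (d + 1) * card (up_shadow n 1 Y)"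
proof -
  note * = up_shadow_1_weight[OF assms]
  show ?thesis unfolding *(1) *(2)[symmetric] by (rule sum_mono2) (use * in auto)
qed

text \<open>The case of equality in the double count: a pair \<open>(\<beta>, i)\<close> not of the
  form \<open>(\<alpha> + unit_exp i, i)\<close> has \<open>\<beta> i = 0\<close> and carries no
  weight.\<close>

lemma card_exponents_Suc:
  "(d + n + 1) * card (exponents n d) = (d + 1) * card (exponents n (d + 1))"
proof -
  note * = up_shadow_1_weight[of "exponents n d" n d, OF order.refl, unfolded up_shadow_full]
  show ?thesis unfolding *(1) *(2)[symmetric]
  proof (rule sum.mono_neutral_left)
    let ?I = "(\<lambda>(\<alpha>, i). (\<alpha> + unit_exp i, i)) ` (exponents n d \<times> {..n})"
    show "\<forall>x\<in>exponents n (d + 1) \<times> {..n} - ?I. (case x of (\<beta>, i) \<Rightarrow> \<beta> i) = 0"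
    proof safe
      fix \<beta> i assume b: "\<beta> \<in> exponents n (d + 1)" "i \<le> n" "(\<beta>, i) \<notin> ?I"
      show "\<beta> i = 0"
      proof (rule ccontr)
        assume "\<beta> i \<noteq> 0"
        hence "\<beta> - unit_exp i \<in> exponents n d" "\<beta> = (\<beta> - unit_exp i) + unit_exp i"
          using exponents_remove_unit[of \<beta> n d i] b by auto
        hence "(\<beta>, i) \<in> ?I" using b(2) by (intro image_eqI[of _ _ "(\<beta> - unit_exp i, i)"]) auto
        with b(3) show False by blast
      qed
    qed
  qed (use * in auto)
qed

lemma card_exponents: "card (exponents n d) = (d + n) choose n"
proof (induction d)
  case 0
  show ?case by (simp add: exponents_0)
next
  case (Suc d)
  have "Suc d * (Suc d + n choose n) = Suc (d + n) * (d + n choose n)"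
    using binomial_absorb_comp[of "Suc (d + n)" n] by simp
  also have "\<dots> = Suc d * card (exponents n (Suc d))"
    using card_exponents_Suc[of d n] Suc by simp
  finally show ?case using mult_left_cancel[of "Suc d"] by (simp only: nat.simps(3) not_False_eq_True)
qed

text \<open>Two monomials of the same degree are joined by exchanges of one variable for another,
  each moving a unit from a variable where \<open>\<alpha>\<close> exceeds the target
  \<open>\<beta>\<close> to one where it falls short.\<close>

lemma exchange_closed_full:
  assumes Y: "Y \<subseteq> exponents n d" "Y \<noteq> {}"
    and ex: "\<And>\<alpha> i l. \<alpha> \<in> Y \<Longrightarrow> i \<le> n \<Longrightarrow> \<alpha> l > 0 \<Longrightarrow> l \<noteq> i \<Longrightarrow> \<alpha> + unit_exp i - unit_exp l \<in> Y"
  shows "Y = exponents n d"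
proof (rule ccontr)
  assume "Y \<noteq> exponents n d"
  then obtain \<beta> where \<beta>: "\<beta> \<in> exponents n d" "\<beta> \<notin> Y" using Y by auto
  \<comment> \<open>The measure is the total excess over \<open>\<beta>\<close>; truncated
    subtraction discards the deficits.\<close>
  have "\<alpha> \<in> Y \<Longrightarrow> (\<Sum>i\<le>n. \<alpha> i - \<beta> i) = m \<Longrightarrow> False" for \<alpha> m
  proof (induction m arbitrary: \<alpha>)
    case 0
    hence le: "\<forall>i\<le>n. \<alpha> i \<le> \<beta> i" by simp
    have "\<alpha> \<in> exponents n d" using 0 Y by auto
    hence s: "(\<Sum>i\<le>n. \<alpha> i) = (\<Sum>i\<le>n. \<beta> i)" using \<beta>(1) by (simp add: exponents_def)
    have "\<alpha> i = \<beta> i" for i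
    proof (cases "i \<le> n")
      case True
      show ?thesis
      proof (rule ccontr)
        assume "\<alpha> i \<noteq> \<beta> i"
        hence "(\<Sum>i\<le>n. \<alpha> i) < (\<Sum>i\<le>n. \<beta> i)" using le True
          by (intro sum_strict_mono_ex1) (auto intro!: bexI[of _ i] simp: order.strict_iff_order)
        with s show False by simp
      qed
    qed (use \<beta>(1) \<open>\<alpha> \<in> exponents n d\<close> in \<open>auto simp: exponents_def\<close>)
    hence "\<alpha> = \<beta>" by auto
    thus False using \<beta> 0 by auto
  next
    case (Suc m)
    have "\<alpha> \<in> exponents n d" using Suc.prems Y by auto
    hence s: "(\<Sum>i\<le>n. \<alpha> i) = (\<Sum>i\<le>n. \<beta> i)" using \<beta>(1) by (simp add: exponents_def)
    have "\<exists>l\<le>n. \<alpha> l > \<beta> l"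
    proof (rule ccontr)
      assume "\<not> ?thesis"
      hence "(\<Sum>i\<le>n. \<alpha> i - \<beta> i) = 0" by auto
      thus False using Suc.prems by simp
    qed
    then obtain l where l: "l \<le> n" "\<alpha> l > \<beta> l" by auto
    have "\<exists>i\<le>n. \<alpha> i < \<beta> i"
    proof (rule ccontr)
      assume "\<not> ?thesis"
      hence "(\<Sum>i\<le>n. \<beta> i) < (\<Sum>i\<le>n. \<alpha> i)" using l
        by (intro sum_strict_mono_ex1) (auto simp: not_less)
      thus False using s by simp
    qed
    then obtain i where i: "i \<le> n" "\<alpha> i < \<beta> i" by auto
    have il: "i \<noteq> l" using i l by auto
    let ?\<alpha> = "\<alpha> + unit_exp i - unit_exp l"
    have "?\<alpha> \<in> Y" by (rule ex) (use Suc.prems i l il in auto)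
    moreover have "(\<Sum>j\<le>n. ?\<alpha> j - \<beta> j) = m"
    proof -
      have "(\<Sum>j\<le>n. \<alpha> j - \<beta> j) = (\<alpha> l - \<beta> l) + (\<Sum>j\<in>{..n}-{l}. \<alpha> j - \<beta> j)"
        using l by (subst sum.remove[of _ l]) auto
      moreover have "(\<Sum>j\<le>n. ?\<alpha> j - \<beta> j) = (?\<alpha> l - \<beta> l) + (\<Sum>j\<in>{..n}-{l}. ?\<alpha> j - \<beta> j)"
        using l by (subst sum.remove[of _ l]) auto
      moreover have "(\<Sum>j\<in>{..n}-{l}. ?\<alpha> j - \<beta> j) = (\<Sum>j\<in>{..n}-{l}. \<alpha> j - \<beta> j)"
        using i by (intro sum.cong) (auto simp: unit_exp_def)
      moreover have "?\<alpha> l = \<alpha> l - 1" using il by (auto simp: unit_exp_def)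
      ultimately show ?thesis using Suc.prems l by simp
    qed
    ultimately show False using Suc.IH by blast
  qed
  thus False using Y(2) by blast
qed

text \<open>Some exchange leaves \<open>Y\<close>. It yields the pair
  \<open>(\<alpha> + unit_exp i, l)\<close>, of positive weight and with its upper end in the
  shadow, whose lower end is outside \<open>Y\<close>; this pair makes \<open>up_shadow_1_le\<close>
  strict.\<close>

lemma up_shadow_1_less:
  assumes Y: "Y \<subseteq> exponents n d" "Y \<noteq> {}" "Y \<noteq> exponents n d"
  shows "(d + n + 1) * card Y < (d + 1) * card (up_shadow n 1 Y)"
proof -
  note * = up_shadow_1_weight[OF Y(1)]
  let ?I = "(\<lambda>(\<alpha>, i). (\<alpha> + unit_exp i, i)) ` (Y \<times> {..n})"
  obtain \<alpha> i l where a: "\<alpha> \<in> Y" "i \<le> n" "\<alpha> l > 0" "l \<noteq> i" "\<alpha> + unit_exp i - unit_exp l \<notin> Y"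
    using exchange_closed_full[OF Y(1,2)] Y(3) by metis
  have "\<alpha> \<in> exponents n d" using a Y by auto
  hence l: "l \<le> n" using a(3) by (auto simp: exponents_def) (metis not_le less_numeral_extra(3))
  let ?\<beta> = "\<alpha> + unit_exp i"
  have "?\<beta> \<in> up_shadow n 1 Y" using a unit_exp_in by (auto simp: up_shadow_def)
  moreover have "(?\<beta>, l) \<notin> ?I"
  proof
    assume "(?\<beta>, l) \<in> ?I"
    then obtain \<alpha>' where "\<alpha>' \<in> Y" "?\<beta> = \<alpha>' + unit_exp l" by auto
    moreover from this have "?\<beta> - unit_exp l = \<alpha>'" by auto
    ultimately show False using a by auto
  qed
  ultimately show ?thesis unfolding *(1) *(2)[symmetric]
    using l a(3,4) * by (intro sum_strict_mono2[of _ _ "(?\<beta>, l)"]) auto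
qed

text \<open>The density does not drop in any single step; cross multiplication avoids
  quotients.\<close>

lemma card_up_shadow_le:
  assumes "Y \<subseteq> exponents n d"
  shows "card Y * card (exponents n (d + k)) \<le> card (up_shadow n k Y) * card (exponents n d)"
  using assms
proof (induction k)
  case 0
  show ?case by simp
next
  case (Suc k)
  let ?Z = "up_shadow n k Y"
  let ?D = "\<lambda>k. card (exponents n k)"
  have Z: "?Z \<subseteq> exponents n (d + k)" by (rule up_shadow_subset[OF Suc.prems])
  have c: "(d + k + n + 1) * ?D (d + k) = (d + k + 1) * ?D (d + Suc k)"
    using card_exponents_Suc[of "d + k" n] by simp
  have "(d + k + 1) * (card Y * ?D (d + Suc k)) = card Y * ((d + k + n + 1) * ?D (d + k))"
    unfolding c by (rule mult.left_commute)
  also have "\<dots> \<le> (d + k + n + 1) * (card ?Z * ?D d)"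
    using mult_le_mono2[OF Suc.IH[OF Suc.prems], of "d + k + n + 1"]
    by (simp only: mult.left_commute[of "card Y"])
  also have "\<dots> = ((d + k + n + 1) * card ?Z) * ?D d" by (simp only: mult.assoc)
  also have "\<dots> \<le> ((d + k + 1) * card (up_shadow n 1 ?Z)) * ?D d"
    by (rule mult_le_mono1[OF up_shadow_1_le[OF Z]])
  also have "up_shadow n 1 ?Z = up_shadow n (Suc k) Y"
    using up_shadow_add[of n k 1 Y] by simp
  finally have "(d + k + 1) * (card Y * ?D (d + Suc k)) \<le> (d + k + 1) * (card (up_shadow n (Suc k) Y) * ?D d)"
    by (simp only: mult.assoc)
  thus ?case by (simp only: mult_le_cancel1)
qed

text \<open>The first step gains strictly and the later ones do not lose.\<close>

lemma card_up_shadow_less: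
  assumes Y: "Y \<subseteq> exponents n d" "Y \<noteq> {}" "Y \<noteq> exponents n d" and k: "k > 0"
  shows "card Y * card (exponents n (d + k)) < card (up_shadow n k Y) * card (exponents n d)"
proof -
  let ?D = "\<lambda>k. card (exponents n k)"
  obtain m where m: "k = 1 + m" using k by (metis Suc_pred plus_1_eq_Suc)
  let ?Z = "up_shadow n 1 Y"
  have Z: "?Z \<subseteq> exponents n (d + 1)" by (rule up_shadow_subset[OF Y(1)])
  have "(d + 1) * (card Y * ?D (d + 1)) = card Y * ((d + n + 1) * ?D d)"
    unfolding card_exponents_Suc by (rule mult.left_commute)
  also have "\<dots> = ((d + n + 1) * card Y) * ?D d" by (simp only: mult_ac)
  also have "\<dots> < ((d + 1) * card ?Z) * ?D d"
    using up_shadow_1_less[OF Y] card_exponents_pos[of n d] by (rule mult_less_mono1)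
  finally have 1: "card Y * ?D (d + 1) < card ?Z * ?D d"
    by (simp only: mult.assoc mult_less_cancel1) 
  have "card ?Z * ?D (d + k) \<le> card (up_shadow n k Y) * ?D (d + 1)"
    using card_up_shadow_le[OF Z, of m] by (simp only: m up_shadow_add add.assoc)
  hence "card ?Z * ?D (d + k) * ?D d \<le> card (up_shadow n k Y) * ?D (d + 1) * ?D d" by (rule mult_le_mono1)
  moreover have "(card Y * ?D (d + 1)) * ?D (d + k) < (card ?Z * ?D d) * ?D (d + k)"
    by (rule mult_less_mono1[OF 1 card_exponents_pos])
  ultimately have "(card Y * ?D (d + 1)) * ?D (d + k) < card (up_shadow n k Y) * ?D (d + 1) * ?D d"
    by (simp only: mult.commute[of _ "?D d"] mult.assoc mult.left_commute[of _ "?D d"])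
  hence "?D (d + 1) * (card Y * ?D (d + k)) < ?D (d + 1) * (card (up_shadow n k Y) * ?D d)"
    by (simp only: mult_ac)
  thus ?thesis by (simp only: mult_less_cancel1)
qed

text \<open>The up-shadow inequality is applied to complements: the monomials of degree
  \<open>d\<close> outside \<open>Z\<close> have no multiple in \<open>Y\<close>, so their shadow
  lies in the complement of \<open>Y\<close>.\<close>

lemma card_down_shadow_le:
  assumes Y: "Y \<subseteq> exponents n (d + k)"
  defines "Z \<equiv> {\<alpha>\<in>exponents n d. \<exists>\<gamma>\<in>exponents n k. \<alpha> + \<gamma> \<in> Y}"
  shows "card Y * card (exponents n d) \<le> card Z * card (exponents n (d + k))"
proof -
  let ?D = "\<lambda>k. card (exponents n k)"
  have Zs: "Z \<subseteq> exponents n d" by (auto simp: Z_def)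
  have "up_shadow n k (exponents n d - Z) \<subseteq> exponents n (d + k) - Y"
    by (auto simp: Z_def exponents_add elim!: up_shadowE simp del: plus_fun_apply)
  hence 1: "card (up_shadow n k (exponents n d - Z)) \<le> card (exponents n (d + k) - Y)"
    by (intro card_mono) auto
  have "card (exponents n d - Z) = ?D d - card Z" "card (exponents n (d + k) - Y) = ?D (d + k) - card Y"
    using Zs Y by (auto intro!: card_Diff_subset intro: finite_subset[OF _ finite_exponents])
  hence "(?D d - card Z) * ?D (d + k) \<le> (?D (d + k) - card Y) * ?D d"
    using order_trans[OF card_up_shadow_le[OF Diff_subset] mult_le_mono1[OF 1]] by (simp only:)
  moreover have "card Z \<le> ?D d" "card Y \<le> ?D (d + k)"
    using Y Zs by (auto intro: card_mono)
  moreover have "y * D \<le> z * E" if le: "(D - z) * E \<le> (E - y) * D" "z \<le> D" "y \<le> E" for y z D E :: nat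
  proof -
    obtain z' y' where "D = z + z'" "E = y + y'" using le(2,3) by (auto simp: le_iff_add)
    with le(1) show ?thesis by (simp add: algebra_simps)
  qed
  ultimately show ?thesis by blast
qed


text \<open>The exponents are read as digits in base \<open>B\<close>. As this is additive, it
  orders monomials compatibly with multiplication; it separates monomials of one degree below
  \<open>B\<close>.\<close>

definition key :: "nat \<Rightarrow> nat \<Rightarrow> (nat \<Rightarrow> nat) \<Rightarrow> nat" where
  "key n B \<alpha> = (\<Sum>i\<le>n. \<alpha> i * B ^ i)"

lemma key_add: "key n B (\<alpha> + \<gamma>) = key n B \<alpha> + key n B \<gamma>"
  by (simp add: key_def sum.distrib distrib_right)

lemma key_eqD:
  assumes "\<And>i. i \<le> n \<Longrightarrow> \<alpha> i < B" "\<And>i. i \<le> n \<Longrightarrow> \<beta> i < B" "key n B \<alpha> = key n B \<beta>" "i \<le> n"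
  shows "\<alpha> i = \<beta> i"
  using assms
proof (induction n arbitrary: \<alpha> \<beta> i)
  case 0
  thus ?case by (simp add: key_def)
next
  case (Suc n)
  have *: "key (Suc n) B \<gamma> = \<gamma> 0 + B * key n B (\<lambda>i. \<gamma> (Suc i))" for \<gamma>
    unfolding key_def by (subst sum.atMost_Suc_shift) (simp add: sum_distrib_left mult_ac)
  have "\<alpha> 0 < B" "\<beta> 0 < B" using Suc.prems by auto
  moreover have eq: "\<alpha> 0 + B * key n B (\<lambda>i. \<alpha> (Suc i)) = \<beta> 0 + B * key n B (\<lambda>i. \<beta> (Suc i))"
    using Suc.prems(3) by (simp add: *)
  ultimately have 0: "\<alpha> 0 = \<beta> 0"
    by (metis add.commute mod_less mod_mult_self4)
  hence "key n B (\<lambda>i. \<alpha> (Suc i)) = key n B (\<lambda>i. \<beta> (Suc i))" using eq \<open>\<alpha> 0 < B\<close> by simp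
  hence "i \<le> n \<Longrightarrow> \<alpha> (Suc i) = \<beta> (Suc i)" for i
    using Suc.IH[of "\<lambda>i. \<alpha> (Suc i)" "\<lambda>i. \<beta> (Suc i)" i] Suc.prems by auto
  thus ?case using 0 Suc.prems(4) by (cases i) auto
qed

lemma inj_on_key:
  assumes "k < B" shows "inj_on (key n B) (exponents n k)"
proof (intro inj_onI ext)
  fix \<alpha> \<beta> i assume *: "\<alpha> \<in> exponents n k" "\<beta> \<in> exponents n k" "key n B \<alpha> = key n B \<beta>"
  show "\<alpha> i = \<beta> i"
  proof (cases "i \<le> n")
    case True
    have "\<alpha> j < B" "\<beta> j < B" for j using exponents_le[of _ n k j] * assms by (auto intro: le_less_trans)
    thus ?thesis using key_eqD[OF _ _ *(3) True] by blast
  qed (use * in \<open>auto simp: exponents_def\<close>)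
qed

section \<open>Counting over finite fields\<close>

text \<open>A model of the vectors with entries in the field with \<open>p\<close> elements: every
  residue class has one representative, so cardinalities are counted over the field while the
  arithmetic stays in the integers.\<close>

definition box :: "nat \<Rightarrow> 'x set \<Rightarrow> ('x \<Rightarrow> int) set" where
  "box p X = X \<rightarrow>\<^sub>E {0..<int p}"

lemma finite_box [simp]: "finite X \<Longrightarrow> finite (box p X)"
  by (simp add: box_def finite_PiE)

lemma card_box: "finite X \<Longrightarrow> card (box p X) = p ^ card X"
  by (simp add: box_def card_PiE)

lemma boxD: "f \<in> box p X \<Longrightarrow> x \<in> X \<Longrightarrow> 0 \<le> f x \<and> f x < int p"
  by (auto simp: box_def PiE_iff)

lemma box_eqI:
  assumes "f \<in> box p X" "g \<in> box p X" "\<And>x. x \<in> X \<Longrightarrow> int p dvd f x - g x"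
  shows "f = g"
proof (rule PiE_ext)
  show "f \<in> X \<rightarrow>\<^sub>E {0..<int p}" "g \<in> X \<rightarrow>\<^sub>E {0..<int p}" using assms by (auto simp: box_def)
  fix x assume "x \<in> X"
  with assms(3) have "f x mod int p = g x mod int p" by (simp add: mod_eq_dvd_iff)
  thus "f x = g x" using boxD[OF assms(1) \<open>x \<in> X\<close>] boxD[OF assms(2) \<open>x \<in> X\<close>] by simp
qed

lemma restrict_mod_box: "p > 0 \<Longrightarrow> (\<lambda>x\<in>X. f x mod int p) \<in> box p X"
  by (auto simp: box_def)

lemma finite_max_key:
  fixes w :: "'x \<Rightarrow> nat"
  assumes "finite A" "A \<noteq> {}"
  obtains x where "x \<in> A" "\<And>y. y \<in> A \<Longrightarrow> w y \<le> w x"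
proof -
  have "Max (w ` A) \<in> w ` A" using assms by (intro Max_in) auto
  then obtain x where "x \<in> A" "w x = Max (w ` A)" by auto
  with that assms show ?thesis by auto
qed

text \<open>A subspace of \<open>F\<^sub>p\<^sup>X\<close> is represented by the set of all its integer lifts.  The key \<open>w\<close> orders
  the coordinates, and \<open>leads\<close> collects the leading coordinates of the elements.\<close>

definition leads :: "nat \<Rightarrow> 'x set \<Rightarrow> ('x \<Rightarrow> nat) \<Rightarrow> ('x \<Rightarrow> int) set \<Rightarrow> 'x set" where
  "leads p X w R = {x \<in> X. \<exists>f\<in>R. \<not> int p dvd f x \<and> (\<forall>y\<in>X. w x < w y \<longrightarrow> int p dvd f y)}"

text \<open>The row with pivot \<open>m\<close> in the reduced echelon form. Only its entries off
  the pivots are free, which bounds the number of subspaces with given leads.\<close>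

definition reduced :: "nat \<Rightarrow> 'x set \<Rightarrow> ('x \<Rightarrow> nat) \<Rightarrow> ('x \<Rightarrow> int) set \<Rightarrow> 'x \<Rightarrow> 'x \<Rightarrow> int" where
  "reduced p X w R m =
     (SOME f. f \<in> R \<and> f \<in> box p X \<and> (\<forall>x\<in>leads p X w R. f x = (if x = m then 1 else 0)))"

locale mod_space =
  fixes p :: nat and X :: "'x set" and w :: "'x \<Rightarrow> nat" and R :: "('x \<Rightarrow> int) set"
  assumes prime: "prime p" and finite_X: "finite X" and inj_w: "inj_on w X"
    and zero: "(\<lambda>_. 0) \<in> R"
    and add: "f \<in> R \<Longrightarrow> g \<in> R \<Longrightarrow> (\<lambda>x. f x + g x) \<in> R"
    and scale: "f \<in> R \<Longrightarrow> (\<lambda>x. c * f x) \<in> R"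
    and cong: "f \<in> R \<Longrightarrow> (\<And>x. x \<in> X \<Longrightarrow> int p dvd f x - g x) \<Longrightarrow> g \<in> R"
begin

abbreviation "L \<equiv> leads p X w R"
abbreviation "b \<equiv> reduced p X w R"

lemma leads_subset: "L \<subseteq> X"
  by (auto simp: leads_def)

lemma finite_leads: "finite L"
  using leads_subset finite_X finite_subset by blast

text \<open>Among the coordinates where \<open>f\<close> is nonzero modulo \<open>p\<close>, the one
  with the largest key is a lead.\<close>

lemma in_leads_max:
  assumes f: "f \<in> R" "x0 \<in> X" "\<not> int p dvd f x0"
  obtains x where "x \<in> L" "\<not> int p dvd f x" "w x0 \<le> w x"
proof -
  let ?A = "{x\<in>X. \<not> int p dvd f x}"
  have fin: "finite ?A" "?A \<noteq> {}" using finite_X f by auto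
  then obtain x where x: "x \<in> ?A" and max: "\<And>y. y \<in> ?A \<Longrightarrow> w y \<le> w x"
    by (rule finite_max_key[where w = w]) auto
  have "int p dvd f y" if "y \<in> X" "w x < w y" for y using max[of y] that by auto
  hence "x \<in> L" unfolding leads_def using x f(1) by blast
  with x max[of x0] f show ?thesis by (intro that[of x]) auto
qed

lemma dvd_of_leads:
  assumes "f \<in> R" "\<And>x. x \<in> L \<Longrightarrow> int p dvd f x" "x \<in> X"
  shows "int p dvd f x"
  using in_leads_max[of f x] assms by blast

text \<open>Bezout inverts the leading entry modulo \<open>p\<close>. The entries above it, so far
  only divisible by \<open>p\<close>, are replaced by exact zeros, which changes no residue.\<close>

lemma monic_lead:
  assumes "x \<in> L"
  obtains f where "f \<in> R" "f x = 1" "\<And>y. y \<in> X \<Longrightarrow> w x < w y \<Longrightarrow> f y = 0"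
proof -
  from assms obtain f where f: "f \<in> R" "\<not> int p dvd f x" "\<And>y. y \<in> X \<Longrightarrow> w x < w y \<Longrightarrow> int p dvd f y"
    and "x \<in> X"
    by (auto simp: leads_def)
  have "coprime (f x) (int p)"
    using prime f(2) prime_imp_coprime[of "int p" "f x"] by (simp add: coprime_commute)
  then obtain c d where cd: "c * f x + d * int p = 1"
    by (metis bezout_int coprime_imp_gcd_eq_1)
  define g where "g y = (if y = x then 1 else if w x < w y then 0 else c * f y)" for y
  have "g \<in> R"
  proof (rule cong[OF scale[OF f(1), of c]])
    fix y assume y: "y \<in> X"
    have "c * f x - 1 = (- d) * int p" using cd by (simp add: algebra_simps)
    hence "int p dvd c * f x - 1" by (metis dvd_triv_right)
    thus "int p dvd c * f y - g y" using f(3)[OF y] by (auto simp: g_def)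
  qed
  thus ?thesis by (rule that) (auto simp: g_def)
qed

lemma interpolate:
  obtains f where "f \<in> R" "\<And>x. x \<in> L \<Longrightarrow> f x = h x"
proof -
  \<comment> \<open>Leads are added in increasing order of key. The vanishing above \<open>A\<close>
    is carried along so that the function found for \<open>A\<close> is zero at the next lead, where
    the multiple of \<open>g\<close> alone sets the value.\<close>
  have "\<exists>f\<in>R. (\<forall>x\<in>A. f x = h x) \<and> (\<forall>y\<in>X. (\<forall>x\<in>A. w x < w y) \<longrightarrow> f y = 0)" if "finite A" "A \<subseteq> L" for A h
    using that
  proof (induction A arbitrary: h rule: finite_ranking_induct[where f = w])
    case empty
    show ?case using zero by auto
  next
    case (insert x A)
    show ?case
    proof (cases "x \<in> A")
      case True
      thus ?thesis using insert by (simp add: insert_absorb)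
    next
      case False
      obtain g where g: "g \<in> R" "g x = 1" "\<And>y. y \<in> X \<Longrightarrow> w x < w y \<Longrightarrow> g y = 0"
        using monic_lead[of x] insert.prems by auto
      obtain f where f: "f \<in> R" "\<And>y. y \<in> A \<Longrightarrow> f y = h y - h x * g y"
          "\<And>y. y \<in> X \<Longrightarrow> (\<forall>x\<in>A. w x < w y) \<Longrightarrow> f y = 0"
        using insert.IH[of "\<lambda>y. h y - h x * g y"] insert.prems by blast
      have less: "w y < w x" if "y \<in> A" for y
      proof -
        have "w y \<noteq> w x" using inj_w that False insert.prems leads_subset
          by (metis inj_on_def insert_subset subset_iff)
        thus ?thesis using insert.hyps(2)[OF that] by simp
      qed
      have "(\<lambda>y. h x * g y + f y) \<in> R" by (intro add scale g f)
      moreover have "f x = 0" by (rule f(3)) (use insert.prems leads_subset less in auto)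
      ultimately show ?thesis using g f
        by (intro bexI[of _ "\<lambda>y. h x * g y + f y"]) auto
    qed
  qed
  from this[OF finite_leads order.refl, of h] that show ?thesis by blast
qed

lemma reduced:
  shows "b m \<in> R" "b m \<in> box p X" "\<And>x. x \<in> L \<Longrightarrow> b m x = (if x = m then 1 else 0)"
proof -
  obtain f where f: "f \<in> R" "\<And>x. x \<in> L \<Longrightarrow> f x = (if x = m then 1 else 0)"
    using interpolate[of "\<lambda>x. if x = m then 1 else 0"] by blast
  have p: "p > 1" using prime by (rule prime_gt_1_nat)
  let ?g = "\<lambda>x\<in>X. f x mod int p"
  have "?g \<in> R" by (rule cong[OF f(1)]) (auto simp: mod_eq_dvd_iff[symmetric])
  moreover have "?g \<in> box p X" using p by (intro restrict_mod_box) auto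
  moreover have "\<forall>x\<in>L. ?g x = (if x = m then 1 else 0)" using f(2) leads_subset p by auto
  ultimately have "\<exists>f. f \<in> R \<and> f \<in> box p X \<and> (\<forall>x\<in>L. f x = (if x = m then 1 else 0))" by blast
  hence "b m \<in> R \<and> b m \<in> box p X \<and> (\<forall>x\<in>L. b m x = (if x = m then 1 else 0))"
    unfolding reduced_def by (rule someI_ex)
  thus "b m \<in> R" "b m \<in> box p X" "\<And>x. x \<in> L \<Longrightarrow> b m x = (if x = m then 1 else 0)" by auto
qed

text \<open>A nonzero residue above \<open>m\<close> would produce a lead other than
  \<open>m\<close> at which \<open>b m\<close> does not vanish.\<close>

lemma reduced_above:
  assumes "x \<in> X" "w m < w x" shows "int p dvd b m x"
proof (rule ccontr)
  assume "\<not> int p dvd b m x"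
  then obtain y where "y \<in> L" "\<not> int p dvd b m y" "w x \<le> w y"
    using in_leads_max[OF reduced(1) assms(1)] by blast
  with reduced(3)[OF this(1), of m] assms show False by (auto split: if_splits)
qed

lemma sum_in: "finite A \<Longrightarrow> (\<And>i. i \<in> A \<Longrightarrow> f i \<in> R) \<Longrightarrow> (\<lambda>x. \<Sum>i\<in>A. f i x) \<in> R"
  by (induction A rule: finite_induct) (auto simp: zero add)

text \<open>The difference lies in \<open>R\<close> and vanishes at every lead, so it is zero modulo
  \<open>p\<close> everywhere.\<close>

lemma expand:
  assumes "f \<in> R" "x \<in> X" shows "int p dvd f x - (\<Sum>m\<in>L. f m * b m x)"
proof (rule dvd_of_leads[OF _ _ assms(2)])
  have "(\<lambda>x. f x + (- 1) * (\<Sum>m\<in>L. f m * b m x)) \<in> R"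
    by (intro add scale sum_in reduced assms finite_leads)
  thus "(\<lambda>x. f x - (\<Sum>m\<in>L. f m * b m x)) \<in> R" by simp
next
  fix x assume x: "x \<in> L"
  have "(\<Sum>m\<in>L. f m * b m x) = (\<Sum>m\<in>L. if m = x then f m else 0)"
    using reduced(3)[OF x] by (intro sum.cong) auto
  thus "int p dvd f x - (\<Sum>m\<in>L. f m * b m x)" using x finite_leads by simp
qed

end

section \<open>Spans of finite families and kernel counts\<close>

definition span_mod :: "nat \<Rightarrow> 'x set \<Rightarrow> 'u set \<Rightarrow> ('u \<Rightarrow> 'x \<Rightarrow> int) \<Rightarrow> ('x \<Rightarrow> int) set" where
  "span_mod p X A \<phi> = {f. \<exists>a. \<forall>x\<in>X. int p dvd f x - (\<Sum>u\<in>A. a u * \<phi> u x)}"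

lemma mod_space_span:
  assumes "prime p" "finite X" "inj_on w X"
  shows "mod_space p X w (span_mod p X A \<phi>)"
proof
  show "(\<lambda>_. 0) \<in> span_mod p X A \<phi>"
    unfolding span_mod_def by (intro CollectI exI[of _ "\<lambda>_. 0"]) auto
next
  fix f g assume "f \<in> span_mod p X A \<phi>" "g \<in> span_mod p X A \<phi>"
  then obtain a a' where a: "\<And>x. x \<in> X \<Longrightarrow> int p dvd f x - (\<Sum>u\<in>A. a u * \<phi> u x)"
     "\<And>x. x \<in> X \<Longrightarrow> int p dvd g x - (\<Sum>u\<in>A. a' u * \<phi> u x)" by (auto simp: span_mod_def)
  have "int p dvd f x + g x - (\<Sum>u\<in>A. (a u + a' u) * \<phi> u x)" if "x \<in> X" for x
    using dvd_add[OF a(1)[OF that] a(2)[OF that]] by (simp add: sum.distrib algebra_simps)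
  thus "(\<lambda>x. f x + g x) \<in> span_mod p X A \<phi>"
    unfolding span_mod_def by (intro CollectI exI[of _ "\<lambda>u. a u + a' u"]) auto
next
  fix f c assume "f \<in> span_mod p X A \<phi>"
  then obtain a where a: "\<And>x. x \<in> X \<Longrightarrow> int p dvd f x - (\<Sum>u\<in>A. a u * \<phi> u x)"
    by (auto simp: span_mod_def)
  have "int p dvd c * f x - (\<Sum>u\<in>A. (c * a u) * \<phi> u x)" if "x \<in> X" for x
    using dvd_mult[OF a[OF that], of c] by (simp add: sum_distrib_left algebra_simps)
  thus "(\<lambda>x. c * f x) \<in> span_mod p X A \<phi>"
    unfolding span_mod_def by (intro CollectI exI[of _ "\<lambda>u. c * a u"]) auto
next
  fix f g assume "f \<in> span_mod p X A \<phi>" and fg: "\<And>x. x \<in> X \<Longrightarrow> int p dvd f x - g x"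
  then obtain a where a: "\<And>x. x \<in> X \<Longrightarrow> int p dvd f x - (\<Sum>u\<in>A. a u * \<phi> u x)"
    by (auto simp: span_mod_def)
  have "int p dvd g x - (\<Sum>u\<in>A. a u * \<phi> u x)" if "x \<in> X" for x
    using dvd_diff[OF a[OF that] fg[OF that]] by simp
  thus "g \<in> span_mod p X A \<phi>"
    unfolding span_mod_def by (intro CollectI exI[of _ a]) auto
qed (use assms in auto)

lemma span_mod_base:
  assumes "finite A" "u \<in> A" shows "\<phi> u \<in> span_mod p X A \<phi>"
proof -
  have "(\<Sum>v\<in>A. (if v = u then 1 else 0) * \<phi> v x) = \<phi> u x" for x
    using assms by (subst sum.remove[of _ u]) auto
  thus ?thesis unfolding span_mod_def
    by (intro CollectI exI[of _ "\<lambda>v. if v = u then 1 else 0"]) auto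
qed

text \<open>The vectors \<open>v s\<close> make the conditions indexed by \<open>S\<close>
  triangular with invertible diagonal, hence independent. Instead of a rank, an injection is used: a
  kernel element plus a combination of the \<open>v s\<close> determines both. Different indices may
  share a key as long as the entries between them vanish.\<close>

lemma card_kernel_triangular:
  fixes \<tau> :: "'g \<Rightarrow> 'q \<Rightarrow> int" and w :: "'q \<Rightarrow> nat"
  assumes p: "prime p" and fin: "finite G" "finite S"
  defines "T \<equiv> \<lambda>c q. \<Sum>g\<in>G. c g * \<tau> g q"
  assumes ex: "\<And>s. s \<in> S \<Longrightarrow> \<exists>v. \<not> int p dvd T v s \<and>
    (\<forall>s'\<in>S. s' \<noteq> s \<longrightarrow> w s \<le> w s' \<longrightarrow> int p dvd T v s')"
  shows "card {c \<in> box p G. \<forall>q\<in>S. int p dvd T c q} * p ^ card S \<le> p ^ card G"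
proof -
  from ex have "\<forall>s\<in>S. \<exists>v. \<not> int p dvd T v s \<and> (\<forall>s'\<in>S. s' \<noteq> s \<longrightarrow> w s \<le> w s' \<longrightarrow> int p dvd T v s')"
    by blast
  from bchoice[OF this] obtain v where "\<forall>s\<in>S. \<not> int p dvd T (v s) s \<and>
    (\<forall>s'\<in>S. s' \<noteq> s \<longrightarrow> w s \<le> w s' \<longrightarrow> int p dvd T (v s) s')" ..
  hence diag: "\<And>s. s \<in> S \<Longrightarrow> \<not> int p dvd T (v s) s"
    and above: "\<And>s s'. s \<in> S \<Longrightarrow> s' \<in> S \<Longrightarrow> s' \<noteq> s \<Longrightarrow> w s \<le> w s' \<Longrightarrow> int p dvd T (v s) s'"
    by blast+
  let ?K = "{c \<in> box p G. \<forall>q\<in>S. int p dvd T c q}"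
  let ?c = "\<lambda>c a g. c g + (\<Sum>s\<in>S. a s * v s g)"
  define F where "F = (\<lambda>(c, a). \<lambda>g\<in>G. ?c c a g mod int p)"
  have p0: "p > 0" using p by (simp add: prime_gt_0_nat)
  have Tsum: "T (?c c a) q = T c q + (\<Sum>s\<in>S. a s * T (v s) q)" for c a q
  proof -
    have "T (?c c a) q = T c q + (\<Sum>g\<in>G. \<Sum>s\<in>S. a s * (v s g * \<tau> g q))"
      by (simp add: T_def algebra_simps sum.distrib sum_distrib_left sum_distrib_right)
    also have "(\<Sum>g\<in>G. \<Sum>s\<in>S. a s * (v s g * \<tau> g q)) = (\<Sum>s\<in>S. \<Sum>g\<in>G. a s * (v s g * \<tau> g q))"
      by (rule sum.swap)
    also have "\<dots> = (\<Sum>s\<in>S. a s * T (v s) q)" by (simp add: T_def sum_distrib_left)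
    finally show ?thesis .
  qed
  have "inj_on F (?K \<times> box p S)"
  proof (rule inj_onI, clarify)
    fix c a c' a'
    assume c: "c \<in> box p G" "\<forall>q\<in>S. int p dvd T c q" and c': "c' \<in> box p G" "\<forall>q\<in>S. int p dvd T c' q"
      and a: "a \<in> box p S" and a': "a' \<in> box p S" and eq: "F (c, a) = F (c', a')"
    have g: "int p dvd ?c c a g - ?c c' a' g" if "g \<in> G" for g
      using fun_cong[OF eq, of g] that by (simp add: F_def mod_eq_dvd_iff)
    have T: "int p dvd (\<Sum>s\<in>S. (a s - a' s) * T (v s) q)" if q: "q \<in> S" for q
    proof -
      have "T (?c c a) q - T (?c c' a') q = (\<Sum>g\<in>G. (?c c a g - ?c c' a' g) * \<tau> g q)"
        unfolding T_def by (simp only: sum_subtractf left_diff_distrib)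
      also have "int p dvd \<dots>" using g by (intro dvd_sum) auto
      finally have "int p dvd (T c q - T c' q) + (\<Sum>s\<in>S. (a s - a' s) * T (v s) q)"
        unfolding Tsum by (simp add: sum_subtractf left_diff_distrib algebra_simps)
      moreover have "int p dvd T c q - T c' q" using c c' q by auto
      ultimately show ?thesis by (metis dvd_add_right_iff)
    qed
    \<comment> \<open>At the largest key where the two combinations differ only the diagonal term
      survives: elsewhere the coefficients agree modulo \<open>p\<close> or triangularity
      applies.\<close>
    have aa': "int p dvd a s - a' s" if s: "s \<in> S" for s
    proof (rule ccontr)
      assume "\<not> int p dvd a s - a' s"
      let ?A = "{s\<in>S. \<not> int p dvd a s - a' s}"
      have A: "finite ?A" "?A \<noteq> {}" using fin s \<open>\<not> _\<close> by auto
      then obtain t where t: "t \<in> ?A" and max: "\<And>y. y \<in> ?A \<Longrightarrow> w y \<le> w t"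
        by (rule finite_max_key[where w = w]) auto
      have "(\<Sum>s\<in>S. (a s - a' s) * T (v s) t)
          = (a t - a' t) * T (v t) t + (\<Sum>s\<in>S - {t}. (a s - a' s) * T (v s) t)"
        using t fin by (intro sum.remove) auto
      moreover have "int p dvd (\<Sum>s\<in>S - {t}. (a s - a' s) * T (v s) t)"
      proof (rule dvd_sum)
        fix s assume s: "s \<in> S - {t}"
        show "int p dvd (a s - a' s) * T (v s) t"
        proof (cases "s \<in> ?A")
          case True
          thus ?thesis using above[of s t] t s max[OF True] by auto
        qed (use s in auto)
      qed
      moreover have "int p dvd (\<Sum>s\<in>S. (a s - a' s) * T (v s) t)" using T t by blast
      ultimately have "int p dvd (a t - a' t) * T (v t) t" by (simp add: dvd_add_left_iff)
      with p t diag[of t] show False by (auto simp: prime_dvd_mult_iff)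
    qed
    have "a = a'" by (rule box_eqI[OF a a' aa'])
    moreover from this g have "c = c'" by (intro box_eqI[OF c(1) c'(1)]) auto
    ultimately show "c = c' \<and> a = a'" by simp
  qed
  moreover have "F ` (?K \<times> box p S) \<subseteq> box p G"
    using restrict_mod_box[OF p0] by (auto simp: F_def)
  ultimately have "card (?K \<times> box p S) \<le> card (box p G)"
    using fin by (intro card_inj_on_le) auto
  thus ?thesis using fin by (simp add: card_cartesian_product card_box)
qed

text \<open>A dimension count over the field with \<open>p\<close> elements.  A bad \<open>c\<close> has at least \<open>p - 1\<close> kernel vectors,
  as these may be scaled, and this exceeds the number of types.\<close>

lemma exists_trivial_kernel:
  fixes ker :: "('k \<Rightarrow> int) \<Rightarrow> ('g \<Rightarrow> int) \<Rightarrow> bool" and \<tau> :: "('k \<Rightarrow> int) \<Rightarrow> 't"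
  assumes p: "prime p" and fin: "finite G" "finite K" "finite Ty" and Ty: "card Ty < p - 1"
  defines "nonzero \<equiv> \<lambda>k. k \<in> box p K \<and> (\<exists>x\<in>K. k x \<noteq> 0)"
  assumes scale: "\<And>k c m. k \<in> box p K \<Longrightarrow> ker k c \<Longrightarrow> ker (\<lambda>x\<in>K. m * k x mod int p) c"
    and type: "\<And>k. nonzero k \<Longrightarrow> \<tau> k \<in> Ty"
    and fam: "\<And>t. t \<in> Ty \<Longrightarrow> card {k. nonzero k \<and> \<tau> k = t} \<le> p ^ fam t"
    and cod: "\<And>k. nonzero k \<Longrightarrow> card {c \<in> box p G. ker k c} * p ^ fam (\<tau> k) \<le> p ^ card G"
  shows "\<exists>c\<in>box p G. \<forall>k. nonzero k \<longrightarrow> \<not> ker k c"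
proof (rule ccontr)
  assume "\<not> ?thesis"
  then obtain \<kappa> where \<kappa>: "\<And>c. c \<in> box p G \<Longrightarrow> nonzero (\<kappa> c) \<and> ker (\<kappa> c) c"
    by metis
  have p0: "p > 0" using p by (simp add: prime_gt_0_nat)
  let ?N = "{k. nonzero k}"
  have finN: "finite ?N" using fin by (auto simp: nonzero_def intro: finite_subset[OF _ finite_box[of K p]])
  let ?P = "SIGMA k:?N. {c \<in> box p G. ker k c}"
  define F where "F = (\<lambda>(c, m). (\<lambda>x\<in>K. m * \<kappa> c x mod int p, c))"
  have F: "inj_on F (box p G \<times> {1..<int p})"
  proof (rule inj_onI, clarify)
    fix c m c' m'
    assume c: "c \<in> box p G" and m: "m \<in> {1..<int p}" "m' \<in> {1..<int p}" and eq: "F (c, m) = F (c', m')"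
    have cc: "c = c'" using eq by (auto simp: F_def)
    obtain x where x: "x \<in> K" "\<kappa> c x \<noteq> 0" "\<kappa> c \<in> box p K" using \<kappa>[OF c] by (auto simp: nonzero_def)
    have "fst (F (c, m)) x = fst (F (c, m')) x" using eq cc by (simp only:)
    hence "m * \<kappa> c x mod int p = m' * \<kappa> c x mod int p"
      using x(1) by (simp add: F_def)
    hence "int p dvd (m - m') * \<kappa> c x" by (simp add: mod_eq_dvd_iff left_diff_distrib)
    moreover have "\<not> int p dvd \<kappa> c x" using boxD[OF x(3,1)] x(2) zdvd_not_zless[of "\<kappa> c x" "int p"] by auto
    ultimately have "int p dvd m - m'" using p by (simp add: prime_dvd_mult_iff)
    hence "m mod int p = m' mod int p" by (simp add: mod_eq_dvd_iff)
    thus "c = c' \<and> m = m'" using m cc by auto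
  qed
  have "F ` (box p G \<times> {1..<int p}) \<subseteq> ?P"
  proof (rule image_subsetI)
    fix z assume "z \<in> box p G \<times> {1..<int p}"
    then obtain c m where z: "z = (c, m)" and c: "c \<in> box p G" and m: "m \<in> {1..<int p}" by blast
    obtain x where x: "x \<in> K" "\<kappa> c x \<noteq> 0" "\<kappa> c \<in> box p K" using \<kappa>[OF c] by (auto simp: nonzero_def)
    have "\<not> int p dvd \<kappa> c x" "\<not> int p dvd m"
      using boxD[OF x(3,1)] x(2) m zdvd_not_zless[of "\<kappa> c x" "int p"] zdvd_not_zless[of m "int p"] by auto
    hence "m * \<kappa> c x mod int p \<noteq> 0" using p by (simp add: dvd_eq_mod_eq_0[symmetric] prime_dvd_mult_iff)
    hence "nonzero (\<lambda>x\<in>K. m * \<kappa> c x mod int p)"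
      using x(1) restrict_mod_box[OF p0] by (auto simp: nonzero_def)
    thus "F z \<in> ?P"
      using z c scale[of "\<kappa> c" c m] \<kappa>[OF c] x by (auto simp: F_def)
  qed
  hence "card (box p G \<times> {1..<int p}) \<le> card ?P"
    using F finN fin by (intro card_inj_on_le) auto
  hence "p ^ card G * (p - 1) \<le> card ?P"
    using fin p0 by (simp add: card_cartesian_product card_box nat_diff_distrib)
  also have "card ?P = (\<Sum>k\<in>?N. card {c \<in> box p G. ker k c})"
    using finN fin by (subst card_SigmaI) auto
  \<comment> \<open>Within one type the size of the family cancels against the codimension, so a
    type accounts for at most \<open>p ^ card G\<close> pairs.\<close>
  also have "\<dots> = (\<Sum>t\<in>Ty. \<Sum>k\<in>{k\<in>?N. \<tau> k = t}. card {c \<in> box p G. ker k c})"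
    using finN fin type by (intro sum.group[symmetric]) auto
  also have "\<dots> \<le> (\<Sum>t\<in>Ty. p ^ card G)"
  proof (rule sum_mono)
    fix t assume t: "t \<in> Ty"
    have "(\<Sum>k\<in>{k\<in>?N. \<tau> k = t}. card {c \<in> box p G. ker k c}) * p ^ fam t
        = (\<Sum>k\<in>{k\<in>?N. \<tau> k = t}. card {c \<in> box p G. ker k c} * p ^ fam (\<tau> k))"
      by (simp add: sum_distrib_right)
    also have "\<dots> \<le> (\<Sum>k\<in>{k\<in>?N. \<tau> k = t}. p ^ card G)"
      by (rule sum_mono) (use cod in auto)
    also have "\<dots> \<le> p ^ fam t * p ^ card G"
      using fam[OF t] by simp
    finally show "(\<Sum>k\<in>{k\<in>?N. \<tau> k = t}. card {c \<in> box p G. ker k c}) \<le> p ^ card G"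
      using p0 by (simp add: mult.commute)
  qed
  also have "\<dots> = p ^ card G * card Ty" by simp
  finally show False using Ty p0 by simp
qed

lemma dvd_sum_scaled:
  assumes "int p dvd (\<Sum>x\<in>K. A x * k x)"
  shows "int p dvd (\<Sum>x\<in>K. A x * (\<lambda>x\<in>K. m * k x mod int p) x)"
proof -
  have "int p dvd (\<Sum>x\<in>K. A x * (m * k x mod int p - m * k x))"
    by (intro dvd_sum dvd_mult) (simp add: mod_eq_dvd_iff[symmetric])
  from dvd_add[OF this dvd_mult[OF assms, of m]] show ?thesis
    by (simp add: sum_distrib_left sum.distrib[symmetric] algebra_simps)
qed

text \<open>Reducing an integer vector into the box changes no residue, so a statement about boxes
  extends to all integer lifts.\<close>

lemma dvd_lift:
  assumes "prime p" and "finite K"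
    and box: "\<And>k. k \<in> box p K \<Longrightarrow> (\<exists>x\<in>K. k x \<noteq> 0) \<Longrightarrow> \<exists>q\<in>R. \<not> int p dvd (\<Sum>x\<in>K. A x q * k x)"
    and k: "\<And>q. q \<in> R \<Longrightarrow> int p dvd (\<Sum>x\<in>K. A x q * k x)" and x: "x \<in> K"
  shows "int p dvd k x"
proof (rule ccontr)
  assume not: "\<not> int p dvd k x"
  let ?k = "\<lambda>x\<in>K. k x mod int p"
  have "?k \<in> box p K" using assms(1) by (intro restrict_mod_box) (simp add: prime_gt_0_nat)
  moreover have "?k x \<noteq> 0" using not x by (simp add: dvd_eq_mod_eq_0)
  ultimately obtain q where q: "q \<in> R" "\<not> int p dvd (\<Sum>x\<in>K. A x q * ?k x)" using box[of ?k] x by blast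
  have "int p dvd (\<Sum>x\<in>K. A x q * k x) - (\<Sum>x\<in>K. A x q * ?k x)"
    unfolding sum_subtractf[symmetric] right_diff_distrib[symmetric]
    by (intro dvd_sum dvd_mult) (simp add: mod_eq_dvd_iff[symmetric])
  with q k[OF q(1)] show False by (metis dvd_diff_commute dvd_add_right_iff diff_add_cancel add.commute)
qed

text \<open>The common form of both counts: \<open>k\<close> is a vector of the source for
  injectivity and a functional on the target for surjectivity. What has to be supplied is that the
  dimension \<open>fam\<close> of a stratum is at most the codimension \<open>m\<close> of the
  matrices that kill a given member.\<close>

lemma exists_injective_mod_p:
  fixes A :: "('g \<Rightarrow> int) \<Rightarrow> 'k \<Rightarrow> 'q \<Rightarrow> int" and \<tau> :: "('k \<Rightarrow> int) \<Rightarrow> 't"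
  assumes p: "prime p" and fin: "finite G" "finite K" "finite Ty" and Ty: "card Ty < p - 1"
  defines "nonzero \<equiv> \<lambda>k. k \<in> box p K \<and> (\<exists>x\<in>K. \<not> int p dvd k x)"
  assumes type: "\<And>k. nonzero k \<Longrightarrow> \<tau> k \<in> Ty"
    and fam: "\<And>t. t \<in> Ty \<Longrightarrow> card {k \<in> box p K. \<tau> k = t} \<le> p ^ fam t"
    and cod: "\<And>k. nonzero k \<Longrightarrow> \<exists>m\<ge>fam (\<tau> k).
      card {c \<in> box p G. \<forall>q\<in>R. int p dvd (\<Sum>x\<in>K. A c x q * k x)} * p ^ m \<le> p ^ card G"
  shows "\<exists>c. \<forall>k. (\<forall>q\<in>R. int p dvd (\<Sum>x\<in>K. A c x q * k x)) \<longrightarrow> (\<forall>x\<in>K. int p dvd k x)"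
proof -
  let ?ker = "\<lambda>k c. \<forall>q\<in>R. int p dvd (\<Sum>x\<in>K. A c x q * k x)"
  let ?nz = "\<lambda>k. k \<in> box p K \<and> (\<exists>x\<in>K. k x \<noteq> 0)"
  have nz: "nonzero k" if k: "?nz k" for k
  proof -
    obtain x where x: "x \<in> K" "k x \<noteq> 0" using k by blast
    hence "\<not> int p dvd k x" using boxD[of k p K x] k zdvd_not_zless[of "k x" "int p"] by auto
    thus ?thesis using k x unfolding nonzero_def by blast
  qed
  have "\<exists>c\<in>box p G. \<forall>k. ?nz k \<longrightarrow> \<not> ?ker k c"
  proof (rule exists_trivial_kernel[where Ty = Ty and \<tau> = \<tau> and fam = fam, OF p fin Ty])
    fix k c m assume "?ker k c"
    thus "?ker (\<lambda>x\<in>K. m * k x mod int p) c" by (intro ballI dvd_sum_scaled) blast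
  next
    fix t assume t: "t \<in> Ty"
    have "card {k. ?nz k \<and> \<tau> k = t} \<le> card {k \<in> box p K. \<tau> k = t}"
      by (intro card_mono finite_subset[OF _ finite_box[OF fin(2)]]) auto
    thus "card {k. ?nz k \<and> \<tau> k = t} \<le> p ^ fam t" using fam[OF t] by (rule order_trans)
  next
    fix k assume "?nz k"
    then obtain m where "fam (\<tau> k) \<le> m" "card {c \<in> box p G. ?ker k c} * p ^ m \<le> p ^ card G"
      using cod[OF nz] by blast
    moreover from this(1) have "p ^ fam (\<tau> k) \<le> p ^ m"
      using prime_gt_0_nat[OF p] by (intro power_increasing) auto
    ultimately show "card {c \<in> box p G. ?ker k c} * p ^ fam (\<tau> k) \<le> p ^ card G"
      using order_trans[OF mult_le_mono2] by blast
  qed (rule type[OF nz])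
  then obtain c where c: "\<And>k. ?nz k \<Longrightarrow> \<not> ?ker k c" by blast
  have "int p dvd k x" if "?ker k c" "x \<in> K" for k x
    by (rule dvd_lift[OF p fin(2), of R "\<lambda>x q. A c x q"]) (use c that in auto)
  thus ?thesis by blast
qed

section \<open>Matrices of forms\<close>

type_synonym coord = "(nat \<times> nat) \<times> (nat \<Rightarrow> nat)"
type_synonym matrix_coord = "(nat \<times> nat) \<times> (nat \<times> nat) \<times> (nat \<Rightarrow> nat)"

definition blocks :: "nat \<Rightarrow> (nat \<Rightarrow> nat) \<Rightarrow> (nat \<times> nat) set" where
  "blocks a s = (SIGMA i:{1..a}. {1..s i})"

definition coords :: "nat \<Rightarrow> nat \<Rightarrow> (nat \<Rightarrow> nat) \<Rightarrow> (nat \<Rightarrow> nat) \<Rightarrow> coord set" where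
  "coords n a d s = (SIGMA \<iota>:blocks a s. exponents n (d (fst \<iota>)))"

text \<open>The entry, in the monomial bases, of the map on global sections that is given by the matrix of
  forms with coefficients \<open>c (\<iota>, \<kappa>, \<gamma>)\<close>.\<close>

definition entry ::
    "(matrix_coord \<Rightarrow> 'r::zero) \<Rightarrow>
     coord \<Rightarrow> coord \<Rightarrow> 'r" where
  "entry c = (\<lambda>(\<iota>, \<alpha>) (\<kappa>, \<beta>). if \<alpha> \<le> \<beta> then c (\<iota>, \<kappa>, \<beta> - \<alpha>) else 0)"

lemma finite_blocks [simp]: "finite (blocks a s)"
  by (simp add: blocks_def)

lemma finite_coords [simp]: "finite (coords n a d s)"
  by (simp add: coords_def)

lemma sum_blocks: "(\<Sum>\<iota>\<in>blocks a s. f \<iota>) = (\<Sum>i=1..a. \<Sum>u=1..s i. f (i, u))"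
  unfolding blocks_def by (subst sum.Sigma) auto

lemma sum_coords:
  "(\<Sum>x\<in>coords n a d s. f x) = (\<Sum>\<iota>\<in>blocks a s. \<Sum>\<alpha>\<in>exponents n (d (fst \<iota>)). f (\<iota>, \<alpha>))"
  unfolding coords_def by (subst sum.Sigma) auto

lemma card_Sigma_blocks:
  assumes "\<And>i. i \<in> {1..a} \<Longrightarrow> finite (Y i)"
  shows "card (SIGMA \<iota>:blocks a s. Y (fst \<iota>)) = (\<Sum>i=1..a. s i * card (Y i))"
proof -
  have "card (SIGMA \<iota>:blocks a s. Y (fst \<iota>)) = (\<Sum>\<iota>\<in>blocks a s. card (Y (fst \<iota>)))"
    using assms by (intro card_SigmaI) (auto simp: blocks_def)
  thus ?thesis by (simp add: sum_blocks)
qed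

lemma card_coords: "card (coords n a d s) = (\<Sum>i=1..a. s i * card (exponents n (d i)))"
  unfolding coords_def by (rule card_Sigma_blocks) simp

lemma diff_add_exponents: "\<gamma> \<le> \<beta> \<Longrightarrow> \<beta> - (\<beta> - \<gamma>) = (\<gamma> :: nat \<Rightarrow> nat)" "\<gamma> \<le> \<beta> \<Longrightarrow> \<beta> - \<gamma> \<le> \<beta>"
  by (auto simp: le_fun_def)

text \<open>Each divisor of \<open>\<beta>\<close> is paired with its complementary divisor.\<close>

lemma sum_exponents_reflect:
  assumes "\<beta> \<in> exponents n e" "d \<le> e"
  shows "(\<Sum>\<alpha>\<in>exponents n d. if \<alpha> \<le> \<beta> then F \<alpha> (\<beta> - \<alpha>) else 0)
       = (\<Sum>\<gamma>\<in>exponents n (e - d). if \<gamma> \<le> \<beta> then F (\<beta> - \<gamma>) \<gamma> else (0::'r::comm_monoid_add))"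
proof -
  have "(\<Sum>\<alpha>\<in>{\<alpha>\<in>exponents n d. \<alpha> \<le> \<beta>}. F \<alpha> (\<beta> - \<alpha>))
      = (\<Sum>\<gamma>\<in>{\<gamma>\<in>exponents n (e - d). \<gamma> \<le> \<beta>}. F (\<beta> - \<gamma>) \<gamma>)"
    using assms exponents_diff(1)[OF _ assms(1)]
    by (intro sum.reindex_bij_witness[of _ "\<lambda>\<gamma>. \<beta> - \<gamma>" "\<lambda>\<alpha>. \<beta> - \<alpha>"])
       (auto simp: diff_add_exponents simp del: minus_apply, (metis diff_diff_cancel)+)
  thus ?thesis by (simp add: sum.inter_filter)
qed

lemma sum_exponents_shift:
  assumes "\<alpha> \<in> exponents n d" "d \<le> e"
  shows "(\<Sum>\<beta>\<in>exponents n e. if \<alpha> \<le> \<beta> then F \<beta> (\<beta> - \<alpha>) else 0)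
       = (\<Sum>\<gamma>\<in>exponents n (e - d). F (\<alpha> + \<gamma>) (\<gamma> :: nat \<Rightarrow> nat) :: 'r::comm_monoid_add)"
proof -
  have 1: "\<alpha> + \<gamma> \<in> exponents n e" if "\<gamma> \<in> exponents n (e - d)" for \<gamma>
    using exponents_add[OF assms(1) that] assms(2) by simp
  have 2: "\<alpha> \<le> \<alpha> + \<gamma>" "\<alpha> + \<gamma> - \<alpha> = \<gamma>" for \<gamma> by (auto simp: le_fun_def)
  have 3: "\<beta> - \<alpha> \<in> exponents n (e - d)" "\<alpha> + (\<beta> - \<alpha>) = \<beta>" if "\<beta> \<in> exponents n e" "\<alpha> \<le> \<beta>" for \<beta>
    using exponents_diff[OF assms(1) that] by auto
  have "(\<Sum>\<beta>\<in>{\<beta>\<in>exponents n e. \<alpha> \<le> \<beta>}. F \<beta> (\<beta> - \<alpha>))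
      = (\<Sum>\<gamma>\<in>exponents n (e - d). F (\<alpha> + \<gamma>) \<gamma>)"
    by (rule sum.reindex_bij_witness[of _ "\<lambda>\<gamma>. \<alpha> + \<gamma>" "\<lambda>\<beta>. \<beta> - \<alpha>"])
       (simp_all only: mem_Collect_eq 1 2 3 simp_thms)
  thus ?thesis by (simp add: sum.inter_filter)
qed

locale twist_data =
  fixes n a b :: nat and d e s t :: "nat \<Rightarrow> nat"
  assumes a_pos: "a \<ge> 1"
    and d_le: "i \<in> {1..a} \<Longrightarrow> d i \<le> d a"
    and e_gt: "j \<in> {1..b} \<Longrightarrow> d a < e j"
    and e_le: "j \<in> {1..b} \<Longrightarrow> e j \<le> e b"
begin

abbreviation "X \<equiv> exponents n"
abbreviation "I \<equiv> blocks a s"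
abbreviation "J \<equiv> blocks b t"
abbreviation "P \<equiv> coords n a d s"
abbreviation "Q \<equiv> coords n b e t"
abbreviation "D i \<equiv> card (X (d i))"
abbreviation "E j \<equiv> card (X (e j))"
text \<open>The base exceeds every \<open>d i\<close> and every \<open>e j\<close>, so a single
  order serves all degrees of source and target.\<close>

abbreviation "w \<equiv> key n (d a + e b + 1)"

definition G :: "matrix_coord set" where
  "G = (SIGMA \<iota>:I. SIGMA \<kappa>:J. X (e (fst \<kappa>) - d (fst \<iota>)))"

lemma finite_G [simp]: "finite G"
  by (simp add: G_def)

lemma d_less_e: "i \<in> {1..a} \<Longrightarrow> j \<in> {1..b} \<Longrightarrow> d i < e j"
  using d_le e_gt by (meson le_less_trans)

lemma blocks_I: "\<iota> \<in> I \<Longrightarrow> fst \<iota> \<in> {1..a}" and blocks_J: "\<kappa> \<in> J \<Longrightarrow> fst \<kappa> \<in> {1..b}"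
  by (auto simp: blocks_def)

lemma inj_w_d: "i \<in> {1..a} \<Longrightarrow> inj_on w (X (d i))"
  by (rule inj_on_key) (use d_le[of i] in auto)

lemma inj_w_e: "j \<in> {1..b} \<Longrightarrow> inj_on w (X (e j))"
  by (rule inj_on_key) (use e_le[of j] in auto)

lemma sum_G: "(\<Sum>g\<in>G. f g) = (\<Sum>\<iota>\<in>I. \<Sum>\<kappa>\<in>J. \<Sum>\<gamma>\<in>X (e (fst \<kappa>) - d (fst \<iota>)). f (\<iota>, \<kappa>, \<gamma>))"
  by (simp add: G_def sum.Sigma case_prod_unfold)

lemma entry_apply:
  assumes "\<kappa> \<in> J" "\<beta> \<in> X (e (fst \<kappa>))"
  shows "(\<Sum>x\<in>P. entry c x (\<kappa>, \<beta>) * k x)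
       = (\<Sum>\<iota>\<in>I. \<Sum>\<gamma>\<in>X (e (fst \<kappa>) - d (fst \<iota>)). c (\<iota>, \<kappa>, \<gamma>) * (if \<gamma> \<le> \<beta> then k (\<iota>, \<beta> - \<gamma>) else (0::int)))"
  unfolding sum_coords
proof (rule sum.cong[OF refl])
  fix \<iota> assume "\<iota> \<in> I"
  hence "d (fst \<iota>) \<le> e (fst \<kappa>)" using d_less_e blocks_I blocks_J assms(1) by (meson less_imp_le)
  from sum_exponents_reflect[OF assms(2) this, of "\<lambda>\<alpha> \<gamma>. c (\<iota>, \<kappa>, \<gamma>) * k (\<iota>, \<alpha>)"]
  show "(\<Sum>\<alpha>\<in>X (d (fst \<iota>)). entry c (\<iota>, \<alpha>) (\<kappa>, \<beta>) * k (\<iota>, \<alpha>))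
      = (\<Sum>\<gamma>\<in>X (e (fst \<kappa>) - d (fst \<iota>)). c (\<iota>, \<kappa>, \<gamma>) * (if \<gamma> \<le> \<beta> then k (\<iota>, \<beta> - \<gamma>) else 0))"
    by (simp add: entry_def if_distrib[of "\<lambda>z. z * _"] if_distrib[of "\<lambda>z. _ * z"] cong: if_cong)
qed

text \<open>The roles are exchanged: with \<open>k\<close> fixed, the image is linear in the
  coefficients of the matrix. This is the shape in which \<open>card_kernel_triangular\<close>
  counts the matrices that kill \<open>k\<close>.\<close>

lemma entry_apply_G:
  assumes "q \<in> Q"
  shows "(\<Sum>x\<in>P. entry c x q * k x)
       = (\<Sum>g\<in>G. c g * (case (g, q) of ((\<iota>, \<kappa>', \<gamma>), \<kappa>, \<beta>) \<Rightarrow> if \<kappa>' = \<kappa> \<and> \<gamma> \<le> \<beta> then k (\<iota>, \<beta> - \<gamma>) else (0::int)))"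
proof -
  obtain \<kappa> \<beta> where q: "q = (\<kappa>, \<beta>)" "\<kappa> \<in> J" "\<beta> \<in> X (e (fst \<kappa>))" using assms by (auto simp: coords_def)
  have "(\<Sum>\<kappa>'\<in>J. \<Sum>\<gamma>\<in>X (e (fst \<kappa>') - d (fst \<iota>)). c (\<iota>, \<kappa>', \<gamma>) * (if \<kappa>' = \<kappa> \<and> \<gamma> \<le> \<beta> then k (\<iota>, \<beta> - \<gamma>) else 0))
     = (\<Sum>\<gamma>\<in>X (e (fst \<kappa>) - d (fst \<iota>)). c (\<iota>, \<kappa>, \<gamma>) * (if \<gamma> \<le> \<beta> then k (\<iota>, \<beta> - \<gamma>) else 0))" for \<iota>
    by (subst sum.remove[OF _ q(2)]) (auto intro!: sum.neutral)
  thus ?thesis unfolding q(1) entry_apply[OF q(2,3)] sum_G by simp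
qed

text \<open>The transpose acts by contraction: multiplication by the monomial
  \<open>\<gamma>\<close> becomes evaluation of \<open>\<phi>\<close> at shifts by
  \<open>\<gamma>\<close>.\<close>

lemma entry_dual_apply:
  assumes "\<iota> \<in> I" "\<alpha> \<in> X (d (fst \<iota>))"
  shows "(\<Sum>q\<in>Q. entry c (\<iota>, \<alpha>) q * \<phi> q)
       = (\<Sum>\<kappa>\<in>J. \<Sum>\<gamma>\<in>X (e (fst \<kappa>) - d (fst \<iota>)). c (\<iota>, \<kappa>, \<gamma>) * (\<phi> (\<kappa>, \<alpha> + \<gamma>) :: int))"
  unfolding sum_coords
proof (rule sum.cong[OF refl])
  fix \<kappa> assume "\<kappa> \<in> J"
  hence "d (fst \<iota>) \<le> e (fst \<kappa>)" using d_less_e blocks_I blocks_J assms(1) by (meson less_imp_le)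
  from sum_exponents_shift[OF assms(2) this, of "\<lambda>\<beta> \<gamma>. c (\<iota>, \<kappa>, \<gamma>) * \<phi> (\<kappa>, \<beta>)"]
  show "(\<Sum>\<beta>\<in>X (e (fst \<kappa>)). entry c (\<iota>, \<alpha>) (\<kappa>, \<beta>) * \<phi> (\<kappa>, \<beta>))
      = (\<Sum>\<gamma>\<in>X (e (fst \<kappa>) - d (fst \<iota>)). c (\<iota>, \<kappa>, \<gamma>) * \<phi> (\<kappa>, \<alpha> + \<gamma>))"
    by (simp add: entry_def if_distrib[of "\<lambda>z. z * _"] cong: if_cong)
qed

lemma entry_dual_apply_G:
  assumes "x \<in> P"
  shows "(\<Sum>q\<in>Q. entry c x q * \<phi> q)
       = (\<Sum>g\<in>G. c g * (case (g, x) of ((\<iota>', \<kappa>, \<gamma>), \<iota>, \<alpha>) \<Rightarrow> if \<iota>' = \<iota> then \<phi> (\<kappa>, \<alpha> + \<gamma>) else (0::int)))"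
proof -
  obtain \<iota> \<alpha> where x: "x = (\<iota>, \<alpha>)" "\<iota> \<in> I" "\<alpha> \<in> X (d (fst \<iota>))" using assms by (auto simp: coords_def)
  have "(\<Sum>\<iota>'\<in>I. \<Sum>\<kappa>\<in>J. \<Sum>\<gamma>\<in>X (e (fst \<kappa>) - d (fst \<iota>')). c (\<iota>', \<kappa>, \<gamma>) * (if \<iota>' = \<iota> then \<phi> (\<kappa>, \<alpha> + \<gamma>) else 0))
     = (\<Sum>\<kappa>\<in>J. \<Sum>\<gamma>\<in>X (e (fst \<kappa>) - d (fst \<iota>)). c (\<iota>, \<kappa>, \<gamma>) * \<phi> (\<kappa>, \<alpha> + \<gamma>))"
    by (subst sum.remove[OF _ x(2)]) (auto intro!: sum.neutral)
  thus ?thesis unfolding x(1) entry_dual_apply[OF x(2,3)] sum_G by simp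
qed

lemma E_pos: "E j > 0" and D_pos: "D i > 0"
  by (simp_all add: card_exponents_pos)

lemma E_le: "j \<in> {1..b} \<Longrightarrow> E j \<le> E b"
  using e_le[of j] unfolding card_exponents by (intro binomial_right_mono) auto

end

section \<open>Injectivity modulo a prime\<close>

context twist_data
begin

definition coeff_span :: "nat \<Rightarrow> (coord \<Rightarrow> int) \<Rightarrow> nat \<Rightarrow> ((nat \<Rightarrow> nat) \<Rightarrow> int) set" where
  "coeff_span p k i = span_mod p (X (d i)) {1..s i} (\<lambda>u \<alpha>. k ((i, u), \<alpha>))"

text \<open>This is the type of \<open>k\<close> in the count. The restriction to
  \<open>{1..a}\<close> makes it extensional, so that the types lie in a finite product of power
  sets.\<close>

definition row_leads :: "nat \<Rightarrow> (coord \<Rightarrow> int) \<Rightarrow> nat \<Rightarrow> (nat \<Rightarrow> nat) set" where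
  "row_leads p k = (\<lambda>i\<in>{1..a}. leads p (X (d i)) w (coeff_span p k i))"

text \<open>The degree \<open>e j\<close> part of the monomial ideal generated by the sets \<open>L i\<close>.\<close>

definition ideal_part :: "(nat \<Rightarrow> (nat \<Rightarrow> nat) set) \<Rightarrow> nat \<Rightarrow> (nat \<Rightarrow> nat) set" where
  "ideal_part L j = (\<Union>i\<in>{1..a}. up_shadow n (e j - d i) (L i))"

lemma mod_space_rows: "prime p \<Longrightarrow> i \<in> {1..a} \<Longrightarrow> mod_space p (X (d i)) w (coeff_span p k i)"
  unfolding coeff_span_def by (intro mod_space_span inj_w_d) auto

lemma row_leads_subset: "i \<in> {1..a} \<Longrightarrow> row_leads p k i \<subseteq> X (d i)"
  by (auto simp: row_leads_def leads_def)

lemma ideal_subset: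
  assumes "\<And>i. i \<in> {1..a} \<Longrightarrow> L i \<subseteq> X (d i)" "j \<in> {1..b}"
  shows "ideal_part L j \<subseteq> X (e j)"
  unfolding ideal_part_def
proof (rule UN_least)
  fix i assume i: "i \<in> {1..a}"
  show "up_shadow n (e j - d i) (L i) \<subseteq> X (e j)"
    using up_shadow_subset[OF assms(1)[OF i], of "e j - d i"] d_less_e[OF i assms(2)] by simp
qed

text \<open>For every monomial \<open>\<beta>\<close> of the ideal in degree \<open>e j\<close> and
  each of the \<open>t j\<close> rows of that degree, there is a matrix that sends \<open>k\<close>
  to a vector with leading monomial \<open>\<beta>\<close> in this row and zero in the others. The
  conditions for killing \<open>k\<close> are triangular along these matrices.\<close>

lemma kernel_card_rows:
  assumes p: "prime p"
  shows "card {c \<in> box p G. \<forall>q\<in>Q. int p dvd (\<Sum>x\<in>P. entry c x q * k x)}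
       * p ^ (\<Sum>j=1..b. t j * card (ideal_part (row_leads p k) j)) \<le> p ^ card G"
proof -
  let ?L = "row_leads p k"
  define S where "S = (SIGMA \<kappa>:J. ideal_part ?L (fst \<kappa>))"
  define \<tau> where "\<tau> = (\<lambda>g q :: coord. case (g, q) of ((\<iota>, \<kappa>', \<gamma>), \<kappa>, \<beta>) \<Rightarrow> if \<kappa>' = \<kappa> \<and> \<gamma> \<le> \<beta> then k (\<iota>, \<beta> - \<gamma>) else (0::int))"
  \<comment> \<open>The row is ignored: monomials in different rows may have equal keys, but each
    test matrix reaches one row only.\<close>
  define W where "W = (\<lambda>q :: coord. w (snd q))"
  have ideal_sub: "ideal_part ?L j \<subseteq> X (e j)" if "j \<in> {1..b}" for j
    by (rule ideal_subset[OF row_leads_subset that])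
  have fin: "finite (ideal_part ?L j)" if "j \<in> {1..b}" for j
    using ideal_sub[OF that] finite_subset finite_exponents by blast
  have SQ: "S \<subseteq> Q" unfolding S_def coords_def by (rule Sigma_mono) (auto dest!: blocks_J ideal_sub)
  have T: "(\<Sum>x\<in>P. entry c x q * k x) = (\<Sum>g\<in>G. c g * \<tau> g q)" if "q \<in> Q" for c q
    unfolding entry_apply_G[OF that] \<tau>_def ..
  have "\<exists>v. \<not> int p dvd (\<Sum>g\<in>G. v g * \<tau> g q) \<and>
      (\<forall>q'\<in>S. q' \<noteq> q \<longrightarrow> W q \<le> W q' \<longrightarrow> int p dvd (\<Sum>g\<in>G. v g * \<tau> g q'))" if q: "q \<in> S" for q
  proof -
    obtain \<kappa> \<beta> where q': "q = (\<kappa>, \<beta>)" "\<kappa> \<in> J" "\<beta> \<in> ideal_part ?L (fst \<kappa>)" using q by (auto simp: S_def)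
    then obtain i where i: "i \<in> {1..a}" "\<beta> \<in> up_shadow n (e (fst \<kappa>) - d i) (?L i)"
      by (auto simp: ideal_part_def)
    then obtain m \<gamma> where m: "m \<in> ?L i" "\<gamma> \<in> X (e (fst \<kappa>) - d i)" "\<beta> = m + \<gamma>" by (elim up_shadowE)
    from m(1) i(1) obtain f where f: "f \<in> coeff_span p k i" "m \<in> X (d i)" "\<not> int p dvd f m"
        "\<And>y. y \<in> X (d i) \<Longrightarrow> w m < w y \<Longrightarrow> int p dvd f y"
      by (auto simp: row_leads_def leads_def)
    then obtain a' where a': "\<And>x. x \<in> X (d i) \<Longrightarrow> int p dvd f x - (\<Sum>u=1..s i. a' u * k ((i, u), x))"
      by (auto simp: coeff_span_def span_mod_def)
    \<comment> \<open>In row \<open>\<kappa>\<close> the columns of degree \<open>d i\<close>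
      receive the multiples \<open>a' u\<close> of the monomial \<open>\<gamma>\<close>, so the
      image of \<open>k\<close> is, modulo \<open>p\<close>, that monomial times
      \<open>f\<close>.\<close>
    define v where "v = (\<lambda>(\<iota>, \<kappa>', \<gamma>'). if fst \<iota> = i \<and> \<kappa>' = \<kappa> \<and> \<gamma>' = \<gamma> then a' (snd \<iota>) else (0::int))"
    have v: "(\<Sum>g\<in>G. v g * \<tau> g (\<kappa>', \<beta>')) =
        (if \<kappa>' = \<kappa> \<and> \<gamma> \<le> \<beta>' then (\<Sum>u=1..s i. a' u * k ((i, u), \<beta>' - \<gamma>)) else 0)"
      if "(\<kappa>', \<beta>') \<in> Q" for \<kappa>' \<beta>'
    proof -
      have "\<kappa>' \<in> J" "\<beta>' \<in> X (e (fst \<kappa>'))" using that by (auto simp: coords_def)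
      note * = entry_apply[OF this, of v k]
      have inner: "(\<Sum>\<gamma>'\<in>X (e (fst \<kappa>') - d (fst \<iota>)). v (\<iota>, \<kappa>', \<gamma>') * (if \<gamma>' \<le> \<beta>' then k (\<iota>, \<beta>' - \<gamma>') else 0))
        = (if fst \<iota> = i then (if \<kappa>' = \<kappa> \<and> \<gamma> \<le> \<beta>' then a' (snd \<iota>) * k (\<iota>, \<beta>' - \<gamma>) else 0) else 0)" for \<iota>
      proof (cases "fst \<iota> = i \<and> \<kappa>' = \<kappa>")
        case True
        with m(2) have g: "\<gamma> \<in> X (e (fst \<kappa>') - d (fst \<iota>))" by simp
        show ?thesis unfolding v_def
          by (subst sum.remove[OF _ g]) (use True in \<open>auto intro!: sum.neutral\<close>)
      qed (auto simp: v_def)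
      have "(\<Sum>g\<in>G. v g * \<tau> g (\<kappa>', \<beta>')) =
         (\<Sum>i'=1..a. \<Sum>u=1..s i'. if i' = i then (if \<kappa>' = \<kappa> \<and> \<gamma> \<le> \<beta>' then a' u * k ((i', u), \<beta>' - \<gamma>) else 0) else 0)"
        unfolding T[OF that, symmetric] * inner sum_blocks by (simp cong: if_cong)
      also have "\<dots> = (\<Sum>u=1..s i. if \<kappa>' = \<kappa> \<and> \<gamma> \<le> \<beta>' then a' u * k ((i, u), \<beta>' - \<gamma>) else 0)"
        by (subst sum.remove[OF _ i(1)]) (auto intro!: sum.neutral)
      finally show ?thesis by (cases "\<kappa>' = \<kappa> \<and> \<gamma> \<le> \<beta>'") (simp_all only: if_True if_False simp_thms sum.neutral_const)
    qed
    have diff: "\<beta>' - \<gamma> \<in> X (d i)" if "\<beta>' \<in> X (e (fst \<kappa>))" "\<gamma> \<le> \<beta>'" for \<beta>'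
      using exponents_diff(1)[OF m(2) that] d_less_e[OF i(1) blocks_J[OF q'(2)]] by simp
    have "\<gamma> \<le> \<beta>" "\<beta> - \<gamma> = m" using m(3) by (auto simp: le_fun_def)
    moreover have "\<not> int p dvd (\<Sum>u=1..s i. a' u * k ((i, u), m))"
    proof
      assume "int p dvd (\<Sum>u=1..s i. a' u * k ((i, u), m))"
      from dvd_add[OF a'[OF f(2)] this] show False using f(3) by simp
    qed
    ultimately have 1: "\<not> int p dvd (\<Sum>g\<in>G. v g * \<tau> g q)" using v[of \<kappa> \<beta>] q q'(1) SQ by auto
    have 2: "int p dvd (\<Sum>g\<in>G. v g * \<tau> g q')" if q'': "q' \<in> S" "q' \<noteq> q" "W q \<le> W q'" for q'
    proof -
      obtain \<kappa>' \<beta>' where k': "q' = (\<kappa>', \<beta>')" by (cases q')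
      show ?thesis
      proof (cases "\<kappa>' = \<kappa> \<and> \<gamma> \<le> \<beta>'")
        case False
        thus ?thesis using v[of \<kappa>' \<beta>'] q'' k' SQ by auto
      next
        case True
        have b': "\<beta>' \<in> X (e (fst \<kappa>))" "\<beta> \<in> X (e (fst \<kappa>))" using q'' k' True SQ q q' by (auto simp: coords_def)
        have "w \<beta> \<noteq> w \<beta>'" using q'' k' True q'(1) b' inj_w_e[OF blocks_J[OF q'(2)]] by (auto simp: inj_on_def)
        hence lt: "w \<beta> < w \<beta>'" using q''(3) k' q' by (simp add: W_def)
        \<comment> \<open>Dividing both monomials by \<open>\<gamma>\<close> preserves their order,
          since keys add.\<close>
        have "\<beta>' = \<beta>' - \<gamma> + \<gamma>" using True by (auto simp: le_fun_def fun_eq_iff)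
        hence "w \<beta>' = w (\<beta>' - \<gamma>) + w \<gamma>" by (metis key_add)
        hence "w m < w (\<beta>' - \<gamma>)" using lt m(3) by (simp only: key_add)
        hence "int p dvd f (\<beta>' - \<gamma>)" using f(4) diff[OF b'(1)] True by blast
        from dvd_diff[OF this a'[OF diff[OF b'(1)]]]
        have "int p dvd (\<Sum>u=1..s i. a' u * k ((i, u), \<beta>' - \<gamma>))" using True by simp
        thus ?thesis using v[of \<kappa>' \<beta>'] q'' k' SQ True by auto
      qed
    qed
    from 1 2 show ?thesis by blast
  qed
  hence "card {c \<in> box p G. \<forall>q\<in>S. int p dvd (\<Sum>g\<in>G. c g * \<tau> g q)} * p ^ card S \<le> p ^ card G"
    by (intro card_kernel_triangular[where w = W, OF p finite_G] finite_subset[OF SQ finite_coords])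
  moreover have "card S = (\<Sum>j=1..b. t j * card (ideal_part ?L j))"
    unfolding S_def using fin by (rule card_Sigma_blocks)
  moreover have "card {c \<in> box p G. \<forall>q\<in>Q. int p dvd (\<Sum>x\<in>P. entry c x q * k x)}
      \<le> card {c \<in> box p G. \<forall>q\<in>S. int p dvd (\<Sum>g\<in>G. c g * \<tau> g q)}"
    by (rule card_mono) (use SQ T in auto)
  ultimately show ?thesis using order_trans[OF mult_le_mono1] by simp
qed

text \<open>By \<open>expand\<close>, a component of \<open>k\<close> is recovered from its entries
  at the leads \<open>L i\<close> and from the reduced basis of the span. The entries account for
  \<open>s i * card (L i)\<close> parameters; a reduced basis has
  \<open>card (L i) * (D i - card (L i))\<close> free entries, the dimension of a
  Grassmannian.\<close>

lemma card_rows_family: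
  assumes p: "prime p" and L: "\<And>i. i \<in> {1..a} \<Longrightarrow> L i \<subseteq> X (d i)"
  shows "card {k \<in> box p P. row_leads p k = L}
       \<le> p ^ (\<Sum>i=1..a. card (L i) * (D i - card (L i)) + s i * card (L i))"
proof -
  define P' where "P' = (SIGMA \<iota>:I. L (fst \<iota>))"
  define Z where "Z = (SIGMA i:{1..a}. L i \<times> (X (d i) - L i))"
  define b' where "b' k = (\<lambda>(i, m, x)\<in>Z. reduced p (X (d i)) w (coeff_span p k i) m x)" for k
  define F where "F k = (restrict k P', b' k)" for k
  have finL: "finite (L i)" if "i \<in> {1..a}" for i using L[OF that] finite_subset finite_exponents by blast
  have finZ: "finite Z" and finP: "finite P'" unfolding Z_def P'_def using finL
    by (auto intro!: finite_SigmaI dest: blocks_I)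
  have P': "P' \<subseteq> P" unfolding P'_def coords_def by (intro Sigma_mono order.refl L blocks_I)
  have "inj_on F {k \<in> box p P. row_leads p k = L}"
  proof (rule inj_onI, clarify)
    fix k k' assume k: "k \<in> box p P" "L = row_leads p k" and k': "k' \<in> box p P" "row_leads p k' = row_leads p k"
      and F: "F k = F k'"
    have F': "restrict k P' = restrict k' P'" "b' k = b' k'" using F by (simp_all add: F_def)
    show "k = k'"
    proof (rule box_eqI[OF k(1) k'(1)])
      fix x assume "x \<in> P"
      then obtain i u \<alpha> where x: "x = ((i, u), \<alpha>)" "i \<in> {1..a}" "u \<in> {1..s i}" "\<alpha> \<in> X (d i)"
        by (auto simp: coords_def blocks_def)
      let ?X = "X (d i)"
      interpret M: mod_space p ?X w "coeff_span p k i" by (rule mod_space_rows[OF p x(2)])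
      interpret M': mod_space p ?X w "coeff_span p k' i" by (rule mod_space_rows[OF p x(2)])
      have "row_leads p k i = M.L" "row_leads p k' i = M'.L" using x(2) by (simp_all only: row_leads_def restrict_apply' x(2))
      hence L1: "M.L = L i" "M'.L = L i" by (simp_all only: k(2) k'(2))
      have in1: "(\<lambda>\<alpha>. k ((i, u), \<alpha>)) \<in> coeff_span p k i" "(\<lambda>\<alpha>. k' ((i, u), \<alpha>)) \<in> coeff_span p k' i"
        unfolding coeff_span_def using x(3) span_mod_base[of "{1..s i}" u "\<lambda>u \<alpha>. k ((i, u), \<alpha>)" for k] by auto
      have "k ((i, u), m) * M.b m \<alpha> = k' ((i, u), m) * M'.b m \<alpha>" if m: "m \<in> L i" for m
      proof -
        have "((i, u), m) \<in> P'" using x m by (auto simp: P'_def blocks_def)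
        hence 1: "k ((i, u), m) = k' ((i, u), m)"
          using fun_cong[OF F'(1), of "((i, u), m)"] by simp
        have "M.b m \<alpha> = M'.b m \<alpha>"
        proof (cases "\<alpha> \<in> L i")
          case True
          thus ?thesis using M.reduced(3)[of \<alpha> m] M'.reduced(3)[of \<alpha> m] L1 by simp
        next
          case False
          hence "(i, m, \<alpha>) \<in> Z" using x m by (auto simp: Z_def)
          thus ?thesis using fun_cong[OF F'(2), of "(i, m, \<alpha>)"] by (simp add: b'_def)
        qed
        with 1 show ?thesis by simp
      qed
      hence "(\<Sum>m\<in>L i. k ((i, u), m) * M.b m \<alpha>) = (\<Sum>m\<in>L i. k' ((i, u), m) * M'.b m \<alpha>)" by simp
      with dvd_diff[OF M.expand[OF in1(1) x(4)] M'.expand[OF in1(2) x(4)]]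
      show "int p dvd k x - k' x" unfolding x(1) L1 by simp
    qed
  qed
  moreover have "F ` {k \<in> box p P. row_leads p k = L} \<subseteq> box p P' \<times> box p Z"
  proof (rule image_subsetI)
    fix k assume "k \<in> {k \<in> box p P. row_leads p k = L}"
    hence "restrict k P' \<in> box p P'" using P' by (auto simp: box_def PiE_iff)
    moreover have "b' k \<in> box p Z"
    proof -
      have "reduced p (X (d i)) w (coeff_span p k i) m x \<in> {0..<int p}" if "(i, m, x) \<in> Z" for i m x
      proof -
        have i: "i \<in> {1..a}" "x \<in> X (d i)" using that by (auto simp: Z_def)
        interpret M: mod_space p "X (d i)" w "coeff_span p k i" by (rule mod_space_rows[OF p i(1)])
        show ?thesis using boxD[OF M.reduced(2) i(2)] by simp
      qed
      thus ?thesis by (auto simp: b'_def box_def)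
    qed
    ultimately show "F k \<in> box p P' \<times> box p Z" by (simp add: F_def)
  qed
  ultimately have "card {k \<in> box p P. row_leads p k = L} \<le> card (box p P' \<times> box p Z)"
    using finP finZ by (intro card_inj_on_le) auto
  also have "\<dots> = p ^ (card P' + card Z)"
    using finP finZ by (simp add: card_cartesian_product card_box power_add)
  also have "card P' = (\<Sum>i=1..a. s i * card (L i))"
    unfolding P'_def by (rule card_Sigma_blocks[OF finL])
  also have "card Z = (\<Sum>i=1..a. card (L i) * (D i - card (L i)))"
    unfolding Z_def using L finL by (subst card_SigmaI) (auto simp: card_cartesian_product card_Diff_subset intro!: sum.cong)
  finally show ?thesis by (simp add: sum.distrib add.commute)
qed

end

lemma mult_diff_le_quarter: "x * (y - x) \<le> y\<^sup>2 / (4::real)"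
proof -
  have "0 \<le> (y - 2 * x)\<^sup>2" by simp
  thus ?thesis by (simp add: power2_eq_square algebra_simps)
qed

section \<open>Strata against codimension: injectivity\<close>

context twist_data
begin

text \<open>As \<open>e j > d a\<close>, the ideal in degree \<open>e j\<close> is the shadow of
  this part. Its proportion in degree \<open>d a\<close> is the common yardstick: the sets
  \<open>L i\<close> occupy at most that much, the ideal in the target degrees more.\<close>

definition ideal_part_a :: "(nat \<Rightarrow> (nat \<Rightarrow> nat) set) \<Rightarrow> (nat \<Rightarrow> nat) set" where
  "ideal_part_a L = (\<Union>i\<in>{1..a}. up_shadow n (d a - d i) (L i))"

lemma up_shadow_UN: "up_shadow n k (\<Union>i\<in>A. Y i) = (\<Union>i\<in>A. up_shadow n k (Y i))"
  unfolding up_shadow_def by blast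

lemma ideal_eq:
  assumes "j \<in> {1..b}" shows "ideal_part L j = up_shadow n (e j - d a) (ideal_part_a L)"
proof -
  have "(d a - d i) + (e j - d a) = e j - d i" if "i \<in> {1..a}" for i
    using d_le[OF that] e_gt[OF assms] by simp
  thus ?thesis unfolding ideal_part_def ideal_part_a_def up_shadow_UN by (simp add: up_shadow_add[symmetric])
qed

text \<open>The factor \<open>E b\<close> of the hypothesis is spent on
  \<open>E j \<le> E b\<close>. What remains bounds the number of rows, each of which will
  contribute one unit of gain after multiplication by \<open>D a\<close>.\<close>

lemma sum_t_ge:
  assumes "1 / 4 * real (D a) * real (E b) * (\<Sum>i=1..a. (real (D i))\<^sup>2) \<le> (\<Sum>j=1..b. real (t j) * real (E j))"
  shows "real (D a) * (\<Sum>i=1..a. (real (D i))\<^sup>2) / 4 \<le> (\<Sum>j=1..b. real (t j))"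
proof -
  have "(\<Sum>j=1..b. real (t j) * real (E j)) \<le> (\<Sum>j=1..b. real (t j) * real (E b))"
    by (intro sum_mono mult_left_mono) (use E_le in auto)
  also have "\<dots> = real (E b) * (\<Sum>j=1..b. real (t j))" by (simp add: sum_distrib_left mult.commute)
  finally have "1 / 4 * real (D a) * real (E b) * (\<Sum>i=1..a. (real (D i))\<^sup>2) \<le> real (E b) * (\<Sum>j=1..b. real (t j))"
    by (rule order_trans[OF assms])
  hence "real (E b) * (real (D a) * (\<Sum>i=1..a. (real (D i))\<^sup>2) / 4) \<le> real (E b) * (\<Sum>j=1..b. real (t j))"
    by (simp only: times_divide_eq_left times_divide_eq_right mult_1 mult.assoc mult.left_commute[of "real (D a)"])
  thus ?thesis using E_pos[of b] by (subst (asm) mult_le_cancel_left_pos) auto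
qed

text \<open>When the ideal fills degree \<open>d a\<close> it has proportion one in every target
  degree and no gain is possible. The stratum is then bounded by the whole source, and comparing
  total dimensions suffices.\<close>

definition fam_rows :: "(nat \<Rightarrow> (nat \<Rightarrow> nat) set) \<Rightarrow> nat" where
  "fam_rows L = (if ideal_part_a L = X (d a) then \<Sum>i=1..a. s i * D i
     else \<Sum>i=1..a. card (L i) * (D i - card (L i)) + s i * card (L i))"

text \<open>With \<open>\<rho>\<close> the size of the ideal in degree \<open>d a\<close>, and after
  multiplication by \<open>D a\<close>, the terms \<open>s i * card (L i)\<close> add up to at most
  \<open>\<rho>\<close> times the dimension of the source, hence of the target. The codimension is
  at least \<open>\<rho>\<close> times the dimension of the target plus the number of rows, and this
  surplus pays for the terms \<open>card (L i) * (D i - card (L i))\<close>.\<close>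

lemma fam_rows_le:
  assumes L: "\<And>i. i \<in> {1..a} \<Longrightarrow> L i \<subseteq> X (d i)" and ne: "i0 \<in> {1..a}" "L i0 \<noteq> {}"
    and le: "(\<Sum>i=1..a. s i * D i) \<le> (\<Sum>j=1..b. t j * E j)"
    and big: "1 / 4 * real (D a) * real (E b) * (\<Sum>i=1..a. (real (D i))\<^sup>2) \<le> (\<Sum>j=1..b. real (t j) * real (E j))"
  shows "fam_rows L \<le> (\<Sum>j=1..b. t j * card (ideal_part L j))"
proof (cases "ideal_part_a L = X (d a)")
  case True
  have "ideal_part L j = X (e j)" if "j \<in> {1..b}" for j
    using ideal_eq[OF that] up_shadow_full[of n "e j - d a" "d a"] e_gt[OF that] by (simp add: True)
  thus ?thesis using le by (simp add: fam_rows_def True)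
next
  case False
  let ?\<Lambda> = "ideal_part_a L"
  have sub: "up_shadow n (d a - d i) (L i) \<subseteq> X (d a)" if "i \<in> {1..a}" for i
    using up_shadow_subset[OF L[OF that], of "d a - d i"] d_le[OF that] by simp
  hence \<Lambda>: "?\<Lambda> \<subseteq> X (d a)" unfolding ideal_part_a_def by blast
  obtain \<alpha> \<gamma> where "\<alpha> \<in> L i0" "\<gamma> \<in> X (d a - d i0)" using ne exponents_nonempty by blast
  hence \<Lambda>0: "?\<Lambda> \<noteq> {}" using ne(1) up_shadowI unfolding ideal_part_a_def by blast
  have finL: "finite ?\<Lambda>" using \<Lambda> finite_subset finite_exponents by blast
  define \<rho> where "\<rho> = real (card ?\<Lambda>)"
  define r where "r i = real (card (L i))" for i
  have r: "r i * real (D a) \<le> \<rho> * real (D i)" if "i \<in> {1..a}" for i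
  proof -
    have "card (L i) * D a \<le> card (up_shadow n (d a - d i) (L i)) * D i"
      using card_up_shadow_le[OF L[OF that], of "d a - d i"] d_le[OF that] by simp
    also have "\<dots> \<le> card ?\<Lambda> * D i"
      by (intro mult_le_mono1 card_mono finL) (use that in \<open>auto simp: ideal_part_a_def\<close>)
    finally show ?thesis unfolding r_def \<rho>_def by (metis of_nat_le_iff of_nat_mult)
  qed
  \<comment> \<open>The \<open>+ 1\<close> is strictness between integers; it is the entire gain of
    a row.\<close>
  have S: "\<rho> * real (E j) + 1 \<le> real (card (ideal_part L j)) * real (D a)" if "j \<in> {1..b}" for j
  proof -
    have "card ?\<Lambda> * E j < card (ideal_part L j) * D a"
      using card_up_shadow_less[OF \<Lambda> \<Lambda>0 False, of "e j - d a"] e_gt[OF that] by (simp add: ideal_eq[OF that])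
    hence "card ?\<Lambda> * E j + 1 \<le> card (ideal_part L j) * D a" by simp
    thus ?thesis unfolding \<rho>_def by (metis of_nat_le_iff of_nat_mult of_nat_add of_nat_1)
  qed
  have cardL: "card (L i) \<le> D i" if "i \<in> {1..a}" for i using L[OF that] by (intro card_mono) auto
  have "real (fam_rows L) = (\<Sum>i=1..a. r i * (real (D i) - r i) + real (s i) * r i)"
    using False cardL by (simp add: fam_rows_def r_def of_nat_diff)
  also have "\<dots> \<le> (\<Sum>i=1..a. (real (D i))\<^sup>2 / 4 + real (s i) * r i)"
    by (intro sum_mono add_right_mono mult_diff_le_quarter)
  finally have "real (D a) * real (fam_rows L) \<le> real (D a) * (\<Sum>i=1..a. (real (D i))\<^sup>2 / 4 + real (s i) * r i)"
    by (rule mult_left_mono) simp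
  also have "\<dots> = real (D a) * (\<Sum>i=1..a. (real (D i))\<^sup>2) / 4 + (\<Sum>i=1..a. real (s i) * (r i * real (D a)))"
    by (simp add: sum.distrib sum_distrib_left sum_divide_distrib distrib_left mult_ac)
  finally have 1: "real (D a) * real (fam_rows L)
      \<le> real (D a) * (\<Sum>i=1..a. (real (D i))\<^sup>2) / 4 + (\<Sum>i=1..a. real (s i) * (r i * real (D a)))" .
  have "(\<Sum>i=1..a. real (s i) * (r i * real (D a))) \<le> (\<Sum>i=1..a. real (s i) * (\<rho> * real (D i)))"
    by (intro sum_mono mult_left_mono r) auto
  also have "\<dots> = \<rho> * real (\<Sum>i=1..a. s i * D i)" by (simp add: sum_distrib_left mult_ac)
  also have "\<dots> \<le> \<rho> * real (\<Sum>j=1..b. t j * E j)"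
    using le by (intro mult_left_mono of_nat_mono) (auto simp: \<rho>_def)
  finally have 2: "(\<Sum>i=1..a. real (s i) * (r i * real (D a))) \<le> \<rho> * real (\<Sum>j=1..b. t j * E j)" .
  have "(\<Sum>j=1..b. real (t j)) + \<rho> * real (\<Sum>j=1..b. t j * E j)
      = (\<Sum>j=1..b. real (t j) * (\<rho> * real (E j) + 1))"
    by (simp add: sum_distrib_left sum.distrib distrib_left mult_ac)
  also have "\<dots> \<le> (\<Sum>j=1..b. real (t j) * (real (card (ideal_part L j)) * real (D a)))"
    by (intro sum_mono mult_left_mono S) auto
  also have "\<dots> = real (D a) * real (\<Sum>j=1..b. t j * card (ideal_part L j))"
    by (simp add: sum_distrib_left mult_ac)
  finally have "real (D a) * real (fam_rows L) \<le> real (D a) * real (\<Sum>j=1..b. t j * card (ideal_part L j))"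
    using 1 2 sum_t_ge[OF big] by linarith
  hence "real (fam_rows L) \<le> real (\<Sum>j=1..b. t j * card (ideal_part L j))"
    using D_pos[of a] by (subst (asm) mult_le_cancel_left_pos) auto
  thus ?thesis by (simp only: of_nat_le_iff)
qed

lemma exists_injective_mod:
  assumes le: "(\<Sum>i=1..a. s i * D i) \<le> (\<Sum>j=1..b. t j * E j)"
    and big: "1 / 4 * real (D a) * real (E b) * (\<Sum>i=1..a. (real (D i))\<^sup>2) \<le> (\<Sum>j=1..b. real (t j) * real (E j))"
  shows "\<exists>p c. prime p \<and> (\<forall>k. (\<forall>q\<in>Q. int p dvd (\<Sum>x\<in>P. entry c x q * k x)) \<longrightarrow> (\<forall>x\<in>P. int p dvd k x))"
proof -
  define Ty where "Ty = (PiE {1..a} (\<lambda>i. Pow (X (d i))))"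
  have finTy: "finite Ty" unfolding Ty_def by (intro finite_PiE) auto
  \<comment> \<open>\<open>Ty\<close> does not mention \<open>p\<close>, so a prime beyond its
    cardinality can be chosen.\<close>
  obtain p where p: "prime p" "card Ty + 1 < p" using bigger_prime by blast
  have "\<exists>c. \<forall>k. (\<forall>q\<in>Q. int p dvd (\<Sum>x\<in>P. entry c x q * k x)) \<longrightarrow> (\<forall>x\<in>P. int p dvd k x)"
  proof (rule exists_injective_mod_p[where G = G and Ty = Ty and \<tau> = "row_leads p" and fam = fam_rows])
    show "card Ty < p - 1" using p by simp
  next
    fix k show "row_leads p k \<in> Ty"
      unfolding Ty_def by (intro PiE_I) (use row_leads_subset[of _ p k] in blast, auto simp: row_leads_def)
  next
    fix L assume "L \<in> Ty"
    hence L: "\<And>i. i \<in> {1..a} \<Longrightarrow> L i \<subseteq> X (d i)" by (auto simp: Ty_def)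
    have "card {k \<in> box p P. row_leads p k = L} \<le> card (box p P)"
      by (intro card_mono) auto
    hence "card {k \<in> box p P. row_leads p k = L} \<le> p ^ (\<Sum>i=1..a. s i * D i)"
      by (simp add: card_box card_coords)
    thus "card {k \<in> box p P. row_leads p k = L} \<le> p ^ fam_rows L"
      using card_rows_family[OF p(1) L] unfolding fam_rows_def by auto
  next
    fix k assume "k \<in> box p P \<and> (\<exists>x\<in>P. \<not> int p dvd k x)"
    then obtain i u \<alpha> where x: "((i, u), \<alpha>) \<in> P" "\<not> int p dvd k ((i, u), \<alpha>)" by auto
    hence i: "i \<in> {1..a}" "u \<in> {1..s i}" "\<alpha> \<in> X (d i)" by (auto simp: coords_def blocks_def)
    interpret M: mod_space p "X (d i)" w "coeff_span p k i" by (rule mod_space_rows[OF p(1) i(1)])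
    have "(\<lambda>\<alpha>. k ((i, u), \<alpha>)) \<in> coeff_span p k i"
      unfolding coeff_span_def using i(2) span_mod_base[of "{1..s i}" u "\<lambda>u \<alpha>. k ((i, u), \<alpha>)"] by auto
    hence "M.L \<noteq> {}" using M.in_leads_max[of "\<lambda>\<alpha>. k ((i, u), \<alpha>)" \<alpha>] i(3) x(2) by blast
    hence "row_leads p k i \<noteq> {}" using i(1) by (simp only: row_leads_def restrict_apply' not_False_eq_True)
    from fam_rows_le[OF row_leads_subset i(1) this le big] kernel_card_rows[OF p(1), of k]
    show "\<exists>m\<ge>fam_rows (row_leads p k). card {c \<in> box p G. \<forall>q\<in>Q. int p dvd (\<Sum>x\<in>P. entry c x q * k x)} * p ^ m \<le> p ^ card G"
      by blast
  qed (use p finTy in auto)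
  with p(1) show ?thesis by blast
qed

end

section \<open>Surjectivity modulo a prime\<close>

context twist_data
begin

text \<open>Here \<open>\<phi>\<close> is read as a tuple of linear forms on the spaces of polynomials of degree \<open>e j\<close>.\<close>

definition contr :: "nat \<Rightarrow> (coord \<Rightarrow> int) \<Rightarrow> nat \<Rightarrow> ((nat \<Rightarrow> nat) \<Rightarrow> int) set" where
  "contr p \<phi> i = span_mod p (X (d i)) (SIGMA \<kappa>:J. X (e (fst \<kappa>) - d i)) (\<lambda>z \<alpha>. \<phi> (fst z, \<alpha> + snd z))"

definition contr_leads :: "nat \<Rightarrow> (coord \<Rightarrow> int) \<Rightarrow> nat \<Rightarrow> (nat \<Rightarrow> nat) set" where
  "contr_leads p \<phi> i = leads p (X (d i)) w (contr p \<phi> i)"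

lemma mod_space_contr: "prime p \<Longrightarrow> i \<in> {1..a} \<Longrightarrow> mod_space p (X (d i)) w (contr p \<phi> i)"
  unfolding contr_def by (intro mod_space_span inj_w_d) auto

lemma contr_leads_subset: "contr_leads p \<phi> i \<subseteq> X (d i)"
  by (auto simp: contr_leads_def leads_def)

lemma in_contr:
  assumes "\<kappa> \<in> J" "\<gamma> \<in> X (e (fst \<kappa>) - d i)"
  shows "(\<lambda>\<alpha>. \<phi> (\<kappa>, \<alpha> + \<gamma>)) \<in> contr p \<phi> i"
proof -
  let ?A = "SIGMA \<kappa>:J. X (e (fst \<kappa>) - d i)"
  have "finite ?A" "(\<kappa>, \<gamma>) \<in> ?A" using assms by auto
  hence "(\<lambda>\<alpha>. \<phi> (fst (\<kappa>, \<gamma>), \<alpha> + snd (\<kappa>, \<gamma>)))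
      \<in> span_mod p (X (d i)) ?A (\<lambda>z \<alpha>. \<phi> (fst z, \<alpha> + snd z))"
    by (rule span_mod_base[where \<phi> = "\<lambda>z \<alpha>. \<phi> (fst z, \<alpha> + snd z)" and u = "(\<kappa>, \<gamma>)"])
  thus ?thesis by (simp only: contr_def fst_conv snd_conv)
qed

text \<open>For every lead \<open>\<alpha>\<close> in degree \<open>d i\<close> and each of the
  \<open>s i\<close> columns of that degree, a matrix supported in this column pulls
  \<open>\<phi>\<close> back to a functional with leading coordinate
  \<open>\<alpha>\<close>.\<close>

lemma kernel_card_contr:
  assumes p: "prime p"
  shows "card {c \<in> box p G. \<forall>x\<in>P. int p dvd (\<Sum>q\<in>Q. entry c x q * \<phi> q)}
       * p ^ (\<Sum>i=1..a. s i * card (contr_leads p \<phi> i)) \<le> p ^ card G"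
proof -
  let ?N = "contr_leads p \<phi>"
  define S where "S = (SIGMA \<iota>:I. ?N (fst \<iota>))"
  define \<tau> where "\<tau> = (\<lambda>g x :: coord. case (g, x) of ((\<iota>', \<kappa>, \<gamma>), \<iota>, \<alpha>) \<Rightarrow> if \<iota>' = \<iota> then \<phi> (\<kappa>, \<alpha> + \<gamma>) else (0::int))"
  define W where "W = (\<lambda>x :: coord. w (snd x))"
  have fin: "finite (?N i)" for i by (rule finite_subset[OF contr_leads_subset finite_exponents])
  have SP: "S \<subseteq> P" unfolding S_def coords_def by (intro Sigma_mono order.refl contr_leads_subset)
  have T: "(\<Sum>q\<in>Q. entry c x q * \<phi> q) = (\<Sum>g\<in>G. c g * \<tau> g x)" if "x \<in> P" for c x
    unfolding entry_dual_apply_G[OF that] \<tau>_def ..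
  have "\<exists>v. \<not> int p dvd (\<Sum>g\<in>G. v g * \<tau> g x) \<and>
      (\<forall>x'\<in>S. x' \<noteq> x \<longrightarrow> W x \<le> W x' \<longrightarrow> int p dvd (\<Sum>g\<in>G. v g * \<tau> g x'))" if x: "x \<in> S" for x
  proof -
    obtain \<iota> \<alpha> where x': "x = (\<iota>, \<alpha>)" "\<iota> \<in> I" "\<alpha> \<in> ?N (fst \<iota>)" using x by (auto simp: S_def)
    then obtain f where f: "f \<in> contr p \<phi> (fst \<iota>)" "\<alpha> \<in> X (d (fst \<iota>))" "\<not> int p dvd f \<alpha>"
        "\<And>y. y \<in> X (d (fst \<iota>)) \<Longrightarrow> w \<alpha> < w y \<Longrightarrow> int p dvd f y"
      by (auto simp: contr_leads_def leads_def)
    let ?A = "SIGMA \<kappa>:J. X (e (fst \<kappa>) - d (fst \<iota>))"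
    from f(1) obtain a' where a': "\<And>x. x \<in> X (d (fst \<iota>)) \<Longrightarrow> int p dvd f x - (\<Sum>z\<in>?A. a' z * \<phi> (fst z, x + snd z))"
      by (auto simp: contr_def span_mod_def)
    define v where "v = (\<lambda>(\<iota>', \<kappa>, \<gamma>). if \<iota>' = \<iota> then a' (\<kappa>, \<gamma>) else (0::int))"
    have v: "(\<Sum>g\<in>G. v g * \<tau> g (\<iota>', \<alpha>')) = (if \<iota>' = \<iota> then \<Sum>z\<in>?A. a' z * \<phi> (fst z, \<alpha>' + snd z) else 0)"
      if "(\<iota>', \<alpha>') \<in> P" for \<iota>' \<alpha>'
    proof -
      have "\<iota>' \<in> I" "\<alpha>' \<in> X (d (fst \<iota>'))" using that by (auto simp: coords_def)
      from entry_dual_apply[OF this, of v \<phi>] show ?thesis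
        unfolding T[OF that, symmetric]
        by (cases "\<iota>' = \<iota>") (simp_all add: v_def sum.Sigma case_prod_unfold)
    qed
    have "\<not> int p dvd (\<Sum>z\<in>?A. a' z * \<phi> (fst z, \<alpha> + snd z))"
    proof
      assume "int p dvd (\<Sum>z\<in>?A. a' z * \<phi> (fst z, \<alpha> + snd z))"
      from dvd_add[OF a'[OF f(2)] this] show False using f(3) by simp
    qed
    hence 1: "\<not> int p dvd (\<Sum>g\<in>G. v g * \<tau> g x)" using v[of \<iota> \<alpha>] x x'(1) SP by auto
    have 2: "int p dvd (\<Sum>g\<in>G. v g * \<tau> g x')" if x'': "x' \<in> S" "x' \<noteq> x" "W x \<le> W x'" for x'
    proof -
      obtain \<iota>' \<alpha>' where k': "x' = (\<iota>', \<alpha>')" by (cases x')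
      show ?thesis
      proof (cases "\<iota>' = \<iota>")
        case False
        thus ?thesis using v[of \<iota>' \<alpha>'] x'' k' SP by auto
      next
        case True
        have b': "\<alpha>' \<in> X (d (fst \<iota>))" using x'' k' True SP by (auto simp: coords_def)
        have "w \<alpha> \<noteq> w \<alpha>'" using x'' k' True x'(1) b' f(2) inj_w_d[OF blocks_I[OF x'(2)]] by (auto simp: inj_on_def)
        hence "w \<alpha> < w \<alpha>'" using x''(3) k' x' by (simp add: W_def)
        hence "int p dvd f \<alpha>'" using f(4) b' by blast
        from dvd_diff[OF this a'[OF b']]
        have "int p dvd (\<Sum>z\<in>?A. a' z * \<phi> (fst z, \<alpha>' + snd z))" by simp
        thus ?thesis using v[of \<iota>' \<alpha>'] x'' k' SP True by auto
      qed
    qed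
    from 1 2 show ?thesis by blast
  qed
  hence "card {c \<in> box p G. \<forall>x\<in>S. int p dvd (\<Sum>g\<in>G. c g * \<tau> g x)} * p ^ card S \<le> p ^ card G"
    by (intro card_kernel_triangular[where w = W, OF p finite_G] finite_subset[OF SP finite_coords])
  moreover have "card S = (\<Sum>i=1..a. s i * card (?N i))"
    unfolding S_def using fin by (rule card_Sigma_blocks)
  moreover have "card {c \<in> box p G. \<forall>x\<in>P. int p dvd (\<Sum>q\<in>Q. entry c x q * \<phi> q)}
      \<le> card {c \<in> box p G. \<forall>x\<in>S. int p dvd (\<Sum>g\<in>G. c g * \<tau> g x)}"
    by (rule card_mono) (use SP T in auto)
  ultimately show ?thesis using order_trans[OF mult_le_mono1] by simp
qed

text \<open>Contracting by \<open>\<gamma>\<close> turns \<open>f\<close> into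
  \<open>f (x + \<gamma>)\<close> in degree \<open>d i\<close> and shifts all keys by a constant, so
  leading coordinates correspond. Through this the leads in degree \<open>d a\<close> control those
  in every source degree.\<close>

lemma contr_leads_down:
  assumes p: "prime p" and i: "i \<in> {1..a}" and \<alpha>: "\<alpha> \<in> X (d i)" and \<gamma>: "\<gamma> \<in> X (d a - d i)"
    and lead: "\<alpha> + \<gamma> \<in> contr_leads p \<phi> a"
  shows "\<alpha> \<in> contr_leads p \<phi> i"
proof -
  interpret M: mod_space p "X (d i)" w "contr p \<phi> i" by (rule mod_space_contr[OF p i])
  let ?A = "SIGMA \<kappa>:J. X (e (fst \<kappa>) - d a)"
  from lead obtain f where f: "f \<in> contr p \<phi> a" "\<not> int p dvd f (\<alpha> + \<gamma>)"
      "\<And>y. y \<in> X (d a) \<Longrightarrow> w (\<alpha> + \<gamma>) < w y \<Longrightarrow> int p dvd f y"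
    by (auto simp: contr_leads_def leads_def simp del: plus_fun_apply)
  from f(1) obtain a' where a': "\<And>x. x \<in> X (d a) \<Longrightarrow> int p dvd f x - (\<Sum>z\<in>?A. a' z * \<phi> (fst z, x + snd z))"
    by (auto simp: contr_def span_mod_def)
  have shift: "x + \<gamma> \<in> X (d a)" if "x \<in> X (d i)" for x
    using exponents_add[OF that \<gamma>] d_le[OF i] by simp
  have "(\<lambda>x. \<Sum>z\<in>?A. a' z * \<phi> (fst z, x + (\<gamma> + snd z))) \<in> contr p \<phi> i"
  proof (intro M.sum_in M.scale)
    fix z assume z: "z \<in> ?A"
    hence J: "fst z \<in> J" and g: "snd z \<in> X (e (fst (fst z)) - d a)" by auto
    have "(d a - d i) + (e (fst (fst z)) - d a) = e (fst (fst z)) - d i"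
      using d_le[OF i] e_gt[OF blocks_J[OF J]] by simp
    hence "\<gamma> + snd z \<in> X (e (fst (fst z)) - d i)" using exponents_add[OF \<gamma> g] by simp
    thus "(\<lambda>x. \<phi> (fst z, x + (\<gamma> + snd z))) \<in> contr p \<phi> i" by (rule in_contr[OF J])
  qed auto
  moreover have "int p dvd (\<Sum>z\<in>?A. a' z * \<phi> (fst z, x + (\<gamma> + snd z))) - f (x + \<gamma>)" if "x \<in> X (d i)" for x
    using a'[OF shift[OF that]] by (subst dvd_diff_commute) (simp only: add.assoc)
  ultimately have "(\<lambda>x. f (x + \<gamma>)) \<in> contr p \<phi> i" by (rule M.cong)
  moreover have "int p dvd f (y + \<gamma>)" if "y \<in> X (d i)" "w \<alpha> < w y" for y
    by (rule f(3)[OF shift[OF that(1)]]) (simp only: key_add that(2) add_less_cancel_right)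
  ultimately show ?thesis unfolding contr_leads_def leads_def
    using \<alpha> f(2) by (intro CollectI conjI bexI[of _ "\<lambda>x. f (x + \<gamma>)"] ballI impI)
qed

text \<open>For \<open>x\<close> outside \<open>N\<close>, \<open>expand\<close> writes the value of
  \<open>\<phi>\<close> at \<open>x + \<gamma>\<close> through its values at
  \<open>m + \<gamma>\<close> with \<open>m\<close> in \<open>N\<close>, and by
  \<open>reduced_above\<close> only larger \<open>m\<close> occur. Given the reduced basis,
  \<open>\<phi>\<close> is therefore recovered in decreasing order from its values outside the
  shadow of the complement of \<open>N\<close>.\<close>

lemma card_contr_family:
  assumes p: "prime p" and N: "N \<subseteq> X (d a)"
  shows "card {\<phi> \<in> box p Q. contr_leads p \<phi> a = N} \<le> p ^ (card N * (D a - card N)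
       + (\<Sum>j=1..b. t j * (E j - card (up_shadow n (e j - d a) (X (d a) - N)))))"
proof -
  let ?X = "X (d a)"
  let ?U = "\<lambda>j. up_shadow n (e j - d a) (?X - N)"
  define Q' where "Q' = (SIGMA \<kappa>:J. X (e (fst \<kappa>)) - ?U (fst \<kappa>))"
  define Z where "Z = N \<times> (?X - N)"
  define b' where "b' \<phi> = (\<lambda>(m, x)\<in>Z. reduced p ?X w (contr p \<phi> a) m x)" for \<phi>
  define F where "F \<phi> = (restrict \<phi> Q', b' \<phi>)" for \<phi>
  have a: "a \<in> {1..a}" using a_pos by simp
  have finN: "finite N" using N finite_subset finite_exponents by blast
  have finZ: "finite Z" and finQ: "finite Q'" unfolding Z_def Q'_def using finN by auto
  have Q': "Q' \<subseteq> Q" unfolding Q'_def coords_def by (intro Sigma_mono order.refl Diff_subset)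
  have "inj_on F {\<phi> \<in> box p Q. contr_leads p \<phi> a = N}"
  proof (rule inj_onI, clarify)
    fix \<phi> \<phi>' assume \<phi>: "\<phi> \<in> box p Q" "N = contr_leads p \<phi> a"
      and \<phi>': "\<phi>' \<in> box p Q" "contr_leads p \<phi>' a = contr_leads p \<phi> a" and F: "F \<phi> = F \<phi>'"
    have F': "restrict \<phi> Q' = restrict \<phi>' Q'" "b' \<phi> = b' \<phi>'" using F by (simp_all add: F_def)
    interpret M: mod_space p ?X w "contr p \<phi> a" by (rule mod_space_contr[OF p a])
    interpret M': mod_space p ?X w "contr p \<phi>' a" by (rule mod_space_contr[OF p a])
    have L: "M.L = N" "M'.L = N" using \<phi>(2) \<phi>'(2) by (simp_all only: contr_leads_def)
    have b: "M.b m x = M'.b m x" if "m \<in> N" "x \<in> ?X" for m x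
    proof (cases "x \<in> N")
      case True
      thus ?thesis using M.reduced(3)[of x m] M'.reduced(3)[of x m] L by simp
    next
      case False
      hence "(m, x) \<in> Z" using that by (auto simp: Z_def)
      thus ?thesis using fun_cong[OF F'(2), of "(m, x)"] by (simp add: b'_def)
    qed
    have eq: "int p dvd \<phi> q - \<phi>' q" if "q \<in> Q" for q
    proof (rule ccontr)
      assume "\<not> int p dvd \<phi> q - \<phi>' q"
      let ?B = "{q\<in>Q. \<not> int p dvd \<phi> q - \<phi>' q}"
      have "finite ?B" by simp
      moreover have "q \<in> ?B" using that \<open>\<not> _\<close> by simp
      hence "?B \<noteq> {}" by blast
      ultimately obtain q0 where q0: "q0 \<in> ?B" and max: "\<And>q. q \<in> ?B \<Longrightarrow> w (snd q) \<le> w (snd q0)"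
        by (rule finite_max_key[where w = "\<lambda>q. w (snd q)"]) auto
      obtain \<kappa> \<beta> where q: "q0 = (\<kappa>, \<beta>)" "\<kappa> \<in> J" "\<beta> \<in> X (e (fst \<kappa>))" using q0 by (auto simp: coords_def)
      have "\<beta> \<in> ?U (fst \<kappa>)"
      proof (rule ccontr)
        assume "\<beta> \<notin> ?U (fst \<kappa>)"
        hence "q0 \<in> Q'" using q by (auto simp: Q'_def)
        hence "\<phi> q0 = \<phi>' q0" using fun_cong[OF F'(1), of q0] by simp
        thus False using q0 by simp
      qed
      then obtain x \<gamma> where x: "x \<in> ?X" "x \<notin> N" "\<gamma> \<in> X (e (fst \<kappa>) - d a)" "\<beta> = x + \<gamma>"
        by (elim up_shadowE) blast
      have mem: "(\<lambda>\<alpha>. \<phi> (\<kappa>, \<alpha> + \<gamma>)) \<in> contr p \<phi> a" "(\<lambda>\<alpha>. \<phi>' (\<kappa>, \<alpha> + \<gamma>)) \<in> contr p \<phi>' a"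
        using in_contr[OF q(2) x(3)] by blast+
      have 1: "int p dvd \<phi> (\<kappa>, x + \<gamma>) - (\<Sum>m\<in>N. \<phi> (\<kappa>, m + \<gamma>) * M.b m x)"
        using M.expand[OF mem(1) x(1)] unfolding L .
      have 2: "int p dvd \<phi>' (\<kappa>, x + \<gamma>) - (\<Sum>m\<in>N. \<phi>' (\<kappa>, m + \<gamma>) * M.b m x)"
        using M'.expand[OF mem(2) x(1)] b[OF _ x(1)] unfolding L by (simp cong: sum.cong)
      have 3: "int p dvd (\<Sum>m\<in>N. (\<phi> (\<kappa>, m + \<gamma>) - \<phi>' (\<kappa>, m + \<gamma>)) * M.b m x)"
      proof (rule dvd_sum)
        fix m assume m: "m \<in> N"
        have mX: "m \<in> ?X" using m N by auto
        show "int p dvd (\<phi> (\<kappa>, m + \<gamma>) - \<phi>' (\<kappa>, m + \<gamma>)) * M.b m x"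
        proof (cases "w m \<le> w x")
          case True
          have "w m \<noteq> w x" using inj_w_d[OF a] mX x m by (auto simp: inj_on_def)
          thus ?thesis using M.reduced_above[OF x(1), of m] True by simp
        next
          case False
          have "m + \<gamma> \<in> X (e (fst \<kappa>))"
            using exponents_add[OF mX x(3)] e_gt[OF blocks_J[OF q(2)]] by simp
          hence "(\<kappa>, m + \<gamma>) \<in> Q" using q(2) by (simp add: coords_def)
          moreover have "w (m + \<gamma>) > w \<beta>" using False unfolding x(4) by (simp only: key_add not_le add_less_cancel_right)
          ultimately have "int p dvd \<phi> (\<kappa>, m + \<gamma>) - \<phi>' (\<kappa>, m + \<gamma>)"
            using max[of "(\<kappa>, m + \<gamma>)"] q(1) by fastforce
          thus ?thesis by simp
        qed
      qed
      have "int p dvd \<phi> (\<kappa>, x + \<gamma>) - \<phi>' (\<kappa>, x + \<gamma>)"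
        using dvd_add[OF dvd_diff[OF 1 2] 3] by (simp add: left_diff_distrib sum_subtractf)
      thus False using q0 q(1) x(4) by simp
    qed
    show "\<phi> = \<phi>'" by (rule box_eqI[OF \<phi>(1) \<phi>'(1) eq])
  qed
  moreover have "F ` {\<phi> \<in> box p Q. contr_leads p \<phi> a = N} \<subseteq> box p Q' \<times> box p Z"
  proof (rule image_subsetI)
    fix \<phi> assume "\<phi> \<in> {\<phi> \<in> box p Q. contr_leads p \<phi> a = N}"
    hence "restrict \<phi> Q' \<in> box p Q'" using Q' by (auto simp: box_def PiE_iff)
    moreover have "b' \<phi> \<in> box p Z"
    proof -
      interpret M: mod_space p ?X w "contr p \<phi> a" by (rule mod_space_contr[OF p a])
      have "M.b m x \<in> {0..<int p}" if "x \<in> ?X" for m x using boxD[OF M.reduced(2) that] by simp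
      thus ?thesis by (auto simp: b'_def box_def Z_def)
    qed
    ultimately show "F \<phi> \<in> box p Q' \<times> box p Z" by (simp add: F_def)
  qed
  ultimately have "card {\<phi> \<in> box p Q. contr_leads p \<phi> a = N} \<le> card (box p Q' \<times> box p Z)"
    using finQ finZ by (intro card_inj_on_le) auto
  also have "\<dots> = p ^ (card Z + card Q')"
    using finQ finZ by (simp add: card_cartesian_product card_box power_add)
  also have "card Q' = (\<Sum>j=1..b. t j * card (X (e j) - ?U j))"
    unfolding Q'_def by (rule card_Sigma_blocks) simp
  also have "\<dots> = (\<Sum>j=1..b. t j * (E j - card (?U j)))"
  proof (rule sum.cong[OF refl])
    fix j assume j: "j \<in> {1..b}"
    have "?U j \<subseteq> X (e j)" using up_shadow_subset[of "?X - N" n "d a" "e j - d a"] e_gt[OF j] by auto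
    thus "t j * card (X (e j) - ?U j) = t j * (E j - card (?U j))"
      by (simp add: card_Diff_subset finite_subset[OF _ finite_exponents])
  qed
  also have "card Z = card N * (D a - card N)"
    using N finN by (simp add: Z_def card_cartesian_product card_Diff_subset)
  finally show ?thesis .
qed

text \<open>One formula covers all \<open>N\<close>: for the full set the complement has empty
  shadow, and the value is the dimension of the whole target.\<close>

definition fam_contr :: "(nat \<Rightarrow> nat) set \<Rightarrow> nat" where
  "fam_contr N = card N * (D a - card N)
     + (\<Sum>j=1..b. t j * (E j - card (up_shadow n (e j - d a) (X (d a) - N))))"

text \<open>\<open>c i\<close> stands for the number of leads in degree \<open>d i\<close>, whose
  proportion is at least that of \<open>N\<close>. The strict growth of the shadow of the complement
  of \<open>N\<close> must outweigh \<open>card N * (D a - card N)\<close>.\<close>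

lemma fam_contr_le:
  assumes N: "N \<subseteq> X (d a)" "N \<noteq> {}"
    and c: "\<And>i. i \<in> {1..a} \<Longrightarrow> card N * D i \<le> c i * D a"
    and le: "(\<Sum>j=1..b. t j * E j) \<le> (\<Sum>i=1..a. s i * D i)"
    and big: "1 / 4 * real (D a) * real (E b) * (\<Sum>i=1..a. (real (D i))\<^sup>2) \<le> (\<Sum>i=1..a. real (s i) * real (D i))"
  shows "fam_contr N \<le> (\<Sum>i=1..a. s i * c i)"
proof (cases "N = X (d a)")
  case True
  have "D i \<le> c i" if "i \<in> {1..a}" for i using c[OF that] D_pos[of a] by (simp add: True)
  hence "(\<Sum>i=1..a. s i * D i) \<le> (\<Sum>i=1..a. s i * c i)" by (intro sum_mono mult_left_mono) auto
  moreover have "fam_contr N \<le> (\<Sum>j=1..b. t j * E j)" by (simp add: fam_contr_def True sum_mono)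
  ultimately show ?thesis using le by linarith
next
  case False
  let ?U = "\<lambda>j. up_shadow n (e j - d a) (X (d a) - N)"
  define \<nu> where "\<nu> = real (card N)"
  define \<Sigma> where "\<Sigma> = (\<Sum>i=1..a. real (s i) * real (D i))"
  have finN: "finite N" using N finite_subset finite_exponents by blast
  have cardN: "card N \<le> D a" "card N > 0" using N finN by (auto intro: card_mono simp: card_gt_0_iff)
  have U: "(real (D a) - \<nu>) * real (E j) + 1 \<le> real (card (?U j)) * real (D a)" if "j \<in> {1..b}" for j
  proof -
    have "card (X (d a) - N) * E j < card (?U j) * D a"
      using card_up_shadow_less[of "X (d a) - N" n "d a" "e j - d a"] N False e_gt[OF that] by fastforce
    hence "(D a - card N) * E j + 1 \<le> card (?U j) * D a"
      using N finN by (simp add: card_Diff_subset)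
    hence "real ((D a - card N) * E j + 1) \<le> real (card (?U j) * D a)" by (simp only: of_nat_le_iff)
    thus ?thesis using cardN by (simp add: \<nu>_def of_nat_diff)
  qed
  have U_le: "card (?U j) \<le> E j" if "j \<in> {1..b}" for j
    using up_shadow_subset[of "X (d a) - N" n "d a" "e j - d a"] e_gt[OF that] by (intro card_mono) auto
  have "real (fam_contr N) = \<nu> * (real (D a) - \<nu>) + (\<Sum>j=1..b. real (t j) * (real (E j) - real (card (?U j))))"
    using cardN U_le by (simp add: fam_contr_def \<nu>_def of_nat_diff)
  hence "real (D a) * real (fam_contr N)
      = real (D a) * (\<nu> * (real (D a) - \<nu>)) + (\<Sum>j=1..b. real (t j) * (real (D a) * real (E j) - real (card (?U j)) * real (D a)))"
    by (simp add: distrib_left sum_distrib_left right_diff_distrib mult_ac)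
  moreover have "real (D a) * (\<nu> * (real (D a) - \<nu>)) \<le> real (D a) * ((real (D a))\<^sup>2 / 4)"
    by (intro mult_left_mono mult_diff_le_quarter) simp
  \<comment> \<open>The gain of one unit is weakened to \<open>E j / E b\<close>. The bound becomes
    proportional to \<open>E j\<close>, so its sum can be compared with the dimension of the source,
    where the hypothesis is available.\<close>
  moreover have "(\<Sum>j=1..b. real (t j) * (real (D a) * real (E j) - real (card (?U j)) * real (D a)))
      \<le> (\<Sum>j=1..b. real (t j) * real (E j) * (\<nu> - 1 / real (E b)))"
  proof (rule sum_mono)
    fix j assume j: "j \<in> {1..b}"
    have "real (E j) / real (E b) \<le> 1" using E_le[OF j] E_pos[of b] by simp
    hence "real (D a) * real (E j) - real (card (?U j)) * real (D a) \<le> real (E j) * (\<nu> - 1 / real (E b))"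
      using U[OF j] by (simp add: algebra_simps)
    thus "real (t j) * (real (D a) * real (E j) - real (card (?U j)) * real (D a))
        \<le> real (t j) * real (E j) * (\<nu> - 1 / real (E b))"
      unfolding mult.assoc by (intro mult_left_mono) auto
  qed
  \<comment> \<open>Passing to the larger dimension requires a nonnegative factor, which holds
    because \<open>N\<close> has at least one element.\<close>
  moreover have "(\<Sum>j=1..b. real (t j) * real (E j) * (\<nu> - 1 / real (E b))) \<le> \<Sigma> * (\<nu> - 1 / real (E b))"
  proof -
    have "real (\<Sum>j=1..b. t j * E j) \<le> real (\<Sum>i=1..a. s i * D i)" using le by (simp only: of_nat_le_iff)
    hence "(\<Sum>j=1..b. real (t j) * real (E j)) \<le> \<Sigma>" by (simp add: \<Sigma>_def)
    moreover have "1 / real (E b) \<le> 1" using E_pos[of b] by simp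
    hence "1 / real (E b) \<le> \<nu>" using cardN(2) unfolding \<nu>_def by linarith
    ultimately show ?thesis by (simp add: sum_distrib_right[symmetric] mult_right_mono)
  qed
  \<comment> \<open>The loss in the one stratified degree is covered by the term
    \<open>i = a\<close> of the sum of squares.\<close>
  moreover have "real (D a) * ((real (D a))\<^sup>2 / 4) \<le> \<Sigma> / real (E b)"
  proof -
    have "(real (D a))\<^sup>2 \<le> (\<Sum>i=1..a. (real (D i))\<^sup>2)"
      using a_pos by (intro member_le_sum) auto
    hence "1 / 4 * real (D a) * real (E b) * (real (D a))\<^sup>2 \<le> 1 / 4 * real (D a) * real (E b) * (\<Sum>i=1..a. (real (D i))\<^sup>2)"
      by (intro mult_left_mono) auto
    also have "\<dots> \<le> \<Sigma>" using big by (simp only: \<Sigma>_def)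
    finally show ?thesis using E_pos[of b] by (simp add: field_simps)
  qed
  moreover have "\<Sigma> * \<nu> \<le> real (D a) * real (\<Sum>i=1..a. s i * c i)"
  proof -
    have "\<Sigma> * \<nu> = (\<Sum>i=1..a. real (s i) * real (card N * D i))"
      by (simp add: \<Sigma>_def \<nu>_def sum_distrib_left sum_distrib_right mult_ac)
    also have "\<dots> \<le> (\<Sum>i=1..a. real (s i) * real (c i * D a))"
      by (intro sum_mono mult_left_mono of_nat_mono c) auto
    also have "\<dots> = real (D a) * real (\<Sum>i=1..a. s i * c i)" by (simp add: sum_distrib_left mult_ac)
    finally show ?thesis .
  qed
  ultimately have "real (D a) * real (fam_contr N) \<le> real (D a) * real (\<Sum>i=1..a. s i * c i)"
    by (simp add: right_diff_distrib)
  hence "real (fam_contr N) \<le> real (\<Sum>i=1..a. s i * c i)"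
    using D_pos[of a] by (subst (asm) mult_le_cancel_left_pos) auto
  thus ?thesis by (simp only: of_nat_le_iff)
qed

lemma exists_surjective_mod:
  assumes le: "(\<Sum>j=1..b. t j * E j) \<le> (\<Sum>i=1..a. s i * D i)"
    and big: "1 / 4 * real (D a) * real (E b) * (\<Sum>i=1..a. (real (D i))\<^sup>2) \<le> (\<Sum>i=1..a. real (s i) * real (D i))"
  shows "\<exists>p c. prime p \<and> (\<forall>\<phi>. (\<forall>x\<in>P. int p dvd (\<Sum>q\<in>Q. entry c x q * \<phi> q)) \<longrightarrow> (\<forall>q\<in>Q. int p dvd \<phi> q))"
proof -
  define Ty where "Ty = Pow (X (d a))"
  have finTy: "finite Ty" unfolding Ty_def by auto
  obtain p where p: "prime p" "card Ty + 1 < p" using bigger_prime by blast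
  let ?N = "\<lambda>\<phi>. contr_leads p \<phi> a"
  have a: "a \<in> {1..a}" using a_pos by simp
  have "\<exists>c. \<forall>\<phi>. (\<forall>x\<in>P. int p dvd (\<Sum>q\<in>Q. entry c x q * \<phi> q)) \<longrightarrow> (\<forall>q\<in>Q. int p dvd \<phi> q)"
  proof (rule exists_injective_mod_p[where G = G and Ty = Ty and \<tau> = ?N and fam = fam_contr])
    show "card Ty < p - 1" using p by simp
  next
    fix \<phi> show "?N \<phi> \<in> Ty" using contr_leads_subset by (auto simp: Ty_def)
  next
    fix N assume "N \<in> Ty"
    thus "card {\<phi> \<in> box p Q. ?N \<phi> = N} \<le> p ^ fam_contr N"
      using card_contr_family[OF p(1)] unfolding fam_contr_def Ty_def by blast
  next
    fix \<phi> assume "\<phi> \<in> box p Q \<and> (\<exists>q\<in>Q. \<not> int p dvd \<phi> q)"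
    then obtain \<kappa> \<beta> where x: "(\<kappa>, \<beta>) \<in> Q" "\<not> int p dvd \<phi> (\<kappa>, \<beta>)" by auto
    hence q: "\<kappa> \<in> J" "\<beta> \<in> X (e (fst \<kappa>))" by (auto simp: coords_def)
    \<comment> \<open>Every monomial of degree \<open>e j\<close> has a divisor of degree
      \<open>d a\<close>, so a nonzero \<open>\<phi>\<close> has a nonzero contraction there and its
      type is not empty.\<close>
    hence "\<beta> \<in> X (d a + (e (fst \<kappa>) - d a))" using e_gt[OF blocks_J[OF q(1)]] by simp
    then obtain \<alpha> \<gamma> where b: "\<alpha> \<in> X (d a)" "\<gamma> \<in> X (e (fst \<kappa>) - d a)" "\<beta> = \<alpha> + \<gamma>" by (rule exponents_split)
    interpret M: mod_space p "X (d a)" w "contr p \<phi> a" by (rule mod_space_contr[OF p(1) a])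
    have "\<not> int p dvd \<phi> (\<kappa>, \<alpha> + \<gamma>)" using x(2) by (simp only: b(3) not_False_eq_True)
    then obtain x where "x \<in> M.L"
      using M.in_leads_max[of "\<lambda>\<alpha>. \<phi> (\<kappa>, \<alpha> + \<gamma>)" \<alpha>] in_contr[OF q(1) b(2), of \<phi> p] b(1) by blast
    hence nonempty: "?N \<phi> \<noteq> {}" unfolding contr_leads_def by blast
    have c: "card (?N \<phi>) * D i \<le> card (contr_leads p \<phi> i) * D a" if i: "i \<in> {1..a}" for i
    proof -
      have da: "d a = d i + (d a - d i)" using d_le[OF i] by simp
      let ?Z = "{\<alpha>\<in>X (d i). \<exists>\<gamma>\<in>X (d a - d i). \<alpha> + \<gamma> \<in> ?N \<phi>}"
      have "card (?N \<phi>) * D i \<le> card ?Z * D a"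
        using card_down_shadow_le[of "?N \<phi>" n "d i" "d a - d i"] contr_leads_subset da by metis
      also have "card ?Z \<le> card (contr_leads p \<phi> i)"
        using contr_leads_down[OF p(1) i]
        by (intro card_mono finite_subset[OF contr_leads_subset finite_exponents]) blast
      finally show ?thesis by simp
    qed
    from fam_contr_le[OF contr_leads_subset nonempty c le big] kernel_card_contr[OF p(1), of \<phi>]
    show "\<exists>m\<ge>fam_contr (?N \<phi>). card {c \<in> box p G. \<forall>x\<in>P. int p dvd (\<Sum>q\<in>Q. entry c x q * \<phi> q)} * p ^ m \<le> p ^ card G"
      by blast
  qed (use p finTy in auto)
  with p(1) show ?thesis by blast
qed

end

section \<open>Forms\<close>

definition monom_fun :: "nat \<Rightarrow> (nat \<Rightarrow> nat) \<Rightarrow> (nat \<Rightarrow> complex) \<Rightarrow> complex" where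
  "monom_fun n \<alpha> x = (\<Prod>i\<le>n. x i ^ \<alpha> i)"

lemma forms_monom_fun: "forms n k = {f. \<exists>c. f = (\<lambda>x. \<Sum>\<alpha>\<in>exponents n k. c \<alpha> * monom_fun n \<alpha> x)}"
  by (simp add: forms_def monom_fun_def)

lemma formE:
  assumes "f \<in> forms n k"
  obtains c where "f = (\<lambda>x. \<Sum>\<alpha>\<in>exponents n k. c \<alpha> * monom_fun n \<alpha> x)"
  using assms by (auto simp: forms_monom_fun)

lemma formI: "(\<lambda>x. \<Sum>\<alpha>\<in>exponents n k. c \<alpha> * monom_fun n \<alpha> x) \<in> forms n k"
  by (auto simp: forms_monom_fun)

lemma monom_fun_add: "monom_fun n (\<alpha> + \<gamma>) x = monom_fun n \<alpha> x * monom_fun n \<gamma> x"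
  by (simp add: monom_fun_def power_add prod.distrib)

lemma monom_fun_scale: "\<alpha> \<in> exponents n k \<Longrightarrow> monom_fun n \<alpha> (\<lambda>i. c * x i) = c ^ k * monom_fun n \<alpha> x"
  using sum_exponents[of \<alpha> n k] by (simp add: monom_fun_def power_mult_distrib prod.distrib power_sum[symmetric])

lemma monom_fun_cong: "(\<And>i. i \<le> n \<Longrightarrow> x i = y i) \<Longrightarrow> monom_fun n \<alpha> x = monom_fun n \<alpha> y"
  by (simp add: monom_fun_def)

lemma form_scale: "f \<in> forms n k \<Longrightarrow> f (\<lambda>i. c * x i) = c ^ k * f x"
  by (auto elim!: formE simp: monom_fun_scale sum_distrib_left mult_ac)

lemma form_cong: "f \<in> forms n k \<Longrightarrow> (\<And>i. i \<le> n \<Longrightarrow> x i = y i) \<Longrightarrow> f x = f y"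
  using monom_fun_cong[of n x y] by (auto elim!: formE)

lemma forms_zero: "(\<lambda>_. 0) \<in> forms n k"
  using formI[where c = "\<lambda>_. 0"] by simp

lemma forms_add:
  assumes "f \<in> forms n k" "g \<in> forms n k" shows "(\<lambda>x. f x + g x) \<in> forms n k"
proof -
  obtain c c' where "f = (\<lambda>x. \<Sum>\<alpha>\<in>exponents n k. c \<alpha> * monom_fun n \<alpha> x)" "g = (\<lambda>x. \<Sum>\<alpha>\<in>exponents n k. c' \<alpha> * monom_fun n \<alpha> x)"
    using assms by (auto elim!: formE)
  thus ?thesis using formI[where n = n and k = k and c = "\<lambda>\<alpha>. c \<alpha> + c' \<alpha>"] by (simp add: sum.distrib distrib_right)
qed

lemma forms_cmult:
  assumes "f \<in> forms n k" shows "(\<lambda>x. c * f x) \<in> forms n k"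
proof -
  obtain c' where "f = (\<lambda>x. \<Sum>\<alpha>\<in>exponents n k. c' \<alpha> * monom_fun n \<alpha> x)" using assms by (auto elim!: formE)
  thus ?thesis using formI[where n = n and k = k and c = "\<lambda>\<alpha>. c * c' \<alpha>"] by (simp add: sum_distrib_left mult_ac)
qed

lemma forms_sum: "(\<And>i. i \<in> A \<Longrightarrow> f i \<in> forms n k) \<Longrightarrow> (\<lambda>x. \<Sum>i\<in>A. f i x) \<in> forms n k"
  by (induction A rule: infinite_finite_induct) (auto simp: forms_zero forms_add)

lemma monom_fun_in_forms: assumes "\<alpha> \<in> exponents n k" shows "monom_fun n \<alpha> \<in> forms n k"
proof -
  have "(\<Sum>\<beta>\<in>exponents n k. (if \<beta> = \<alpha> then 1 else 0) * monom_fun n \<beta> x) = monom_fun n \<alpha> x" for x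
    using assms by (subst sum.remove[of _ \<alpha>]) auto
  thus ?thesis using formI[where n = n and k = k and c = "\<lambda>\<beta>. if \<beta> = \<alpha> then 1 else 0"] by simp
qed

lemma forms_mult:
  assumes "f \<in> forms n k" "g \<in> forms n m" shows "(\<lambda>x. f x * g x) \<in> forms n (k + m)"
proof -
  obtain c c' where f: "f = (\<lambda>x. \<Sum>\<alpha>\<in>exponents n k. c \<alpha> * monom_fun n \<alpha> x)" "g = (\<lambda>x. \<Sum>\<alpha>\<in>exponents n m. c' \<alpha> * monom_fun n \<alpha> x)"
    using assms by (auto elim!: formE)
  have "(\<lambda>x. \<Sum>\<alpha>\<in>exponents n k. \<Sum>\<beta>\<in>exponents n m. (c \<alpha> * c' \<beta>) * monom_fun n (\<alpha> + \<beta>) x) \<in> forms n (k + m)"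
    by (intro forms_sum forms_cmult monom_fun_in_forms exponents_add)
  thus ?thesis unfolding f sum_product monom_fun_add by (simp only: mult_ac)
qed

lemma forms_const: "(\<lambda>_. c) \<in> forms n 0"
  using formI[where n = n and k = 0 and c = "\<lambda>_. c"] by (simp add: exponents_0 monom_fun_def)

lemma forms_times_var:
  assumes "f \<in> forms m k" shows "(\<lambda>x. x (Suc m) ^ j * f x) \<in> forms (Suc m) (k + j)"
proof -
  obtain c where f: "f = (\<lambda>x. \<Sum>\<alpha>\<in>exponents m k. c \<alpha> * monom_fun m \<alpha> x)" using assms by (rule formE)
  have "monom_fun (Suc m) (\<alpha>(Suc m := j)) x = x (Suc m) ^ j * monom_fun m \<alpha> x" for \<alpha> x
    by (simp add: monom_fun_def mult.commute)
  moreover have "\<alpha>(Suc m := j) \<in> exponents (Suc m) (k + j)" if "\<alpha> \<in> exponents m k" for \<alpha>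
    using that by (auto simp: exponents_def)
  ultimately have "(\<lambda>x. x (Suc m) ^ j * monom_fun m \<alpha> x) \<in> forms (Suc m) (k + j)" if "\<alpha> \<in> exponents m k" for \<alpha>
    using monom_fun_in_forms[of "\<alpha>(Suc m := j)" "Suc m" "k + j"] that by presburger
  hence "(\<lambda>x. \<Sum>\<alpha>\<in>exponents m k. c \<alpha> * (x (Suc m) ^ j * monom_fun m \<alpha> x)) \<in> forms (Suc m) (k + j)"
    by (intro forms_sum forms_cmult)
  thus ?thesis by (simp add: f sum_distrib_left mult_ac)
qed

section \<open>Functions that are polynomial along lines\<close>

lemma form_on_line:
  assumes "f \<in> forms n k" obtains H where "\<And>t. f (\<lambda>i. u i + t * v i) = poly H t"
proof -
  obtain c where f: "f = (\<lambda>x. \<Sum>\<alpha>\<in>exponents n k. c \<alpha> * monom_fun n \<alpha> x)" using assms by (rule formE)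
  have "f (\<lambda>i. u i + t * v i) = poly (\<Sum>\<alpha>\<in>exponents n k. Polynomial.smult (c \<alpha>) (\<Prod>i\<le>n. [:u i, v i:] ^ \<alpha> i)) t" for t
    by (simp add: f monom_fun_def poly_sum poly_prod)
  thus ?thesis by (rule that)
qed

lemma poly_eq_off_0:
  fixes H H' :: "complex poly"
  assumes "\<And>t. t \<noteq> 0 \<Longrightarrow> poly H t = poly H' t" shows "H = H'"
proof (rule ccontr)
  assume "H \<noteq> H'"
  hence "finite {t. poly (H - H') t = 0}" by (intro poly_roots_finite) simp
  moreover have "UNIV - {0} \<subseteq> {t. poly (H - H') t = 0}" using assms by auto
  ultimately have "finite (UNIV - {0 :: complex})" by (rule finite_subset[rotated])
  thus False using infinite_UNIV_char_0[where 'a = complex] by simp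
qed

text \<open>Substituting powers of a single variable separates the monomials.\<close>

lemma form_coeff_unique:
  assumes 0: "\<And>x. x \<in> vecs n - {0} \<Longrightarrow> (\<Sum>\<alpha>\<in>exponents n k. c \<alpha> * monom_fun n \<alpha> x) = 0"
    and \<alpha>: "\<alpha> \<in> exponents n k"
  shows "c \<alpha> = 0"
proof -
  let ?w = "key n (Suc k)"
  let ?H = "\<Sum>\<beta>\<in>exponents n k. monom (c \<beta>) (?w \<beta>)"
  have inj: "inj_on ?w (exponents n k)" by (rule inj_on_key) simp
  have "poly ?H z = poly 0 z" if "z \<noteq> 0" for z
  proof -
    let ?x = "\<lambda>i. if i \<le> n then z ^ (Suc k ^ i) else 0"
    have "?x \<noteq> 0"
    proof
      assume "?x = 0"
      from fun_cong[OF this, of 0] show False using that by simp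
    qed
    hence "?x \<in> vecs n - {0}" by (simp add: vecs_def)
    from 0[OF this] show ?thesis
      by (simp add: poly_sum poly_monom monom_fun_def key_def power_sum power_mult[symmetric] mult.commute)
  qed
  hence "?H = 0" by (rule poly_eq_off_0)
  hence "0 = coeff ?H (?w \<alpha>)" by simp
  also have "\<dots> = (\<Sum>\<beta>\<in>exponents n k. if \<beta> = \<alpha> then c \<beta> else 0)"
    unfolding coeff_sum using inj \<alpha> by (intro sum.cong) (auto simp: inj_on_def)
  also have "\<dots> = c \<alpha>" using \<alpha> by simp
  finally show ?thesis by simp
qed

text \<open>The polynomials whose product with \<open>h\<close> is a polynomial form an ideal without a common zero.\<close>

lemma poly_of_local_quotients:
  fixes h :: "complex \<Rightarrow> complex"
  assumes "\<And>t0. \<exists>g q r. poly g t0 \<noteq> 0 \<and> poly q t0 \<noteq> 0 \<and> (\<forall>t. poly g t \<noteq> 0 \<longrightarrow> poly q t * h t = poly r t)"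
  obtains H where "\<And>t. h t = poly H t"
proof -
  define I where "I = {q. \<exists>r. \<forall>t. poly q t * h t = poly r t}"
  have nz: "\<exists>q\<in>I. poly q t0 \<noteq> 0" for t0
  proof -
    obtain g q r where *: "poly g t0 \<noteq> 0" "poly q t0 \<noteq> 0" "\<And>t. poly g t \<noteq> 0 \<Longrightarrow> poly q t * h t = poly r t"
      using assms by blast
    \<comment> \<open>Multiplication by \<open>g\<close> extends the local identity to the whole
      line, as both sides vanish where \<open>g\<close> does.\<close>
    have "poly (g * q) t * h t = poly (g * r) t" for t
      using *(3)[of t] by (cases "poly g t = 0") auto
    hence "g * q \<in> I" unfolding I_def by blast
    with * show ?thesis by (intro bexI[of _ "g * q"]) auto
  qed
  then obtain q0 where "q0 \<in> I" "q0 \<noteq> 0" by (metis poly_0)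
  then obtain q where q: "q \<in> I" "q \<noteq> 0" and min: "\<And>q'. q' \<in> I \<Longrightarrow> q' \<noteq> 0 \<Longrightarrow> degree q \<le> degree q'"
    using ex_has_least_nat[of "\<lambda>q. q \<in> I \<and> q \<noteq> 0" q0 degree] by blast
  have "degree q = 0"
  proof (rule ccontr)
    assume "degree q \<noteq> 0"
    hence "\<not> constant (poly q)" by (simp add: constant_degree)
    \<comment> \<open>An element of minimal degree divides all others, so a root of it would be a
      common zero of the ideal.\<close>
    then obtain t0 where t0: "poly q t0 = 0" using fundamental_theorem_of_algebra by blast
    obtain s where s: "s \<in> I" "poly s t0 \<noteq> 0" using nz by blast
    obtain r r' where r: "\<And>t. poly q t * h t = poly r t" "\<And>t. poly s t * h t = poly r' t"
      using q(1) s(1) by (auto simp: I_def)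
    have sm: "s mod q = s - s div q * q" by (simp add: minus_div_mult_eq_mod)
    have "poly (s mod q) t * h t = poly (r' - s div q * r) t" for t
      using r[of t] unfolding sm by (simp add: left_diff_distrib mult.assoc)
    hence "s mod q \<in> I" unfolding I_def by blast
    hence "s mod q = 0" using min degree_mod_less'[OF q(2), of s] by (metis linorder_not_le)
    hence "poly s t0 = 0" using t0 by (auto simp: mod_eq_0_iff_dvd)
    with s(2) show False by simp
  qed
  then obtain c where c: "q = [:c:]" by (rule degree_eq_zeroE)
  obtain r where r: "\<And>t. poly q t * h t = poly r t" using q(1) by (auto simp: I_def)
  have "h t = poly (Polynomial.smult (1 / c) r) t" for t using r[of t] q(2) c by (auto simp: field_simps)
  thus ?thesis by (rule that)
qed

text \<open>Degrees are compared in \<open>t ^ degree H' * H = t ^ k * reflect_poly H'\<close>, and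
  reflection does not raise the degree. It is meant for a homogeneous function on a line, with the
  two spanning vectors exchanged.\<close>

lemma degree_le_of_reflect:
  fixes H H' :: "complex poly"
  assumes "\<And>t. t \<noteq> 0 \<Longrightarrow> poly H t = t ^ k * poly H' (inverse t)" shows "degree H \<le> k"
proof (cases "H = 0")
  case False
  have eq: "monom 1 (degree H') * H = monom 1 k * reflect_poly H'"
    by (rule poly_eq_off_0) (simp add: assms poly_monom poly_reflect_poly_nz)
  with False have nz: "reflect_poly H' \<noteq> 0" by auto
  have "degree H' + degree H = degree (monom 1 (degree H') * H)"
    using False by (subst degree_mult_eq) (auto simp: degree_monom_eq)
  also have "\<dots> = k + degree (reflect_poly H')"
    unfolding eq using nz by (subst degree_mult_eq) (auto simp: degree_monom_eq)
  also have "\<dots> \<le> k + degree H'" using degree_reflect_poly_le[of H'] by simp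
  finally show ?thesis by simp
qed simp

text \<open>Lagrange interpolation at \<open>0, ..., k\<close>. The weights are independent of
  \<open>H\<close>, so the coefficients along a family of parallel lines are fixed combinations of
  values of the function.\<close>

lemma coeff_by_values:
  obtains a :: "nat \<Rightarrow> complex"
  where "\<And>H :: complex poly. degree H \<le> k \<Longrightarrow> coeff H j = (\<Sum>l\<le>k. a l * poly H (of_nat l))"
proof -
  define L where "L l = (\<Prod>r\<in>{..k} - {l}. Polynomial.smult (1 / (of_nat l - of_nat r)) [:- of_nat r, 1:] :: complex poly)" for l
  have val: "poly (L l) (of_nat r) = (if r = l then 1 else 0)" if "l \<le> k" "r \<le> k" for l r
  proof (cases "r = l")
    case True
    thus ?thesis unfolding L_def poly_prod by (auto intro!: prod.neutral simp: diff_divide_distrib[symmetric])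
  next
    case False
    thus ?thesis unfolding L_def poly_prod using that by (auto intro!: prod_zero bexI[of _ r])
  qed
  have deg: "degree (L l) \<le> k" if "l \<le> k" for l
  proof -
    have "degree (L l) \<le> sum (degree \<circ> (\<lambda>r. Polynomial.smult (1 / (of_nat l - of_nat r)) [:- of_nat r, 1:] :: complex poly)) ({..k} - {l})"
      unfolding L_def by (rule degree_prod_sum_le) simp
    also have "\<dots> \<le> (\<Sum>r\<in>{..k} - {l}. 1)"
      by (intro sum_mono) (auto intro: order_trans[OF degree_smult_le])
    also have "\<dots> = k" using that by (simp add: card_Diff_singleton)
    finally show ?thesis .
  qed
  have "coeff H j = (\<Sum>l\<le>k. coeff (L l) j * poly H (of_nat l))" if H: "degree H \<le> k" for H
  proof -
    let ?S = "\<Sum>l\<le>k. Polynomial.smult (poly H (of_nat l)) (L l)"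
    have "H = ?S"
    proof (rule poly_eqI_degree)
      show "poly H x = poly ?S x" if "x \<in> of_nat ` {..k}" for x
      proof -
        obtain r where r: "x = of_nat r" "r \<le> k" using \<open>x \<in> of_nat ` {..k}\<close> by auto
        have "poly ?S x = (\<Sum>l\<le>k. if l = r then poly H (of_nat l) else 0)"
          unfolding poly_sum r(1) using r(2) by (intro sum.cong) (auto simp: val)
        thus ?thesis using r by simp
      qed
      have "card (of_nat ` {..k} :: complex set) = Suc k" by (subst card_image) (auto simp: inj_on_def)
      moreover have "degree ?S \<le> k"
        by (rule degree_sum_le) (use deg in auto)
      ultimately show "card (of_nat ` {..k} :: complex set) > degree H" "card (of_nat ` {..k} :: complex set) > degree ?S"
        using H by auto
    qed
    hence "coeff H j = coeff ?S j" by simp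
    thus ?thesis by (simp add: coeff_sum mult.commute)
  qed
  thus ?thesis by (rule that)
qed

text \<open>Independence keeps the line \<open>u + t v\<close> away from the origin, hence inside
  the cone over projective space.\<close>

definition indep2 :: "(nat \<Rightarrow> complex) \<Rightarrow> (nat \<Rightarrow> complex) \<Rightarrow> bool" where
  "indep2 u v \<longleftrightarrow> (\<forall>c d. (\<lambda>i. c * u i + d * v i) = 0 \<longrightarrow> c = 0 \<and> d = 0)"

lemma indep2_nonzero: "indep2 u v \<Longrightarrow> (\<lambda>i. u i + t * v i) \<noteq> 0"
  unfolding indep2_def by (drule spec[of _ 1], drule spec[of _ t]) auto

lemma indep2_commute: "indep2 u v \<Longrightarrow> indep2 v u"
  unfolding indep2_def by (metis (no_types, lifting) add.commute ext)

lemma vec_nonzeroE: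
  assumes "x \<in> vecs n - {0}" obtains i where "i \<le> n" "x i \<noteq> 0"
proof -
  have "\<exists>i. x i \<noteq> 0"
  proof (rule ccontr)
    assume "\<not> ?thesis"
    hence "x = 0" by (intro ext) simp
    with assms show False by simp
  qed
  then obtain i where "x i \<noteq> 0" ..
  moreover from this have "i \<le> n" using assms by (auto simp: vecs_def not_le[symmetric])
  ultimately show ?thesis using that by blast
qed

text \<open>Expand in powers of the last variable, where interpolation recovers the coefficients from values,
  and use induction on the number of variables.\<close>

lemma form_of_homogeneous_on_lines:
  assumes "\<And>c x. c \<noteq> 0 \<Longrightarrow> x \<in> vecs m - {0} \<Longrightarrow> f (\<lambda>i. c * x i) = c ^ k * f x"
    and "\<And>u v. u \<in> vecs m \<Longrightarrow> v \<in> vecs m \<Longrightarrow> indep2 u v \<Longrightarrow> \<exists>H. \<forall>t. f (\<lambda>i. u i + t * v i) = poly H t"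
  obtains p where "p \<in> forms m k" "\<And>x. x \<in> vecs m - {0} \<Longrightarrow> f x = p x"
proof -
  have "\<exists>p\<in>forms m k. \<forall>x\<in>vecs m - {0}. f x = p x"
    using assms
  proof (induction m arbitrary: f k)
    case 0
    define \<epsilon> :: "nat \<Rightarrow> complex" where "\<epsilon> = (\<lambda>i. if i = 0 then 1 else 0)"
    have "\<epsilon> \<noteq> 0"
    proof
      assume "\<epsilon> = 0"
      from fun_cong[OF this, of 0] show False by (simp add: \<epsilon>_def)
    qed
    hence e: "\<epsilon> \<in> vecs 0 - {0}" by (auto simp: \<epsilon>_def vecs_def)
    let ?\<delta> = "\<lambda>i. if i = 0 then k else 0"
    have 1: "(\<lambda>x. f \<epsilon> * monom_fun 0 ?\<delta> x) \<in> forms 0 k"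
      by (intro forms_cmult monom_fun_in_forms) (simp add: exponents_def)
    have 2: "f x = f \<epsilon> * monom_fun 0 ?\<delta> x" if x: "x \<in> vecs 0 - {0}" for x
    proof -
      have eq: "x = (\<lambda>i. x 0 * \<epsilon> i)" using x by (auto simp: vecs_def \<epsilon>_def fun_eq_iff)
      have "x 0 \<noteq> 0"
      proof
        assume "x 0 = 0"
        hence "x i = 0" for i using x by (cases "i = 0") (auto simp: vecs_def)
        hence "x = 0" by (intro ext) simp
        thus False using x by simp
      qed
      from "0.prems"(1)[OF this e] have "f x = x 0 ^ k * f \<epsilon>" by (simp only: eq[symmetric])
      thus ?thesis by (simp add: monom_fun_def)
    qed
    show ?case by (intro bexI[OF _ 1] ballI 2)
  next
    case (Suc m)
    note hom = Suc.prems(1) and line = Suc.prems(2)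
    define \<epsilon> :: "nat \<Rightarrow> complex" where "\<epsilon> = (\<lambda>i. if i = Suc m then 1 else 0)"
    have \<epsilon>: "\<epsilon> \<in> vecs (Suc m)" by (auto simp: \<epsilon>_def vecs_def)
    have vecs_Suc: "u \<in> vecs (Suc m)" if "u \<in> vecs m" for u using that by (auto simp: vecs_def)
    \<comment> \<open>Homogeneity gives \<open>f (u + t v) = t ^ k * f (v + u / t)\<close>, the
      situation of \<open>degree_le_of_reflect\<close>.\<close>
    have deg: "degree H \<le> k" if uvH: "u \<in> vecs (Suc m)" "v \<in> vecs (Suc m)" "indep2 u v"
        "\<And>t. f (\<lambda>i. u i + t * v i) = poly H t" for u v H
    proof -
      obtain H' where H': "\<And>t. f (\<lambda>i. v i + t * u i) = poly H' t"
        using line[OF uvH(2,1) indep2_commute[OF uvH(3)]] by blast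
      show ?thesis
      proof (rule degree_le_of_reflect[of _ k H'])
        fix t :: complex assume t: "t \<noteq> 0"
        have "(\<lambda>i. v i + inverse t * u i) \<in> vecs (Suc m) - {0}"
          using uvH(1,2) indep2_nonzero[OF indep2_commute[OF uvH(3)]] by (auto simp: vecs_def)
        from hom[OF t this] show "poly H t = t ^ k * poly H' (inverse t)"
          using t by (simp add: uvH(4)[symmetric] H'[symmetric] distrib_left mult.assoc[symmetric] add.commute)
      qed
    qed
    have ind_\<epsilon>: "indep2 (\<lambda>i. u i + z * \<epsilon> i) v" if "u \<in> vecs m" "v \<in> vecs m" "indep2 u v" for u v z
      unfolding indep2_def
    proof (intro allI impI)
      fix c c' assume eq: "(\<lambda>i. c * (u i + z * \<epsilon> i) + c' * v i) = 0"
      have "c * u i + c' * v i = 0" for i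
        using fun_cong[OF eq, of i] that(1,2) by (cases "i = Suc m") (auto simp: \<epsilon>_def vecs_def)
      hence "(\<lambda>i. c * u i + c' * v i) = 0" by (intro ext) simp
      thus "c = 0 \<and> c' = 0" using that(3) unfolding indep2_def by blast
    qed
    have ind_y: "indep2 y \<epsilon>" if y: "y \<in> vecs m - {0}" for y
      unfolding indep2_def
    proof (intro allI impI)
      fix c c' assume eq: "(\<lambda>i. c * y i + c' * \<epsilon> i) = 0"
      obtain i where i: "i \<le> m" "y i \<noteq> 0" using y by (rule vec_nonzeroE)
      hence "c * y i = 0" using fun_cong[OF eq, of i] by (simp add: \<epsilon>_def)
      hence "c = 0" using i by simp
      moreover have "c' = 0" using fun_cong[OF eq, of "Suc m"] y by (simp add: \<epsilon>_def vecs_def)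
      ultimately show "c = 0 \<and> c' = 0" ..
    qed
    have "\<forall>j. \<exists>a :: nat \<Rightarrow> complex. \<forall>H. degree H \<le> k \<longrightarrow> coeff H j = (\<Sum>l\<le>k. a l * poly H (of_nat l))"
      using coeff_by_values[of k] by metis
    then obtain a :: "nat \<Rightarrow> nat \<Rightarrow> complex"
      where a: "\<And>j H. degree H \<le> k \<Longrightarrow> coeff H j = (\<Sum>l\<le>k. a j l * poly H (of_nat l))"
      by metis
    \<comment> \<open>For nonzero \<open>y\<close> this is the coefficient of the
      \<open>j\<close>-th power of the last variable. Writing it through values of \<open>f\<close>
      shows that it is again polynomial along lines.\<close>
    define g where "g j y = (\<Sum>l\<le>k. a j l * f (\<lambda>i. y i + of_nat l * \<epsilon> i))" for j y
    have expansion: "\<exists>H. degree H \<le> k \<and> (\<forall>t. f (\<lambda>i. y i + t * \<epsilon> i) = poly H t) \<and> (\<forall>j. coeff H j = g j y)"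
      if y: "y \<in> vecs m - {0}" for y
    proof -
      obtain H where H: "\<And>t. f (\<lambda>i. y i + t * \<epsilon> i) = poly H t"
        using line[OF vecs_Suc \<epsilon> ind_y[OF y]] y by blast
      have "degree H \<le> k" using deg[OF vecs_Suc \<epsilon> ind_y[OF y] H] y by blast
      with H a show ?thesis by (intro exI[of _ H]) (auto simp: g_def)
    qed
    have "\<exists>p\<in>forms m (k - j). \<forall>y\<in>vecs m - {0}. g j y = p y" if j: "j \<le> k" for j
    proof (rule Suc.IH)
      fix c :: complex and y assume c: "c \<noteq> 0" and y: "y \<in> vecs m - {0}"
      obtain H where H: "\<And>t. f (\<lambda>i. y i + t * \<epsilon> i) = poly H t" "\<And>j. coeff H j = g j y"
        using expansion[OF y] by blast
      have cy: "(\<lambda>i. c * y i) \<in> vecs m - {0}"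
        using c y by (auto simp: vecs_def fun_eq_iff)
      obtain H' where H': "\<And>t. f (\<lambda>i. c * y i + t * \<epsilon> i) = poly H' t" "\<And>j. coeff H' j = g j (\<lambda>i. c * y i)"
        using expansion[OF cy] by blast
      \<comment> \<open>Pulling \<open>c\<close> out gives
        \<open>f (c y + t \<epsilon>) = c ^ k * f (y + (t / c) \<epsilon>)\<close>. Comparing
        coefficients of \<open>t ^ j\<close> shows that \<open>g j\<close> is homogeneous of degree
        \<open>k - j\<close>.\<close>
      have "H' = Polynomial.smult (c ^ k) (pcompose H [:0, 1 / c:])"
      proof (rule poly_eq_off_0)
        fix t :: complex
        have "(\<lambda>i. y i + (t / c) * \<epsilon> i) \<in> vecs (Suc m) - {0}"
          using y vecs_Suc[of y] \<epsilon> indep2_nonzero[OF ind_y[OF y], of "t / c"] by (auto simp: vecs_def)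
        from hom[OF c this] show "poly H' t = poly (Polynomial.smult (c ^ k) (pcompose H [:0, 1 / c:])) t"
          using c by (simp add: H'(1)[symmetric] H(1)[symmetric] poly_pcompose distrib_left mult.assoc[symmetric])
      qed
      hence "coeff H' j = c ^ k * ((1 / c) ^ j * coeff H j)"
        by (simp add: coeff_pcompose_linear)
      also have "c ^ k * ((1 / c) ^ j * coeff H j) = c ^ (k - j) * coeff H j"
        using c j by (simp add: power_diff power_divide)
      finally show "g j (\<lambda>i. c * y i) = c ^ (k - j) * g j y" using H(2) H'(2) by simp
    next
      fix u v assume uv: "u \<in> vecs m" "v \<in> vecs m" "indep2 u v"
      have "\<exists>H. \<forall>t. f (\<lambda>i. (u i + of_nat l * \<epsilon> i) + t * v i) = poly H t" for l
        using uv vecs_Suc[of u] vecs_Suc[of v] \<epsilon>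
        by (intro line ind_\<epsilon>) (auto simp: vecs_def)
      then obtain Hl where Hl: "\<And>l t. f (\<lambda>i. (u i + of_nat l * \<epsilon> i) + t * v i) = poly (Hl l) t" by metis
      have "g j (\<lambda>i. u i + t * v i) = poly (\<Sum>l\<le>k. Polynomial.smult (a j l) (Hl l)) t" for t
        by (simp add: g_def poly_sum Hl[symmetric] add_ac)
      thus "\<exists>H. \<forall>t. g j (\<lambda>i. u i + t * v i) = poly H t" by blast
    qed
    then obtain p where p: "\<And>j. j \<le> k \<Longrightarrow> p j \<in> forms m (k - j)"
        "\<And>j y. j \<le> k \<Longrightarrow> y \<in> vecs m - {0} \<Longrightarrow> g j y = p j y"
      by metis
    define q where "q x = (\<Sum>j\<le>k. x (Suc m) ^ j * p j x)" for x
    have q: "q \<in> forms (Suc m) k"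
      unfolding q_def using forms_times_var[OF p(1)] by (intro forms_sum) (metis atMost_iff le_add_diff_inverse2)
    have main: "f x = q x" if x: "x \<in> vecs (Suc m)" and ne: "x(Suc m := 0) \<noteq> 0" for x
    proof -
      let ?y = "x(Suc m := 0)"
      have y: "?y \<in> vecs m - {0}" using x ne by (auto simp: vecs_def)
      obtain H where H: "degree H \<le> k" "\<And>t. f (\<lambda>i. ?y i + t * \<epsilon> i) = poly H t" "\<And>j. coeff H j = g j ?y"
        using expansion[OF y] by blast
      have "x = (\<lambda>i. ?y i + x (Suc m) * \<epsilon> i)" by (auto simp: \<epsilon>_def)
      hence "f x = poly H (x (Suc m))" using H(2) by metis
      also have "\<dots> = (\<Sum>j\<le>k. coeff H j * x (Suc m) ^ j)"
        using H(1) by (subst poly_altdef) (intro sum.mono_neutral_left, auto simp: coeff_eq_0)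
      also have "\<dots> = q x" unfolding q_def
      proof (rule sum.cong[OF refl])
        fix j assume "j \<in> {..k}"
        hence "p j ?y = p j x" "g j ?y = p j ?y" using form_cong[OF p(1), of j ?y x] p(2)[of j ?y] y by auto
        thus "coeff H j * x (Suc m) ^ j = x (Suc m) ^ j * p j x" by (simp add: H(3))
      qed
      finally show ?thesis .
    qed
    have "f x = q x" if x: "x \<in> vecs (Suc m) - {0}" for x
    proof (cases "x(Suc m := 0) = 0")
      case True
      \<comment> \<open>On the last axis the expansion has no nonzero base point \<open>y\<close>. A
        line through \<open>x\<close> in the direction of the first variable leaves the axis at
        once, and two polynomials that agree off \<open>0\<close> agree at \<open>0\<close>.\<close>
      have x0: "x i = 0" if "i \<noteq> Suc m" for i using fun_cong[OF True, of i] that by simp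
      obtain i where "x i \<noteq> 0" using x by (rule vec_nonzeroE)
      hence xm: "x (Suc m) \<noteq> 0" using x0 by metis
      define v :: "nat \<Rightarrow> complex" where "v = (\<lambda>i. if i = 0 then 1 else 0)"
      have v: "v \<in> vecs (Suc m)" by (auto simp: v_def vecs_def)
      have "indep2 x v" unfolding indep2_def
      proof (intro allI impI)
        fix c c' assume eq: "(\<lambda>i. c * x i + c' * v i) = 0"
        from fun_cong[OF eq, of "Suc m"] fun_cong[OF eq, of 0] show "c = 0 \<and> c' = 0"
          using xm x0[of 0] by (simp add: v_def)
      qed
      then obtain H where H: "\<And>t. f (\<lambda>i. x i + t * v i) = poly H t" using line[OF _ v] x by blast
      obtain H' where H': "\<And>t. q (\<lambda>i. x i + t * v i) = poly H' t" using form_on_line[OF q, of x v] by blast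
      have "H = H'"
      proof (rule poly_eq_off_0)
        fix t :: complex assume t: "t \<noteq> 0"
        have "(\<lambda>i. x i + t * v i)(Suc m := 0) \<noteq> 0"
        proof
          assume "(\<lambda>i. x i + t * v i)(Suc m := 0) = 0"
          from fun_cong[OF this, of 0] show False using t x0[of 0] by (simp add: v_def)
        qed
        moreover have "(\<lambda>i. x i + t * v i) \<in> vecs (Suc m)" using x v by (auto simp: vecs_def)
        ultimately show "poly H t = poly H' t" using main by (simp add: H[symmetric] H'[symmetric])
      qed
      with H[of 0] H'[of 0] show ?thesis by simp
    qed (use main x in auto)
    with q show ?case by blast
  qed
  with that show ?thesis by blast
qed

section \<open>Sections of twists\<close>

abbreviation cone :: "point set \<Rightarrow> (nat \<Rightarrow> complex) set" where
  "cone U \<equiv> \<Union>U"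

lemma proj_pointE:
  assumes "P \<in> proj_space n"
  obtains x where "x \<in> vecs n - {0}" "P = {\<lambda>i. c * x i | c. c \<noteq> 0}"
proof -
  obtain x where x: "x \<in> vecs n - {0}" "P = proportional n `` {x}"
    using assms by (auto simp: proj_space_def elim!: quotientE)
  have "(\<lambda>i. c * x i) \<in> vecs n - {0}" if "c \<noteq> 0" for c
  proof -
    obtain i where "x i \<noteq> 0" using x(1) by (rule vec_nonzeroE)
    hence "(\<lambda>i. c * x i) i \<noteq> 0" using that by simp
    hence "(\<lambda>i. c * x i) \<noteq> 0" by (auto dest: fun_cong[of _ _ i])
    thus ?thesis using x(1) by (simp add: vecs_def)
  qed
  hence "(x, \<lambda>i. c * x i) \<in> proportional n" if "c \<noteq> 0" for c
    using x(1) that unfolding proportional_def by auto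
  moreover have "\<exists>c. c \<noteq> 0 \<and> z = (\<lambda>i. c * x i)" if "(x, z) \<in> proportional n" for z
    using that unfolding proportional_def by simp
  ultimately have "P = {\<lambda>i. c * x i | c. c \<noteq> 0}" unfolding x(2) by auto
  with x(1) show ?thesis by (rule that)
qed

lemma proj_point_scale:
  assumes "P \<in> proj_space n" "x \<in> P" "c \<noteq> 0" shows "(\<lambda>i. c * x i) \<in> P"
proof -
  obtain y where y: "P = {\<lambda>i. c * y i | c. c \<noteq> 0}" using assms(1) by (rule proj_pointE)
  then obtain c' where "x = (\<lambda>i. c' * y i)" "c' \<noteq> 0" using assms(2) by auto
  thus ?thesis unfolding y using assms(3) by (intro CollectI exI[of _ "c * c'"]) (simp add: mult.assoc)
qed

lemma proj_point_proportional:
  assumes "P \<in> proj_space n" "x \<in> P" "z \<in> P" obtains c where "c \<noteq> 0" "z = (\<lambda>i. c * x i)"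
proof -
  obtain y where y: "P = {\<lambda>i. c * y i | c. c \<noteq> 0}" using assms(1) by (rule proj_pointE)
  then obtain c' c'' where "x = (\<lambda>i. c' * y i)" "c' \<noteq> 0" "z = (\<lambda>i. c'' * y i)" "c'' \<noteq> 0"
    using assms(2,3) by auto
  thus ?thesis by (intro that[of "c'' / c'"]) auto
qed

lemma point_through:
  assumes "x \<in> vecs n - {0}" obtains P where "P \<in> proj_space n" "x \<in> P"
proof -
  have "(x, x) \<in> proportional n" using assms unfolding proportional_def by (auto intro!: exI[of _ 1])
  hence "x \<in> proportional n `` {x}" by blast
  moreover have "proportional n `` {x} \<in> proj_space n"
    unfolding proj_space_def using assms by (rule quotientI)
  ultimately show ?thesis using that by blast
qed

lemma cone_proj_space: "cone (proj_space n) = vecs n - {0}"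
proof
  show "cone (proj_space n) \<subseteq> vecs n - {0}"
    by (auto simp: proj_space_def proportional_def elim!: quotientE)
  show "vecs n - {0} \<subseteq> cone (proj_space n)" using point_through by (metis UnionI subsetI)
qed

lemma proj_point_nonempty: "P \<in> proj_space n \<Longrightarrow> P \<noteq> {}"
  by (elim proj_pointE) (auto intro: exI[of _ 1])

section \<open>Open sets of projective space\<close>

lemma proj_open_subset: "proj_open n U \<Longrightarrow> U \<subseteq> proj_space n"
  by (auto simp: proj_open_def)

lemma proj_openE:
  assumes "proj_open n U"
  obtains F where "F \<subseteq> (\<Union>k. forms n k)" "U = {P \<in> proj_space n. \<exists>f\<in>F. \<exists>x\<in>P. f x \<noteq> 0}"
  using assms by (auto simp: proj_open_def)

text \<open>A form changes by a nonzero factor between representatives of a point.\<close>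

lemma nonzero_on_point:
  assumes "f \<in> (\<Union>k. forms n k)" "P \<in> proj_space n" "x \<in> P" "f x \<noteq> 0" "y \<in> P"
  shows "f y \<noteq> 0"
proof -
  obtain c where "c \<noteq> 0" "y = (\<lambda>i. c * x i)" using proj_point_proportional[OF assms(2,3,5)] .
  with assms(1,4) show ?thesis by (auto simp: form_scale)
qed

lemma proj_open_space: "proj_open n (proj_space n)"
  unfolding proj_open_def using proj_point_nonempty forms_const[of 1 n]
  by (intro exI[of _ "{\<lambda>_. 1}"]) fastforce

lemma proj_open_Int:
  assumes "proj_open n U" "proj_open n V" shows "proj_open n (U \<inter> V)"
proof -
  obtain F F' where F: "F \<subseteq> (\<Union>k. forms n k)" "U = {P \<in> proj_space n. \<exists>f\<in>F. \<exists>x\<in>P. f x \<noteq> 0}"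
    and F': "F' \<subseteq> (\<Union>k. forms n k)" "V = {P \<in> proj_space n. \<exists>f\<in>F'. \<exists>x\<in>P. f x \<noteq> 0}"
    using assms by (auto elim!: proj_openE)
  let ?F = "{\<lambda>x. f x * g x | f g. f \<in> F \<and> g \<in> F'}"
  have "?F \<subseteq> (\<Union>k. forms n k)"
  proof clarify
    fix f g assume "f \<in> F" "g \<in> F'"
    then obtain k m where "f \<in> forms n k" "g \<in> forms n m" using F F' by blast
    hence "(\<lambda>x. f x * g x) \<in> forms n (k + m)" by (rule forms_mult)
    thus "(\<lambda>x. f x * g x) \<in> (\<Union>k. forms n k)" by (rule UN_I[OF UNIV_I])
  qed
  moreover have "U \<inter> V = {P \<in> proj_space n. \<exists>f\<in>?F. \<exists>x\<in>P. f x \<noteq> 0}"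
  proof (intro equalityI subsetI)
    fix P assume "P \<in> U \<inter> V"
    then obtain f g x y where *: "P \<in> proj_space n" "f \<in> F" "x \<in> P" "f x \<noteq> 0" "g \<in> F'" "y \<in> P" "g y \<noteq> 0"
      using F F' by auto
    hence "g x \<noteq> 0" using nonzero_on_point[of g n P y x] F'(1) by blast
    hence nz: "f x * g x \<noteq> 0" using * by simp
    have mem: "(\<lambda>x. f x * g x) \<in> ?F" using *(2,5) by (intro CollectI exI[of _ f] exI[of _ g] conjI refl)
    show "P \<in> {P \<in> proj_space n. \<exists>f\<in>?F. \<exists>x\<in>P. f x \<noteq> 0}"
      by (intro CollectI conjI *(1), rule bexI[OF _ mem], rule bexI[where x = x], rule nz, rule *(3))
  next
    fix P assume "P \<in> {P \<in> proj_space n. \<exists>f\<in>?F. \<exists>x\<in>P. f x \<noteq> 0}"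
    then obtain f g x where "P \<in> proj_space n" "f \<in> F" "g \<in> F'" "x \<in> P" "f x * g x \<noteq> 0" by auto
    thus "P \<in> U \<inter> V" using F F' by auto
  qed
  ultimately show ?thesis unfolding proj_open_def by blast
qed

section \<open>Operations on sections of twists\<close>

definition local_quotient :: "nat \<Rightarrow> nat \<Rightarrow> point set \<Rightarrow> ((nat \<Rightarrow> complex) \<Rightarrow> complex) \<Rightarrow> bool" where
  "local_quotient n k W f \<longleftrightarrow> (\<exists>m. \<exists>p\<in>forms n (m + k). \<exists>q\<in>forms n m. \<forall>x\<in>cone W. q x \<noteq> 0 \<and> f x = p x / q x)"

lemma local_quotientI:
  "p \<in> forms n (m + k) \<Longrightarrow> q \<in> forms n m \<Longrightarrow> (\<And>x. x \<in> cone W \<Longrightarrow> q x \<noteq> 0 \<and> f x = p x / q x) \<Longrightarrow> local_quotient n k W f"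
  unfolding local_quotient_def by blast

lemma local_quotientE:
  assumes "local_quotient n k W f"
  obtains m p q where "p \<in> forms n (m + k)" "q \<in> forms n m" "\<And>x. x \<in> cone W \<Longrightarrow> q x \<noteq> 0 \<and> f x = p x / q x"
  using assms unfolding local_quotient_def by blast

lemma twist_iff:
  "f \<in> twist n k U \<longleftrightarrow> (\<forall>x. x \<notin> cone U \<longrightarrow> f x = 0) \<and>
     (\<forall>P\<in>U. \<exists>W. proj_open n W \<and> P \<in> W \<and> W \<subseteq> U \<and> local_quotient n k W f)"
  unfolding twist_def local_quotient_def by (rule mem_Collect_eq)

lemma twistD:
  assumes "f \<in> twist n k U"
  shows "x \<notin> cone U \<Longrightarrow> f x = 0"
    and "P \<in> U \<Longrightarrow> \<exists>W. proj_open n W \<and> P \<in> W \<and> W \<subseteq> U \<and> local_quotient n k W f"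
  using assms unfolding twist_iff by blast+

lemma twistI:
  assumes "\<And>x. x \<notin> cone U \<Longrightarrow> f x = 0"
    and "\<And>P. P \<in> U \<Longrightarrow> \<exists>W. proj_open n W \<and> P \<in> W \<and> W \<subseteq> U \<and> local_quotient n k W f"
  shows "f \<in> twist n k U"
  unfolding twist_iff by (intro conjI allI impI ballI assms)

lemma local_quotient_mono: "local_quotient n k W f \<Longrightarrow> W' \<subseteq> W \<Longrightarrow> local_quotient n k W' f"
  unfolding local_quotient_def by blast

text \<open>Local representations of two sections are compared on the intersection of their
  neighbourhoods, so an operation has to be checked on one open set only.\<close>

lemma twist_binary:
  assumes f: "f \<in> twist n k U" and g: "g \<in> twist n l U"
    and out: "\<And>x. x \<notin> cone U \<Longrightarrow> h x = 0"
    and loc: "\<And>W. local_quotient n k W f \<Longrightarrow> local_quotient n l W g \<Longrightarrow> local_quotient n r W h"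
  shows "h \<in> twist n r U"
proof (rule twistI[OF out])
  fix P assume "P \<in> U"
  then obtain W W' where W: "proj_open n W" "P \<in> W" "W \<subseteq> U" "local_quotient n k W f"
      "proj_open n W'" "P \<in> W'" "W' \<subseteq> U" "local_quotient n l W' g"
    using twistD(2)[OF f] twistD(2)[OF g] by blast
  have "local_quotient n r (W \<inter> W') h"
    by (intro loc local_quotient_mono[OF W(4)] local_quotient_mono[OF W(8)]) auto
  thus "\<exists>W. proj_open n W \<and> P \<in> W \<and> W \<subseteq> U \<and> local_quotient n r W h"
    using W proj_open_Int[OF W(1,5)] by (intro exI[of _ "W \<inter> W'"]) auto
qed

lemma twist_add:
  assumes "f \<in> twist n k U" "g \<in> twist n k U"
  shows "(\<lambda>x. f x + g x) \<in> twist n k U"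
proof (rule twist_binary[OF assms])
  fix W assume "local_quotient n k W f" "local_quotient n k W g"
  then obtain m p q m' p' q' where pq: "p \<in> forms n (m + k)" "q \<in> forms n m" "\<And>x. x \<in> cone W \<Longrightarrow> q x \<noteq> 0 \<and> f x = p x / q x"
      "p' \<in> forms n (m' + k)" "q' \<in> forms n m'" "\<And>x. x \<in> cone W \<Longrightarrow> q' x \<noteq> 0 \<and> g x = p' x / q' x"
    by (elim local_quotientE) blast
  have "(\<lambda>x. q' x * p x) \<in> forms n (m' + m + k)" "(\<lambda>x. q x * p' x) \<in> forms n (m' + m + k)"
    using forms_mult[OF pq(5,1)] forms_mult[OF pq(2,4)] by (simp_all add: add_ac)
  from forms_add[OF this] forms_mult[OF pq(5,2)]
  show "local_quotient n k W (\<lambda>x. f x + g x)"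
    by (rule local_quotientI) (use pq(3,6) in \<open>auto simp: field_simps\<close>)
qed (simp add: twistD(1)[OF assms(1)] twistD(1)[OF assms(2)])

lemma twist_mult:
  assumes "f \<in> twist n k U" "g \<in> twist n l U"
  shows "(\<lambda>x. f x * g x) \<in> twist n (k + l) U"
proof (rule twist_binary[OF assms])
  fix W assume "local_quotient n k W f" "local_quotient n l W g"
  then obtain m p q m' p' q' where pq: "p \<in> forms n (m + k)" "q \<in> forms n m" "\<And>x. x \<in> cone W \<Longrightarrow> q x \<noteq> 0 \<and> f x = p x / q x"
      "p' \<in> forms n (m' + l)" "q' \<in> forms n m'" "\<And>x. x \<in> cone W \<Longrightarrow> q' x \<noteq> 0 \<and> g x = p' x / q' x"
    by (elim local_quotientE) blast
  have "(\<lambda>x. p x * p' x) \<in> forms n (m + m' + (k + l))"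
    using forms_mult[OF pq(1,4)] by (simp add: add_ac)
  from this forms_mult[OF pq(2,5)] show "local_quotient n (k + l) W (\<lambda>x. f x * g x)"
    by (rule local_quotientI) (use pq(3,6) in auto)
qed (simp add: twistD(1)[OF assms(1)] twistD(1)[OF assms(2)])

lemma twist_form:
  assumes "proj_open n U" "p \<in> forms n k"
  shows "(\<lambda>x. if x \<in> cone U then p x else 0) \<in> twist n k U"
proof (rule twistI)
  fix P assume "P \<in> U"
  have "local_quotient n k U (\<lambda>x. if x \<in> cone U then p x else 0)"
    using assms(2) by (intro local_quotientI[of p n 0 k "\<lambda>_. 1"] forms_const) auto
  thus "\<exists>W. proj_open n W \<and> P \<in> W \<and> W \<subseteq> U \<and> local_quotient n k W (\<lambda>x. if x \<in> cone U then p x else 0)"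
    using assms(1) \<open>P \<in> U\<close> by blast
qed simp

lemma twist_form_mult:
  assumes "proj_open n U" "p \<in> forms n k" "f \<in> twist n l U"
  shows "(\<lambda>x. p x * f x) \<in> twist n (k + l) U"
proof -
  have "(\<lambda>x. (if x \<in> cone U then p x else 0) * f x) = (\<lambda>x. p x * f x)"
    using twistD(1)[OF assms(3)] by auto
  with twist_mult[OF twist_form[OF assms(1,2)] assms(3)] show ?thesis by simp
qed

lemma twist_zero: "proj_open n U \<Longrightarrow> (\<lambda>_. 0) \<in> twist n k U"
  using twist_form[OF _ forms_zero] by (simp cong: if_cong)

lemma twist_sum:
  assumes "proj_open n U" "\<And>i. i \<in> A \<Longrightarrow> f i \<in> twist n k U"
  shows "(\<lambda>x. \<Sum>i\<in>A. f i x) \<in> twist n k U"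
  using assms(2)
  by (induction A rule: infinite_finite_induct) (auto simp: twist_zero[OF assms(1)] twist_add)

lemma twist_restrict:
  assumes "f \<in> twist n k U" "proj_open n U'" "U' \<subseteq> U"
  shows "(\<lambda>x. if x \<in> cone U' then f x else 0) \<in> twist n k U'"
proof (rule twistI)
  fix P assume P: "P \<in> U'"
  then obtain W where W: "proj_open n W" "P \<in> W" "W \<subseteq> U" "local_quotient n k W f"
    using twistD(2)[OF assms(1)] assms(3) by blast
  obtain m p q where pq: "p \<in> forms n (m + k)" "q \<in> forms n m" "\<And>x. x \<in> cone W \<Longrightarrow> q x \<noteq> 0 \<and> f x = p x / q x"
    using W(4) by (rule local_quotientE) blast
  have "local_quotient n k (W \<inter> U') (\<lambda>x. if x \<in> cone U' then f x else 0)"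
    by (rule local_quotientI[OF pq(1,2)]) (use pq(3) in auto)
  thus "\<exists>W. proj_open n W \<and> P \<in> W \<and> W \<subseteq> U' \<and> local_quotient n k W (\<lambda>x. if x \<in> cone U' then f x else 0)"
    using W P proj_open_Int[OF W(1) assms(2)] by (intro exI[of _ "W \<inter> U'"]) auto
qed simp

text \<open>A local quotient is homogeneous of degree \<open>k\<close>. Along a line that misses the
  origin it becomes a quotient of polynomials in one variable, and these glue to a polynomial.
  \<open>form_of_homogeneous_on_lines\<close> then yields the form; this identifies the global
  sections of \<open>O(k)\<close>.\<close>

lemma twist_global_section:
  assumes f: "f \<in> twist n k (proj_space n)"
  obtains p where "p \<in> forms n k" "f = (\<lambda>x. if x \<in> vecs n - {0} then p x else 0)"
proof -
  have loc: "\<exists>W. proj_open n W \<and> x \<in> cone W \<and> local_quotient n k W f" if x: "x \<in> vecs n - {0}" for x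
  proof -
    obtain P where "P \<in> proj_space n" "x \<in> P" using x by (rule point_through)
    with twistD(2)[OF f this(1)] show ?thesis by blast
  qed
  have hom: "f (\<lambda>i. c * x i) = c ^ k * f x" if c: "c \<noteq> 0" and x: "x \<in> vecs n - {0}" for c x
  proof -
    obtain W where W: "proj_open n W" "x \<in> cone W" "local_quotient n k W f" using loc[OF x] by blast
    obtain m p q where pq: "p \<in> forms n (m + k)" "q \<in> forms n m" "\<And>x. x \<in> cone W \<Longrightarrow> q x \<noteq> 0 \<and> f x = p x / q x"
      using W(3) by (rule local_quotientE) blast
    have "(\<lambda>i. c * x i) \<in> cone W"
      using W(2) proj_open_subset[OF W(1)] proj_point_scale[OF _ _ c] by blast
    thus ?thesis using pq(3) W(2) c by (simp add: form_scale[OF pq(1)] form_scale[OF pq(2)] power_add)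
  qed
  have line: "\<exists>H. \<forall>t. f (\<lambda>i. u i + t * v i) = poly H t" if uv: "u \<in> vecs n" "v \<in> vecs n" "indep2 u v" for u v
  proof -
    define l where "l t = (\<lambda>i. u i + t * v i)" for t
    have l: "l t \<in> vecs n - {0}" for t
      using uv indep2_nonzero[OF uv(3), of t] by (simp add: l_def vecs_def)
    have "\<exists>g q r. poly g t0 \<noteq> 0 \<and> poly q t0 \<noteq> 0 \<and> (\<forall>t. poly g t \<noteq> 0 \<longrightarrow> poly q t * f (l t) = poly r t)" for t0
    proof -
      obtain W where W: "proj_open n W" "l t0 \<in> cone W" "local_quotient n k W f" using loc[OF l] by blast
      obtain m p q where pq: "p \<in> forms n (m + k)" "q \<in> forms n m" "\<And>x. x \<in> cone W \<Longrightarrow> q x \<noteq> 0 \<and> f x = p x / q x"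
        using W(3) by (rule local_quotientE) blast
      obtain F where F: "F \<subseteq> (\<Union>k. forms n k)" "W = {P \<in> proj_space n. \<exists>f\<in>F. \<exists>x\<in>P. f x \<noteq> 0}"
        using W(1) by (rule proj_openE)
      \<comment> \<open>One form \<open>g\<close> cuts out a neighbourhood inside \<open>W\<close>;
        restricted to the line it is the polynomial that marks where the local quotient is
        valid.\<close>
      obtain P g y where P: "P \<in> proj_space n" "l t0 \<in> P" "g \<in> F" "y \<in> P" "g y \<noteq> 0" using W(2) F(2) by blast
      obtain k' where g: "g \<in> forms n k'" using P(3) F(1) by blast
      have gt0: "g (l t0) \<noteq> 0" using nonzero_on_point[of g n P y "l t0"] P F(1) by blast
      obtain g' where g': "\<And>t. g (l t) = poly g' t" using form_on_line[OF g, of u v] unfolding l_def by blast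
      obtain p' where p': "\<And>t. p (l t) = poly p' t" using form_on_line[OF pq(1), of u v] unfolding l_def by blast
      obtain q' where q': "\<And>t. q (l t) = poly q' t" using form_on_line[OF pq(2), of u v] unfolding l_def by blast
      have "poly q' t * f (l t) = poly p' t" if "poly g' t \<noteq> 0" for t
      proof -
        obtain P' where P': "P' \<in> proj_space n" "l t \<in> P'" using l by (rule point_through)
        have "g (l t) \<noteq> 0" using that g' by simp
        hence "P' \<in> W" using F(2) P(3) P' by blast
        hence "l t \<in> cone W" using P'(2) by blast
        from pq(3)[OF this] show ?thesis by (simp add: p' q')
      qed
      moreover have "poly g' t0 \<noteq> 0" "poly q' t0 \<noteq> 0" using gt0 pq(3)[OF W(2)] by (simp_all add: g' q')
      ultimately show ?thesis by blast
    qed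
    then obtain H where "\<And>t. f (l t) = poly H t" by (rule poly_of_local_quotients[of "\<lambda>t. f (l t)"]) blast
    thus ?thesis unfolding l_def by blast
  qed
  obtain p where p: "p \<in> forms n k" "\<And>x. x \<in> vecs n - {0} \<Longrightarrow> f x = p x"
    using form_of_homogeneous_on_lines[of n f k] hom line by blast
  have "f x = (if x \<in> vecs n - {0} then p x else 0)" for x
    using p(2)[of x] twistD(1)[OF f, of x] unfolding cone_proj_space by simp
  with that[OF p(1)] show ?thesis by blast
qed

section \<open>Determinants and integer matrices\<close>

text \<open>Carries determinants over to matrices indexed by any finite set. Rows and columns use
  the same enumeration, so the choice does not affect the determinant.\<close>

definition enum :: "'s set \<Rightarrow> nat \<Rightarrow> 's" where
  "enum S = (SOME h. bij_betw h {..<card S} S)"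

lemma bij_enum: "finite S \<Longrightarrow> bij_betw (enum S) {..<card S} S"
  unfolding enum_def atLeast0LessThan[symmetric] by (rule someI_ex[OF ex_bij_betw_nat_finite])

definition set_mat :: "'s set \<Rightarrow> ('s \<Rightarrow> 's \<Rightarrow> 'r) \<Rightarrow> 'r mat" where
  "set_mat S B = mat (card S) (card S) (\<lambda>(i, j). B (enum S i) (enum S j))"

lemma set_mat_carrier [simp]: "set_mat S B \<in> carrier_mat (card S) (card S)"
  by (simp add: set_mat_def)

lemma sum_enum: "finite S \<Longrightarrow> (\<Sum>x\<in>S. f x) = (\<Sum>i<card S. f (enum S i))"
  by (rule sum.reindex_bij_betw[symmetric, OF bij_enum])

lemma set_mat_mult_vec:
  assumes "finite S" "i < card S" "v \<in> carrier_vec (card S)" "\<And>j. j < card S \<Longrightarrow> v $ j = k (enum S j)"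
  shows "(set_mat S B *\<^sub>v v) $ i = (\<Sum>y\<in>S. B (enum S i) y * (k y :: 'r :: comm_semiring_0))"
  using assms
  by (auto simp: set_mat_def scalar_prod_def sum_enum[OF assms(1)] atLeast0LessThan row_def intro!: sum.cong)

lemma enum_inverse:
  assumes "finite S" "y \<in> S" obtains j where "j < card S" "y = enum S j"
  using bij_enum[OF assms(1)] assms(2) unfolding bij_betw_def by auto

lemma enum_in: "finite S \<Longrightarrow> i < card S \<Longrightarrow> enum S i \<in> S"
  using bij_enum[of S] unfolding bij_betw_def by auto

lemma vec_of_fun:
  assumes "finite S"
  obtains v where "v \<in> carrier_vec (card S)" "\<And>j. j < card S \<Longrightarrow> v $ j = k (enum S j)"
  by (rule that[of "vec (card S) (\<lambda>j. k (enum S j))"]) auto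

lemma fun_of_vec:
  assumes "finite S"
  obtains k where "\<And>j. j < card S \<Longrightarrow> v $ j = k (enum S j)"
proof (rule that)
  fix j assume "j < card S"
  thus "v $ j = v $ (inv_into {..<card S} (enum S) (enum S j))"
    using bij_enum[OF assms] by (simp add: bij_betw_def inv_into_f_f)
qed

text \<open>The generality of an integral domain provides, over the integers, an integral kernel
  vector, to which positivity of squares applies.\<close>

lemma set_det_eq_0_iff:
  fixes B :: "'s \<Rightarrow> 's \<Rightarrow> 'r :: idom"
  assumes S: "finite S"
  shows "det (set_mat S B) = 0 \<longleftrightarrow> (\<exists>k. (\<exists>y\<in>S. k y \<noteq> 0) \<and> (\<forall>x\<in>S. (\<Sum>y\<in>S. B x y * k y) = 0))"
proof
  assume "det (set_mat S B) = 0"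
  then obtain v where v: "v \<in> carrier_vec (card S)" "v \<noteq> 0\<^sub>v (card S)" "set_mat S B *\<^sub>v v = 0\<^sub>v (card S)"
    using det_0_iff_vec_prod_zero[OF set_mat_carrier] by blast
  obtain k where k: "\<And>j. j < card S \<Longrightarrow> v $ j = k (enum S j)" using fun_of_vec[OF S] by blast
  have "\<exists>j<card S. v $ j \<noteq> 0" using v(1,2) by (auto simp: vec_eq_iff)
  hence "\<exists>y\<in>S. k y \<noteq> 0" using k enum_in[OF S] by auto
  moreover have "(\<Sum>y\<in>S. B x y * k y) = 0" if x: "x \<in> S" for x
  proof -
    obtain i where "i < card S" "x = enum S i" using S x by (rule enum_inverse)
    with set_mat_mult_vec[OF S _ v(1) k, of i B] v(3) show ?thesis by simp
  qed
  ultimately show "\<exists>k. (\<exists>y\<in>S. k y \<noteq> 0) \<and> (\<forall>x\<in>S. (\<Sum>y\<in>S. B x y * k y) = 0)" by blast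
next
  assume "\<exists>k. (\<exists>y\<in>S. k y \<noteq> 0) \<and> (\<forall>x\<in>S. (\<Sum>y\<in>S. B x y * k y) = 0)"
  then obtain k y where k: "y \<in> S" "k y \<noteq> 0" "\<And>x. x \<in> S \<Longrightarrow> (\<Sum>y\<in>S. B x y * k y) = 0" by blast
  obtain v where v: "v \<in> carrier_vec (card S)" "\<And>j. j < card S \<Longrightarrow> v $ j = k (enum S j)"
    using vec_of_fun[OF S] by blast
  obtain j where j: "j < card S" "y = enum S j" using S k(1) by (rule enum_inverse)
  have "v \<noteq> 0\<^sub>v (card S)" using k(2) v(2)[OF j(1)] j by auto
  moreover have "set_mat S B *\<^sub>v v = 0\<^sub>v (card S)"
  proof (rule eq_vecI)
    fix i assume "i < dim_vec (0\<^sub>v (card S) :: 'r Matrix.vec)"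
    hence "i < card S" by simp
    thus "(set_mat S B *\<^sub>v v) $ i = 0\<^sub>v (card S) $ i"
      using set_mat_mult_vec[OF S _ v, of i B] k(3)[OF enum_in[OF S]] by simp
  qed (simp add: set_mat_def)
  ultimately show "det (set_mat S B) = 0" using det_0_iff_vec_prod_zero[OF set_mat_carrier] v(1) by blast
qed

lemma set_det_kernel:
  fixes B :: "'s \<Rightarrow> 's \<Rightarrow> 'r :: idom"
  assumes "finite S" "det (set_mat S B) \<noteq> 0" "\<And>x. x \<in> S \<Longrightarrow> (\<Sum>y\<in>S. B x y * k y) = 0" "y \<in> S"
  shows "k y = 0"
  using assms(2-4) unfolding set_det_eq_0_iff[OF assms(1)] by blast

lemma set_det_solve:
  fixes B :: "'s \<Rightarrow> 's \<Rightarrow> 'r :: field"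
  assumes S: "finite S" and det: "det (set_mat S B) \<noteq> 0"
  obtains k where "\<And>x. x \<in> S \<Longrightarrow> (\<Sum>y\<in>S. B x y * k y) = \<tau> x"
proof -
  let ?A = "set_mat S B"
  from det_non_zero_imp_unit[OF set_mat_carrier det, of "()"]
  obtain C where C: "C \<in> carrier_mat (card S) (card S)" "?A * C = 1\<^sub>m (card S)"
    unfolding Units_def ring_mat_def by auto
  obtain u where u: "u \<in> carrier_vec (card S)" "\<And>j. j < card S \<Longrightarrow> u $ j = \<tau> (enum S j)"
    using vec_of_fun[OF S] by blast
  have Cu: "C *\<^sub>v u \<in> carrier_vec (card S)" using C u by auto
  have eq: "?A *\<^sub>v (C *\<^sub>v u) = u"
    using C u assoc_mult_mat_vec[OF set_mat_carrier C(1) u(1), of B] by simp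
  obtain k where k: "\<And>j. j < card S \<Longrightarrow> (C *\<^sub>v u) $ j = k (enum S j)" using fun_of_vec[OF S] by blast
  have "(\<Sum>y\<in>S. B x y * k y) = \<tau> x" if x: "x \<in> S" for x
  proof -
    obtain i where "i < card S" "x = enum S i" using S x by (rule enum_inverse)
    with set_mat_mult_vec[OF S _ Cu k, of i B] eq u(2) show ?thesis by simp
  qed
  thus ?thesis by (rule that)
qed

lemma set_det_of_int:
  "det (set_mat S (\<lambda>x y. of_int (B x y))) = (of_int (det (set_mat S B)) :: 'r :: comm_ring_1)"
proof -
  have "set_mat S (\<lambda>x y. of_int (B x y)) = map_mat (of_int :: int \<Rightarrow> 'r) (set_mat S B)"
    by (rule eq_matI) (auto simp: set_mat_def)
  thus ?thesis by (simp only: of_int_hom.hom_det)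
qed

section \<open>Determinants as polynomial functions\<close>

lemma polynomial_functions_sum:
  "(\<And>i. i \<in> A \<Longrightarrow> f i \<in> polynomial_functions sc H) \<Longrightarrow> (\<lambda>v. \<Sum>i\<in>A. f i v) \<in> polynomial_functions sc H"
  by (induction A rule: infinite_finite_induct)
     (auto intro: polynomial_functions.const polynomial_functions.add)

lemma polynomial_functions_prod:
  "(\<And>i. i \<in> A \<Longrightarrow> f i \<in> polynomial_functions sc H) \<Longrightarrow> (\<lambda>v. \<Prod>i\<in>A. f i v) \<in> polynomial_functions sc H"
  by (induction A rule: infinite_finite_induct)
     (auto intro: polynomial_functions.const polynomial_functions.mult)

lemma polynomial_functions_det:
  assumes S: "finite S" and B: "\<And>x y. x \<in> S \<Longrightarrow> y \<in> S \<Longrightarrow> (\<lambda>v. B v x y) \<in> polynomial_functions sc H"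
  shows "(\<lambda>v. det (set_mat S (B v))) \<in> polynomial_functions sc H"
proof -
  let ?n = "card S"
  have "det (set_mat S (B v)) = (\<Sum>\<pi>\<in>{\<pi>. \<pi> permutes {0..<?n}}. signof \<pi> * (\<Prod>i=0..<?n. B v (enum S i) (enum S (\<pi> i))))" for v
    unfolding det_def'[OF set_mat_carrier]
    by (intro sum.cong refl arg_cong2[of _ _ _ _ "(*)"] prod.cong) (auto simp: set_mat_def dest: permutes_in_image)
  moreover have "(\<lambda>v. \<Sum>\<pi>\<in>{\<pi>. \<pi> permutes {0..<?n}}. signof \<pi> * (\<Prod>i=0..<?n. B v (enum S i) (enum S (\<pi> i)))) \<in> polynomial_functions sc H"
  proof (intro polynomial_functions_sum polynomial_functions.mult[OF polynomial_functions.const] polynomial_functions_prod)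
    fix \<pi> i assume "\<pi> \<in> {\<pi>. \<pi> permutes {0..<?n}}" "i \<in> {0..<?n}"
    hence "i < ?n" "\<pi> i < ?n" using permutes_in_image[of \<pi> "{0..<?n}" i] by auto
    thus "(\<lambda>v. B v (enum S i) (enum S (\<pi> i))) \<in> polynomial_functions sc H"
      by (intro B enum_in S)
  qed
  ultimately show ?thesis by simp
qed

text \<open>Infinite descent: an integral kernel vector is divisible by all powers of \<open>p\<close>.\<close>

lemma kernel_zero_of_mod:
  fixes A :: "'x \<Rightarrow> 'q \<Rightarrow> int"
  assumes p: "prime p" and A: "\<And>k. (\<forall>q\<in>R. int p dvd (\<Sum>x\<in>K. A x q * k x)) \<Longrightarrow> (\<forall>x\<in>K. int p dvd k x)"
    and k: "\<And>q. q \<in> R \<Longrightarrow> (\<Sum>x\<in>K. A x q * k x) = 0" and x: "x \<in> K"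
  shows "k x = 0"
proof (rule ccontr)
  have "int p ^ m dvd k x" if "x \<in> K" "\<And>q. q \<in> R \<Longrightarrow> (\<Sum>x\<in>K. A x q * k x) = 0" for m k x
    using that
  proof (induction m arbitrary: k)
    case (Suc m)
    have dvd: "int p dvd k y" if "y \<in> K" for y using A[of k] Suc.prems(2) that by simp
    have p0: "int p \<noteq> 0" using p by (auto simp: prime_gt_0_nat)
    have "(\<Sum>y\<in>K. A y q * (k y div int p)) = 0" if "q \<in> R" for q
    proof -
      have "int p * (\<Sum>y\<in>K. A y q * (k y div int p)) = (\<Sum>y\<in>K. A y q * k y)"
        unfolding sum_distrib_left by (intro sum.cong refl) (simp add: mult.left_commute dvd)
      thus ?thesis using Suc.prems(2)[OF that] p0 by simp
    qed
    from Suc.IH[OF Suc.prems(1) this] have "int p ^ m dvd k x div int p" .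
    hence "int p ^ m * int p dvd k x div int p * int p" by (rule mult_dvd_mono) simp
    thus ?case using dvd[OF Suc.prems(1)] by (simp add: mult.commute)
  qed simp
  hence dvd: "int p ^ m dvd k x" for m using x k by blast
  assume nz: "k x \<noteq> 0"
  have "int p > 1" using prime_gt_1_nat[OF p] by simp
  have "int (nat \<bar>k x\<bar>) < 2 ^ nat \<bar>k x\<bar>" by (metis of_nat_less_two_power)
  also have "(2 :: int) ^ nat \<bar>k x\<bar> \<le> int p ^ nat \<bar>k x\<bar>" using \<open>int p > 1\<close> by (intro power_mono) auto
  also have "\<dots> \<le> \<bar>k x\<bar>" using dvd_imp_le_int[OF nz dvd[of "nat \<bar>k x\<bar>"]] by simp
  finally show False by simp
qed

text \<open>Pairing the Gram matrix with a kernel vector \<open>k\<close> on both sides gives the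
  sum of the squares of the values of \<open>A\<close> at \<open>k\<close>, so all these values
  vanish. The order of the integers is essential here.\<close>

lemma gram_det_nonzero:
  fixes A :: "'x \<Rightarrow> 'q \<Rightarrow> int"
  assumes fin: "finite K" "finite R"
    and A: "\<And>k. (\<And>q. q \<in> R \<Longrightarrow> (\<Sum>x\<in>K. A x q * k x) = 0) \<Longrightarrow> \<forall>x\<in>K. k x = 0"
  shows "det (set_mat K (\<lambda>x y. \<Sum>q\<in>R. A x q * A y q)) \<noteq> 0"
proof
  assume "det (set_mat K (\<lambda>x y. \<Sum>q\<in>R. A x q * A y q)) = 0"
  then obtain k where k: "\<exists>y\<in>K. k y \<noteq> 0" "\<And>x. x \<in> K \<Longrightarrow> (\<Sum>y\<in>K. (\<Sum>q\<in>R. A x q * A y q) * k y) = 0"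
    unfolding set_det_eq_0_iff[OF fin(1)] by blast
  have "(\<Sum>q\<in>R. (\<Sum>x\<in>K. A x q * k x) * (\<Sum>x\<in>K. A x q * k x))
      = (\<Sum>q\<in>R. \<Sum>x\<in>K. \<Sum>y\<in>K. k x * (A x q * A y q * k y))"
    by (simp add: sum_product mult_ac)
  also have "\<dots> = (\<Sum>x\<in>K. \<Sum>y\<in>K. \<Sum>q\<in>R. k x * (A x q * A y q * k y))"
    by (subst sum.swap, intro sum.cong refl sum.swap)
  also have "\<dots> = (\<Sum>x\<in>K. k x * (\<Sum>y\<in>K. (\<Sum>q\<in>R. A x q * A y q) * k y))"
    by (simp add: sum_distrib_left sum_distrib_right)
  also have "\<dots> = 0" using k(2) by simp
  finally have "\<forall>q\<in>R. (\<Sum>x\<in>K. A x q * k x) * (\<Sum>x\<in>K. A x q * k x) = 0"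
    by (subst (asm) sum_nonneg_eq_0_iff[OF fin(2)]) auto
  hence "\<forall>x\<in>K. k x = 0" by (intro A) simp
  with k(1) show False by blast
qed

section \<open>General morphisms\<close>

definition sec :: "nat \<Rightarrow> nat \<Rightarrow> (nat \<Rightarrow> nat) \<Rightarrow> (nat \<Rightarrow> nat) \<Rightarrow>
    (coord \<Rightarrow> complex) \<Rightarrow> section_fun" where
  "sec n a d s k = (\<lambda>\<iota> x. if \<iota> \<in> blocks a s \<and> x \<in> vecs n - {0}
     then \<Sum>\<alpha>\<in>exponents n (d (fst \<iota>)). k (\<iota>, \<alpha>) * monom_fun n \<alpha> x else 0)"

text \<open>Determined only on \<open>coords\<close>: \<open>sec\<close> ignores \<open>k\<close>
  elsewhere. Hence values are compared at members of \<open>coords\<close>.\<close>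

definition coef :: "nat \<Rightarrow> nat \<Rightarrow> (nat \<Rightarrow> nat) \<Rightarrow> (nat \<Rightarrow> nat) \<Rightarrow> section_fun \<Rightarrow>
    coord \<Rightarrow> complex" where
  "coef n a d s \<sigma> = (SOME k. \<sigma> = sec n a d s k)"

lemma sum_of_twists_iff:
  "\<sigma> \<in> sum_of_twists n a d s U \<longleftrightarrow>
     (\<forall>\<iota>. if \<iota> \<in> blocks a s then \<sigma> \<iota> \<in> twist n (d (fst \<iota>)) U else \<sigma> \<iota> = 0)"
  by (simp add: sum_of_twists_def blocks_def split_paired_all)

lemma sum_of_twistsI:
  assumes "\<And>\<iota>. \<iota> \<in> blocks a s \<Longrightarrow> \<sigma> \<iota> \<in> twist n (d (fst \<iota>)) U" "\<And>\<iota>. \<iota> \<notin> blocks a s \<Longrightarrow> \<sigma> \<iota> = 0"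
  shows "\<sigma> \<in> sum_of_twists n a d s U"
  unfolding sum_of_twists_iff
proof
  fix \<iota>
  show "if \<iota> \<in> blocks a s then \<sigma> \<iota> \<in> twist n (d (fst \<iota>)) U else \<sigma> \<iota> = 0"
    by (cases "\<iota> \<in> blocks a s") (simp_all add: assms)
qed

lemma sum_of_twistsD:
  assumes "\<sigma> \<in> sum_of_twists n a d s U"
  shows "\<iota> \<in> blocks a s \<Longrightarrow> \<sigma> \<iota> \<in> twist n (d (fst \<iota>)) U" "\<iota> \<notin> blocks a s \<Longrightarrow> \<sigma> \<iota> = 0"
  using assms[unfolded sum_of_twists_iff, rule_format, of \<iota>] by simp_all

lemma sec_global: "sec n a d s k \<in> global_sections n (sum_of_twists n a d s)"
  unfolding global_sections_def
proof (rule sum_of_twistsI)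
  fix \<iota> assume \<iota>: "\<iota> \<in> blocks a s"
  have "sec n a d s k \<iota> = (\<lambda>x. if x \<in> cone (proj_space n) then \<Sum>\<alpha>\<in>exponents n (d (fst \<iota>)). k (\<iota>, \<alpha>) * monom_fun n \<alpha> x else 0)"
    unfolding cone_proj_space sec_def using \<iota> by (intro ext) simp
  also have "\<dots> \<in> twist n (d (fst \<iota>)) (proj_space n)"
    by (rule twist_form[OF proj_open_space formI])
  finally show "sec n a d s k \<iota> \<in> twist n (d (fst \<iota>)) (proj_space n)" .
qed (simp add: sec_def fun_eq_iff)

lemma global_section_sec:
  assumes "\<sigma> \<in> global_sections n (sum_of_twists n a d s)"
  shows "\<sigma> = sec n a d s (coef n a d s \<sigma>)"
proof -
  have \<sigma>: "\<sigma> \<in> sum_of_twists n a d s (proj_space n)" using assms by (simp only: global_sections_def)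
  have "\<exists>c. \<sigma> \<iota> = (\<lambda>x. if x \<in> vecs n - {0} then \<Sum>\<alpha>\<in>exponents n (d (fst \<iota>)). c \<alpha> * monom_fun n \<alpha> x else 0)"
    if \<iota>: "\<iota> \<in> blocks a s" for \<iota>
  proof -
    obtain p where p: "p \<in> forms n (d (fst \<iota>))" "\<sigma> \<iota> = (\<lambda>x. if x \<in> vecs n - {0} then p x else 0)"
      using twist_global_section[OF sum_of_twistsD(1)[OF \<sigma> \<iota>]] by blast
    obtain c where "p = (\<lambda>x. \<Sum>\<alpha>\<in>exponents n (d (fst \<iota>)). c \<alpha> * monom_fun n \<alpha> x)" using p(1) by (rule formE)
    with p(2) show ?thesis by (intro exI[of _ c]) (simp only:)
  qed
  hence "\<forall>\<iota>\<in>blocks a s. \<exists>c. \<sigma> \<iota> = (\<lambda>x. if x \<in> vecs n - {0} then \<Sum>\<alpha>\<in>exponents n (d (fst \<iota>)). c \<alpha> * monom_fun n \<alpha> x else 0)" by blast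
  from bchoice[OF this] obtain c where c: "\<forall>\<iota>\<in>blocks a s. \<sigma> \<iota> =
     (\<lambda>x. if x \<in> vecs n - {0} then \<Sum>\<alpha>\<in>exponents n (d (fst \<iota>)). c \<iota> \<alpha> * monom_fun n \<alpha> x else 0)" ..
  have "\<sigma> \<iota> x = sec n a d s (\<lambda>(\<iota>, \<alpha>). c \<iota> \<alpha>) \<iota> x" for \<iota> x
  proof (cases "\<iota> \<in> blocks a s")
    case True
    show ?thesis unfolding c[rule_format, OF True] sec_def using True by simp
  next
    case False
    thus ?thesis using sum_of_twistsD(2)[OF \<sigma> False] by (simp add: sec_def)
  qed
  hence "\<sigma> = sec n a d s (\<lambda>(\<iota>, \<alpha>). c \<iota> \<alpha>)" by (intro ext)
  thus ?thesis unfolding coef_def by (rule someI[where P = "\<lambda>k. \<sigma> = sec n a d s k"])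
qed

lemma sec_eqD:
  assumes eq: "sec n a d s k = sec n a d s k'" and x: "x \<in> coords n a d s"
  shows "k x = k' x"
proof -
  obtain \<iota> \<alpha> where x: "x = (\<iota>, \<alpha>)" "\<iota> \<in> blocks a s" "\<alpha> \<in> exponents n (d (fst \<iota>))"
    using x by (auto simp: coords_def)
  have "(\<Sum>\<alpha>\<in>exponents n (d (fst \<iota>)). (k (\<iota>, \<alpha>) - k' (\<iota>, \<alpha>)) * monom_fun n \<alpha> y) = 0" if "y \<in> vecs n - {0}" for y
    using fun_cong[OF fun_cong[OF eq, of \<iota>], of y] x(2) that
    by (simp add: sec_def sum_subtractf left_diff_distrib)
  from form_coeff_unique[OF this x(3)] show ?thesis by (simp add: x(1))
qed

lemma coef_sec: "x \<in> coords n a d s \<Longrightarrow> coef n a d s (sec n a d s k) x = k x"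
  using sec_eqD[OF global_section_sec[OF sec_global]] by (rule sym)

lemma sec_cong: "(\<And>x. x \<in> coords n a d s \<Longrightarrow> k x = k' x) \<Longrightarrow> sec n a d s k = sec n a d s k'"
  unfolding sec_def coords_def by (intro ext if_cong refl sum.cong) auto

lemma sec_add: "sec n a d s (\<lambda>x. k x + k' x) = sec n a d s k + sec n a d s k'"
  by (intro ext) (simp add: sec_def sum.distrib distrib_right)

lemma sec_scale: "sec n a d s (\<lambda>x. c * k x) = (\<lambda>\<iota> x. c * sec n a d s k \<iota> x)"
  by (intro ext) (simp add: sec_def sum_distrib_left mult_ac)

text \<open>A scalar is viewed as a constant section of the structure sheaf, so that linearity over
  this sheaf gives complex linearity on global sections.\<close>

lemma sec_smul: "smul (\<lambda>x. if x \<in> vecs n - {0} then c else 0) (sec n a d s k) = sec n a d s (\<lambda>x. c * k x)"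
  unfolding sec_scale by (intro ext) (simp add: smul_def sec_def)

lemma global_eqI:
  assumes "\<sigma> \<in> global_sections n (sum_of_twists n a d s)" "\<tau> \<in> global_sections n (sum_of_twists n a d s)"
    and "\<And>x. x \<in> coords n a d s \<Longrightarrow> coef n a d s \<sigma> x = coef n a d s \<tau> x"
  shows "\<sigma> = \<tau>"
  using global_section_sec[OF assms(1)] global_section_sec[OF assms(2)] sec_cong[OF assms(3)] by simp

lemma coef_add:
  assumes "\<sigma> \<in> global_sections n (sum_of_twists n a d s)" "\<tau> \<in> global_sections n (sum_of_twists n a d s)"
    and "x \<in> coords n a d s"
  shows "coef n a d s (\<sigma> + \<tau>) x = coef n a d s \<sigma> x + coef n a d s \<tau> x"
proof -
  have "\<sigma> + \<tau> = sec n a d s (\<lambda>x. coef n a d s \<sigma> x + coef n a d s \<tau> x)"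
    unfolding sec_add using global_section_sec[OF assms(1)] global_section_sec[OF assms(2)] by simp
  thus ?thesis using coef_sec[OF assms(3)] by simp
qed

lemma coef_scale:
  assumes "\<sigma> \<in> global_sections n (sum_of_twists n a d s)" "x \<in> coords n a d s"
  shows "coef n a d s (\<lambda>\<iota> x. c * \<sigma> \<iota> x) x = c * coef n a d s \<sigma> x"
proof -
  have "(\<lambda>\<iota> x. c * \<sigma> \<iota> x) = sec n a d s (\<lambda>x. c * coef n a d s \<sigma> x)"
    unfolding sec_scale using global_section_sec[OF assms(1)] by simp
  thus ?thesis using coef_sec[OF assms(2)] by simp
qed

text \<open>The matrix on global sections, in the monomial bases, of an arbitrary morphism. The
  morphism is the last argument because the entry is used as a function of it.\<close>

definition hom_entry :: "nat \<Rightarrow> nat \<Rightarrow> nat \<Rightarrow> (nat \<Rightarrow> nat) \<Rightarrow> (nat \<Rightarrow> nat) \<Rightarrow> (nat \<Rightarrow> nat) \<Rightarrow> (nat \<Rightarrow> nat) \<Rightarrow>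
    coord \<Rightarrow> coord \<Rightarrow> sheaf_map \<Rightarrow> complex" where
  "hom_entry n a b d e s t x q M =
     coef n b e t (on_global_sections n M (sec n a d s (\<lambda>y. if y = x then 1 else 0))) q"

context twist_data
begin

abbreviation "V\<^sub>1 \<equiv> sum_of_twists n a d s"
abbreviation "V\<^sub>2 \<equiv> sum_of_twists n b e t"
abbreviation "\<Gamma>\<^sub>1 \<equiv> global_sections n V\<^sub>1"
abbreviation "\<Gamma>\<^sub>2 \<equiv> global_sections n V\<^sub>2"
abbreviation "sec\<^sub>1 \<equiv> sec n a d s"
abbreviation "sec\<^sub>2 \<equiv> sec n b e t"
abbreviation "coef\<^sub>1 \<equiv> coef n a d s"
abbreviation "coef\<^sub>2 \<equiv> coef n b e t"
abbreviation "ent \<equiv> hom_entry n a b d e s t"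

lemma hom_global:
  assumes M: "M \<in> sheaf_hom n V\<^sub>1 V\<^sub>2"
  shows "\<sigma> \<in> \<Gamma>\<^sub>1 \<Longrightarrow> on_global_sections n M \<sigma> \<in> \<Gamma>\<^sub>2"
    and "\<sigma> \<in> \<Gamma>\<^sub>1 \<Longrightarrow> \<tau> \<in> \<Gamma>\<^sub>1 \<Longrightarrow> on_global_sections n M (\<sigma> + \<tau>) = on_global_sections n M \<sigma> + on_global_sections n M \<tau>"
    and "f \<in> twist n 0 (proj_space n) \<Longrightarrow> \<sigma> \<in> \<Gamma>\<^sub>1 \<Longrightarrow> on_global_sections n M (smul f \<sigma>) = smul f (on_global_sections n M \<sigma>)"
proof -
  have "\<forall>U. proj_open n U \<longrightarrow>
            (\<forall>\<sigma>\<in>V\<^sub>1 U. M U \<sigma> \<in> V\<^sub>2 U) \<and>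
            (\<forall>\<sigma>\<in>V\<^sub>1 U. \<forall>\<tau>\<in>V\<^sub>1 U. M U (\<sigma> + \<tau>) = M U \<sigma> + M U \<tau>) \<and>
            (\<forall>f\<in>twist n 0 U. \<forall>\<sigma>\<in>V\<^sub>1 U. M U (smul f \<sigma>) = smul f (M U \<sigma>))"
    using M unfolding sheaf_hom_def mem_Collect_eq by (rule conjunct1)
  note H = mp[OF spec[OF this] proj_open_space]
  show "\<sigma> \<in> \<Gamma>\<^sub>1 \<Longrightarrow> on_global_sections n M \<sigma> \<in> \<Gamma>\<^sub>2"
    unfolding global_sections_def on_global_sections_def by (rule bspec[OF conjunct1[OF H]])
  show "\<sigma> \<in> \<Gamma>\<^sub>1 \<Longrightarrow> \<tau> \<in> \<Gamma>\<^sub>1 \<Longrightarrow> on_global_sections n M (\<sigma> + \<tau>) = on_global_sections n M \<sigma> + on_global_sections n M \<tau>"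
    unfolding global_sections_def on_global_sections_def
    by (rule bspec[OF bspec[OF conjunct1[OF conjunct2[OF H]]]])
  show "f \<in> twist n 0 (proj_space n) \<Longrightarrow> \<sigma> \<in> \<Gamma>\<^sub>1 \<Longrightarrow> on_global_sections n M (smul f \<sigma>) = smul f (on_global_sections n M \<sigma>)"
    unfolding global_sections_def on_global_sections_def
    by (rule bspec[OF bspec[OF conjunct2[OF conjunct2[OF H]]]])
qed

text \<open>On global sections a morphism is additive and complex linear, so its values at the basis
  sections determine it.\<close>

lemma hom_coef:
  assumes M: "M \<in> sheaf_hom n V\<^sub>1 V\<^sub>2" and q: "q \<in> Q"
  shows "coef\<^sub>2 (on_global_sections n M (sec\<^sub>1 k)) q = (\<Sum>x\<in>P. ent x q M * k x)"
proof -
  define h where "h k = coef\<^sub>2 (on_global_sections n M (sec\<^sub>1 k)) q" for k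
  have h_add: "h (\<lambda>x. k x + k' x) = h k + h k'" for k k'
    unfolding h_def sec_add hom_global(2)[OF M sec_global sec_global]
    by (rule coef_add[OF hom_global(1)[OF M sec_global] hom_global(1)[OF M sec_global] q])
  have h_scale: "h (\<lambda>x. c * k x) = c * h k" for c k
  proof -
    let ?f = "\<lambda>x. if x \<in> vecs n - {0} then c else 0"
    obtain k' where k': "on_global_sections n M (sec\<^sub>1 k) = sec\<^sub>2 k'"
      using global_section_sec[OF hom_global(1)[OF M sec_global]] by blast
    have "?f \<in> twist n 0 (proj_space n)"
      using twist_form[OF proj_open_space forms_const] unfolding cone_proj_space .
    from hom_global(3)[OF M this sec_global[of n a d s k]]
    have "on_global_sections n M (sec\<^sub>1 (\<lambda>x. c * k x)) = sec\<^sub>2 (\<lambda>x. c * k' x)"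
      unfolding sec_smul k' .
    thus ?thesis unfolding h_def k' using coef_sec[OF q] by simp
  qed
  have "h (\<lambda>x. if x \<in> A then k x else 0) = (\<Sum>x\<in>A. ent x q M * k x)" if "finite A" for A
    using that
  proof (induction A rule: finite_induct)
    case empty
    show ?case using h_scale[of 0 "\<lambda>_. 0"] by simp
  next
    case (insert y A)
    have "(\<lambda>x. if x \<in> insert y A then k x else 0)
        = (\<lambda>x. k y * (if x = y then 1 else 0) + (if x \<in> A then k x else 0))"
      using insert.hyps by (auto simp: fun_eq_iff)
    hence "h (\<lambda>x. if x \<in> insert y A then k x else 0)
        = k y * h (\<lambda>x. if x = y then 1 else 0) + (\<Sum>x\<in>A. ent x q M * k x)"
      by (simp only: h_add h_scale insert.IH)
    thus ?case using insert.hyps by (simp add: h_def hom_entry_def mult.commute)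
  qed
  from this[OF finite_coords, of n a d s]
  have "h (\<lambda>x. if x \<in> P then k x else 0) = (\<Sum>x\<in>P. ent x q M * k x)" .
  moreover have "sec\<^sub>1 (\<lambda>x. if x \<in> P then k x else 0) = sec\<^sub>1 k" by (rule sec_cong) simp
  ultimately show ?thesis by (simp add: h_def)
qed

text \<open>Sums and multiples of morphisms are pointwise and \<open>coef\<close> is linear, so an
  entry is a linear functional on Hom.\<close>

lemma ent_polynomial:
  assumes "q \<in> Q"
  shows "(\<lambda>M. ent x q M) \<in> polynomial_functions hom_scale (sheaf_hom n V\<^sub>1 V\<^sub>2)"
proof (rule polynomial_functions.linear)
  show "\<forall>M\<in>sheaf_hom n V\<^sub>1 V\<^sub>2. \<forall>M'\<in>sheaf_hom n V\<^sub>1 V\<^sub>2. ent x q (M + M') = ent x q M + ent x q M'"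
    unfolding hom_entry_def on_global_sections_def
    using coef_add[OF _ _ assms] hom_global(1)[OF _ sec_global, unfolded on_global_sections_def] by simp
  show "\<forall>c. \<forall>M\<in>sheaf_hom n V\<^sub>1 V\<^sub>2. ent x q (hom_scale c M) = c * ent x q M"
    unfolding hom_entry_def on_global_sections_def hom_scale_def
    using coef_scale[OF _ assms] hom_global(1)[OF _ sec_global, unfolded on_global_sections_def] by simp
qed

section \<open>Morphisms given by matrices of forms\<close>

definition form_matrix :: "(matrix_coord \<Rightarrow> complex) \<Rightarrow>
    nat \<times> nat \<Rightarrow> nat \<times> nat \<Rightarrow> (nat \<Rightarrow> complex) \<Rightarrow> complex" where
  "form_matrix c \<iota> \<kappa> x = (\<Sum>\<gamma>\<in>X (e (fst \<kappa>) - d (fst \<iota>)). c (\<iota>, \<kappa>, \<gamma>) * monom_fun n \<gamma> x)"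

text \<open>The value \<open>0\<close> off the domain is the normalisation that
  \<open>sheaf_hom\<close> prescribes.\<close>

definition matrix_hom :: "(matrix_coord \<Rightarrow> complex) \<Rightarrow> sheaf_map" where
  "matrix_hom c U \<sigma> = (if proj_open n U \<and> \<sigma> \<in> V\<^sub>1 U
     then \<lambda>\<kappa> x. if \<kappa> \<in> J then \<Sum>\<iota>\<in>I. form_matrix c \<iota> \<kappa> x * \<sigma> \<iota> x else 0 else 0)"

lemma matrix_hom_apply:
  assumes "proj_open n U" "\<sigma> \<in> V\<^sub>1 U"
  shows "matrix_hom c U \<sigma> = (\<lambda>\<kappa> x. if \<kappa> \<in> J then \<Sum>\<iota>\<in>I. form_matrix c \<iota> \<kappa> x * \<sigma> \<iota> x else 0)"
  using assms by (simp add: matrix_hom_def)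

lemma sum_of_twists_add:
  assumes "proj_open n U" "\<sigma> \<in> V\<^sub>1 U" "\<tau> \<in> V\<^sub>1 U" shows "\<sigma> + \<tau> \<in> V\<^sub>1 U"
proof (rule sum_of_twistsI)
  fix \<iota> assume "\<iota> \<in> I"
  from twist_add[OF sum_of_twistsD(1)[OF assms(2) this] sum_of_twistsD(1)[OF assms(3) this]]
  show "(\<sigma> + \<tau>) \<iota> \<in> twist n (d (fst \<iota>)) U" by (simp add: plus_fun_def)
qed (use sum_of_twistsD(2)[OF assms(2)] sum_of_twistsD(2)[OF assms(3)] in simp)

lemma sum_of_twists_smul:
  assumes "f \<in> twist n 0 U" "\<sigma> \<in> V\<^sub>1 U" shows "smul f \<sigma> \<in> V\<^sub>1 U"
proof (rule sum_of_twistsI)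
  fix \<iota> assume "\<iota> \<in> I"
  from twist_mult[OF assms(1) sum_of_twistsD(1)[OF assms(2) this]]
  show "smul f \<sigma> \<iota> \<in> twist n (d (fst \<iota>)) U" by (simp add: smul_def)
qed (use sum_of_twistsD(2)[OF assms(2)] in \<open>simp add: smul_def fun_eq_iff\<close>)

lemma sum_of_twists_restr:
  assumes "\<sigma> \<in> V\<^sub>1 U" "proj_open n U'" "U' \<subseteq> U" shows "restr U' \<sigma> \<in> V\<^sub>1 U'"
proof (rule sum_of_twistsI)
  fix \<iota> assume "\<iota> \<in> I"
  from twist_restrict[OF sum_of_twistsD(1)[OF assms(1) this] assms(2,3)]
  show "restr U' \<sigma> \<iota> \<in> twist n (d (fst \<iota>)) U'" by (simp only: restr_def)
qed (use sum_of_twistsD(2)[OF assms(1)] in \<open>simp add: restr_def fun_eq_iff\<close>)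

lemma matrix_hom_in_sheaf_hom: "matrix_hom c \<in> sheaf_hom n V\<^sub>1 V\<^sub>2"
proof -
  have maps: "matrix_hom c U \<sigma> \<in> V\<^sub>2 U" if U: "proj_open n U" and \<sigma>: "\<sigma> \<in> V\<^sub>1 U" for U \<sigma>
    unfolding matrix_hom_apply[OF U \<sigma>]
  proof (rule sum_of_twistsI)
    fix \<kappa> assume \<kappa>: "\<kappa> \<in> J"
    have "(\<lambda>x. \<Sum>\<iota>\<in>I. form_matrix c \<iota> \<kappa> x * \<sigma> \<iota> x) \<in> twist n (e (fst \<kappa>)) U"
    proof (rule twist_sum[OF U])
      fix \<iota> assume \<iota>: "\<iota> \<in> I"
      have "form_matrix c \<iota> \<kappa> \<in> forms n (e (fst \<kappa>) - d (fst \<iota>))"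
        unfolding form_matrix_def by (rule formI)
      from twist_form_mult[OF U this sum_of_twistsD(1)[OF \<sigma> \<iota>]]
      show "(\<lambda>x. form_matrix c \<iota> \<kappa> x * \<sigma> \<iota> x) \<in> twist n (e (fst \<kappa>)) U"
        using d_less_e[OF blocks_I[OF \<iota>] blocks_J[OF \<kappa>]] by simp
    qed
    thus "(\<lambda>x. if \<kappa> \<in> J then \<Sum>\<iota>\<in>I. form_matrix c \<iota> \<kappa> x * \<sigma> \<iota> x else 0) \<in> twist n (e (fst \<kappa>)) U"
      using \<kappa> by simp
  qed (simp add: fun_eq_iff)
  have add: "matrix_hom c U (\<sigma> + \<tau>) = matrix_hom c U \<sigma> + matrix_hom c U \<tau>"
    if "proj_open n U" "\<sigma> \<in> V\<^sub>1 U" "\<tau> \<in> V\<^sub>1 U" for U \<sigma> \<tau>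
    unfolding matrix_hom_apply[OF that(1,2)] matrix_hom_apply[OF that(1,3)] matrix_hom_apply[OF that(1) sum_of_twists_add[OF that]]
    by (intro ext) (simp add: distrib_left sum.distrib)
  have smul: "matrix_hom c U (smul f \<sigma>) = smul f (matrix_hom c U \<sigma>)"
    if "proj_open n U" "f \<in> twist n 0 U" "\<sigma> \<in> V\<^sub>1 U" for U f \<sigma>
    unfolding matrix_hom_apply[OF that(1,3)] matrix_hom_apply[OF that(1) sum_of_twists_smul[OF that(2,3)]]
    by (intro ext) (simp add: smul_def sum_distrib_left mult_ac)
  have res: "matrix_hom c U' (restr U' \<sigma>) = restr U' (matrix_hom c U \<sigma>)"
    if "proj_open n U" "proj_open n U'" "U' \<subseteq> U" "\<sigma> \<in> V\<^sub>1 U" for U U' \<sigma>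
    unfolding matrix_hom_apply[OF that(1,4)] matrix_hom_apply[OF that(2) sum_of_twists_restr[OF that(4,2,3)]]
    by (intro ext) (simp add: restr_def)
  have out: "matrix_hom c U \<sigma> = 0" if "\<not> (proj_open n U \<and> \<sigma> \<in> V\<^sub>1 U)" for U \<sigma>
    using that unfolding matrix_hom_def by (rule if_not_P)
  show ?thesis unfolding sheaf_hom_def
    by (intro CollectI conjI allI impI ballI)
       (blast intro: maps add smul res out)+
qed

text \<open>Multiplying the monomial \<open>\<alpha>\<close> by a form shifts exponents by
  \<open>\<alpha>\<close>. This ties the matrices counted modulo a prime to actual
  morphisms.\<close>

lemma ent_matrix_hom:
  assumes x: "x \<in> P" and q: "q \<in> Q"
  shows "ent x q (matrix_hom c) = entry c x q"
proof -
  obtain \<iota> \<alpha> where x': "x = (\<iota>, \<alpha>)" "\<iota> \<in> I" "\<alpha> \<in> X (d (fst \<iota>))" using x by (auto simp: coords_def)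
  let ?\<delta> = "\<lambda>y. if y = x then 1 else 0 :: complex"
  have s1: "sec\<^sub>1 ?\<delta> \<iota>' y = (if \<iota>' = \<iota> \<and> y \<in> vecs n - {0} then monom_fun n \<alpha> y else 0)" for \<iota>' y
  proof (cases "\<iota>' = \<iota>")
    case True
    have "(\<Sum>\<alpha>'\<in>X (d (fst \<iota>)). ?\<delta> (\<iota>, \<alpha>') * monom_fun n \<alpha>' y) = monom_fun n \<alpha> y"
      using x' by (subst sum.remove[of _ \<alpha>]) auto
    thus ?thesis using True x'(2) by (simp add: sec_def)
  next
    case False
    thus ?thesis by (simp add: sec_def x'(1))
  qed
  have "matrix_hom c (proj_space n) (sec\<^sub>1 ?\<delta>) \<kappa> y = sec\<^sub>2 (entry c x) \<kappa> y" for \<kappa> y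
  proof (cases "\<kappa> \<in> J \<and> y \<in> vecs n - {0}")
    case True
    have le: "d (fst \<iota>) \<le> e (fst \<kappa>)"
      using d_less_e[OF blocks_I[OF x'(2)] blocks_J[of \<kappa>]] True by simp
    have "matrix_hom c (proj_space n) (sec\<^sub>1 ?\<delta>) \<kappa> y = (\<Sum>\<iota>'\<in>I. form_matrix c \<iota>' \<kappa> y * sec\<^sub>1 ?\<delta> \<iota>' y)"
      using True by (subst matrix_hom_apply[OF proj_open_space sec_global[unfolded global_sections_def]]) simp
    also have "\<dots> = form_matrix c \<iota> \<kappa> y * monom_fun n \<alpha> y"
      unfolding s1 using True x'(2) by (subst sum.remove[of _ \<iota>]) auto
    also have "\<dots> = (\<Sum>\<gamma>\<in>X (e (fst \<kappa>) - d (fst \<iota>)). c (\<iota>, \<kappa>, \<gamma>) * monom_fun n (\<alpha> + \<gamma>) y)"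
      unfolding form_matrix_def sum_distrib_right by (simp only: monom_fun_add mult_ac)
    also have "\<dots> = (\<Sum>\<beta>\<in>X (e (fst \<kappa>)). if \<alpha> \<le> \<beta> then c (\<iota>, \<kappa>, \<beta> - \<alpha>) * monom_fun n \<beta> y else 0)"
      by (rule sum_exponents_shift[OF x'(3) le, of "\<lambda>\<beta> \<gamma>. c (\<iota>, \<kappa>, \<gamma>) * monom_fun n \<beta> y", symmetric])
    also have "\<dots> = sec\<^sub>2 (entry c x) \<kappa> y"
      using True by (simp add: sec_def entry_def x'(1) if_distrib[of "\<lambda>z. z * _"] cong: if_cong)
    finally show ?thesis .
  next
    case False
    have "(\<Sum>\<iota>'\<in>I. form_matrix c \<iota>' \<kappa> y * sec\<^sub>1 ?\<delta> \<iota>' y) = 0" if "y \<notin> vecs n - {0}"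
      unfolding s1 by (intro sum.neutral ballI) (simp only: that simp_thms if_False mult_zero_right)
    with False show ?thesis
      by (subst matrix_hom_apply[OF proj_open_space sec_global[unfolded global_sections_def]]) (auto simp: sec_def)
  qed
  hence "on_global_sections n (matrix_hom c) (sec\<^sub>1 ?\<delta>) = sec\<^sub>2 (entry c x)"
    unfolding on_global_sections_def by (intro ext)
  thus ?thesis unfolding hom_entry_def using coef_sec[OF q] by simp
qed

text \<open>The nonvanishing set of one polynomial function is open, and the morphism with
  coefficients \<open>c\<close> shows that it is not empty.\<close>

lemma general_in_HomI:
  assumes "f \<in> polynomial_functions hom_scale (sheaf_hom n V\<^sub>1 V\<^sub>2)" "f (matrix_hom c) \<noteq> 0"
    and "\<And>M. M \<in> sheaf_hom n V\<^sub>1 V\<^sub>2 \<Longrightarrow> f M \<noteq> 0 \<Longrightarrow> R M"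
  shows "general_in_Hom n V\<^sub>1 V\<^sub>2 R"
proof -
  let ?A = "{M \<in> sheaf_hom n V\<^sub>1 V\<^sub>2. \<exists>f\<in>{f}. f M \<noteq> 0}"
  have "zariski_open_in hom_scale (sheaf_hom n V\<^sub>1 V\<^sub>2) ?A"
    unfolding zariski_open_in_def using assms(1) by (intro exI[of _ "{f}"] conjI refl) simp
  moreover have "?A \<noteq> {}" using matrix_hom_in_sheaf_hom assms(2) by blast
  moreover have "\<forall>M\<in>?A. R M" using assms(3) by simp
  ultimately show ?thesis unfolding general_in_Hom_def by blast
qed

lemma entry_of_int: "entry (\<lambda>g. of_int (c g)) x q = of_int (entry c x q)"
  by (simp add: entry_def split: prod.splits)

text \<open>The determinant is that of the morphism followed by the transpose of the fixed integer
  matrix. Where it is nonzero the morphism is injective; at the fixed matrix itself it is the Gram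
  determinant.\<close>

lemma general_injective:
  assumes A: "\<And>k. (\<And>q. q \<in> Q \<Longrightarrow> (\<Sum>x\<in>P. entry c x q * k x) = (0::int)) \<Longrightarrow> \<forall>x\<in>P. k x = 0"
  shows "general_in_Hom n V\<^sub>1 V\<^sub>2 (\<lambda>M. inj_on (on_global_sections n M) \<Gamma>\<^sub>1)"
proof (rule general_in_HomI)
  let ?c = "\<lambda>g. of_int (c g) :: complex"
  let ?B = "\<lambda>M x y. \<Sum>q\<in>Q. of_int (entry c x q) * ent y q M"
  let ?f = "\<lambda>M. det (set_mat P (?B M))"
  show "?f \<in> polynomial_functions hom_scale (sheaf_hom n V\<^sub>1 V\<^sub>2)"
    by (intro polynomial_functions_det polynomial_functions_sum finite_coords
          polynomial_functions.mult[OF polynomial_functions.const] ent_polynomial)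
  have "set_mat P (?B (matrix_hom ?c)) = set_mat P (\<lambda>x y. of_int (\<Sum>q\<in>Q. entry c x q * entry c y q))"
    unfolding set_mat_def
    by (rule cong_mat) (simp_all add: ent_matrix_hom entry_of_int enum_in)
  thus "?f (matrix_hom ?c) \<noteq> 0"
    using gram_det_nonzero[OF finite_coords finite_coords A] by (simp only: set_det_of_int of_int_eq_0_iff not_False_eq_True)
  fix M assume M: "M \<in> sheaf_hom n V\<^sub>1 V\<^sub>2" and det: "?f M \<noteq> 0"
  show "inj_on (on_global_sections n M) \<Gamma>\<^sub>1"
  proof (rule inj_onI)
    fix \<sigma> \<tau> assume \<sigma>: "\<sigma> \<in> \<Gamma>\<^sub>1" and \<tau>: "\<tau> \<in> \<Gamma>\<^sub>1" and eq: "on_global_sections n M \<sigma> = on_global_sections n M \<tau>"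
    let ?k = "\<lambda>x. coef\<^sub>1 \<sigma> x - coef\<^sub>1 \<tau> x"
    have 0: "(\<Sum>x\<in>P. ent x q M * ?k x) = 0" if q: "q \<in> Q" for q
    proof -
      have "(\<Sum>x\<in>P. ent x q M * coef\<^sub>1 \<sigma> x) = (\<Sum>x\<in>P. ent x q M * coef\<^sub>1 \<tau> x)"
        unfolding hom_coef[OF M q, symmetric] using global_section_sec[OF \<sigma>] global_section_sec[OF \<tau>] eq by simp
      thus ?thesis by (simp add: right_diff_distrib sum_subtractf)
    qed
    have "(\<Sum>y\<in>P. ?B M x y * ?k y) = 0" for x
    proof -
      have "(\<Sum>y\<in>P. ?B M x y * ?k y) = (\<Sum>y\<in>P. \<Sum>q\<in>Q. of_int (entry c x q) * (ent y q M * ?k y))"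
        unfolding sum_distrib_right by (simp only: mult.assoc)
      also have "\<dots> = (\<Sum>q\<in>Q. of_int (entry c x q) * (\<Sum>y\<in>P. ent y q M * ?k y))"
        unfolding sum_distrib_left by (rule sum.swap)
      also have "\<dots> = 0" by (intro sum.neutral ballI) (simp only: 0 mult_zero_right)
      finally show ?thesis .
    qed
    from set_det_kernel[OF finite_coords det this] show "\<sigma> = \<tau>" by (intro global_eqI[OF \<sigma> \<tau>]) simp
  qed
qed

text \<open>The order of composition is reversed: the transpose of the fixed matrix comes first, and
  invertibility on the target makes the morphism surjective.\<close>

lemma general_surjective:
  assumes A: "\<And>\<phi>. (\<And>x. x \<in> P \<Longrightarrow> (\<Sum>q\<in>Q. entry c x q * \<phi> q) = (0::int)) \<Longrightarrow> \<forall>q\<in>Q. \<phi> q = 0"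
  shows "general_in_Hom n V\<^sub>1 V\<^sub>2 (\<lambda>M. on_global_sections n M ` \<Gamma>\<^sub>1 = \<Gamma>\<^sub>2)"
proof (rule general_in_HomI)
  let ?c = "\<lambda>g. of_int (c g) :: complex"
  let ?B = "\<lambda>M q q'. \<Sum>x\<in>P. of_int (entry c x q') * ent x q M"
  let ?f = "\<lambda>M. det (set_mat Q (?B M))"
  show "?f \<in> polynomial_functions hom_scale (sheaf_hom n V\<^sub>1 V\<^sub>2)"
    by (intro polynomial_functions_det polynomial_functions_sum finite_coords
          polynomial_functions.mult[OF polynomial_functions.const] ent_polynomial)
  have "set_mat Q (?B (matrix_hom ?c)) = set_mat Q (\<lambda>q q'. of_int (\<Sum>x\<in>P. entry c x q * entry c x q'))"
    unfolding set_mat_def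
    by (rule cong_mat) (simp_all add: ent_matrix_hom entry_of_int enum_in mult.commute)
  thus "?f (matrix_hom ?c) \<noteq> 0"
    using gram_det_nonzero[where A = "\<lambda>q x. entry c x q", OF finite_coords finite_coords A]
    by (simp only: set_det_of_int of_int_eq_0_iff not_False_eq_True)
  fix M assume M: "M \<in> sheaf_hom n V\<^sub>1 V\<^sub>2" and det: "?f M \<noteq> 0"
  show "on_global_sections n M ` \<Gamma>\<^sub>1 = \<Gamma>\<^sub>2"
  proof (intro equalityI subsetI)
    fix \<tau> assume \<tau>: "\<tau> \<in> \<Gamma>\<^sub>2"
    obtain y where y: "\<And>q. q \<in> Q \<Longrightarrow> (\<Sum>q'\<in>Q. ?B M q q' * y q') = coef\<^sub>2 \<tau> q"
      using set_det_solve[OF finite_coords det, of "coef\<^sub>2 \<tau>"] by blast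
    \<comment> \<open>The preimage is sought in the image of the transpose, where it amounts to the
      square system solved by \<open>y\<close>.\<close>
    define k where "k x = (\<Sum>q'\<in>Q. of_int (entry c x q') * y q')" for x
    have "on_global_sections n M (sec\<^sub>1 k) = \<tau>"
    proof (rule global_eqI[OF hom_global(1)[OF M sec_global] \<tau>])
      fix q assume q: "q \<in> Q"
      have "coef\<^sub>2 (on_global_sections n M (sec\<^sub>1 k)) q = (\<Sum>x\<in>P. \<Sum>q'\<in>Q. of_int (entry c x q') * ent x q M * y q')"
        unfolding hom_coef[OF M q] k_def sum_distrib_left by (simp only: mult_ac)
      also have "\<dots> = (\<Sum>q'\<in>Q. ?B M q q' * y q')"
        unfolding sum_distrib_right by (rule sum.swap)
      finally show "coef\<^sub>2 (on_global_sections n M (sec\<^sub>1 k)) q = coef\<^sub>2 \<tau> q" using y[OF q] by simp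
    qed
    thus "\<tau> \<in> on_global_sections n M ` \<Gamma>\<^sub>1" using sec_global by blast
  qed (use hom_global(1)[OF M] in blast)
qed

lemma general_maximal_rank:
  assumes "max (\<Sum>i=1..a. real (s i) * real (D i)) (\<Sum>j=1..b. real (t j) * real (E j))
    \<ge> 1 / 4 * real (D a) * real (E b) * (\<Sum>i=1..a. (real (D i))\<^sup>2)"
  shows "general_in_Hom n V\<^sub>1 V\<^sub>2 (\<lambda>M. maximal_rank (on_global_sections n M) \<Gamma>\<^sub>1 \<Gamma>\<^sub>2)"
proof -
  let ?S = "\<Sum>i=1..a. s i * D i" and ?T = "\<Sum>j=1..b. t j * E j"
  have real: "real ?S = (\<Sum>i=1..a. real (s i) * real (D i))" "real ?T = (\<Sum>j=1..b. real (t j) * real (E j))"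
    by simp_all
  have "general_in_Hom n V\<^sub>1 V\<^sub>2 (\<lambda>M. inj_on (on_global_sections n M) \<Gamma>\<^sub>1) \<or>
        general_in_Hom n V\<^sub>1 V\<^sub>2 (\<lambda>M. on_global_sections n M ` \<Gamma>\<^sub>1 = \<Gamma>\<^sub>2)"
  \<comment> \<open>The larger of the two dimensions attains the maximum in the hypothesis, so the
    bound falls on the side that each count needs.\<close>
  proof (cases "?S \<le> ?T")
    case True
    hence "real ?S \<le> real ?T" by (simp only: of_nat_le_iff)
    hence "1 / 4 * real (D a) * real (E b) * (\<Sum>i=1..a. (real (D i))\<^sup>2) \<le> (\<Sum>j=1..b. real (t j) * real (E j))"
      using assms unfolding real by simp
    from exists_injective_mod[OF True this] obtain p c where p: "prime p"
      "\<And>k. (\<forall>q\<in>Q. int p dvd (\<Sum>x\<in>P. entry c x q * k x)) \<Longrightarrow> (\<forall>x\<in>P. int p dvd k x)" by blast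
    have "\<forall>x\<in>P. k x = 0" if "\<And>q. q \<in> Q \<Longrightarrow> (\<Sum>x\<in>P. entry c x q * k x) = 0" for k
      by (intro ballI, rule kernel_zero_of_mod[where A = "\<lambda>x q. entry c x q", OF p that])
    thus ?thesis using general_injective[of c] by blast
  next
    case False
    hence le: "?T \<le> ?S" by simp
    hence "real ?T \<le> real ?S" by (simp only: of_nat_le_iff)
    hence "1 / 4 * real (D a) * real (E b) * (\<Sum>i=1..a. (real (D i))\<^sup>2) \<le> (\<Sum>i=1..a. real (s i) * real (D i))"
      using assms unfolding real by simp
    from exists_surjective_mod[OF le this] obtain p c where p: "prime p"
      "\<And>\<phi>. (\<forall>x\<in>P. int p dvd (\<Sum>q\<in>Q. entry c x q * \<phi> q)) \<Longrightarrow> (\<forall>q\<in>Q. int p dvd \<phi> q)" by blast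
    have "\<forall>q\<in>Q. \<phi> q = 0" if "\<And>x. x \<in> P \<Longrightarrow> (\<Sum>q\<in>Q. entry c x q * \<phi> q) = 0" for \<phi>
      by (intro ballI, rule kernel_zero_of_mod[where A = "\<lambda>q x. entry c x q", OF p that])
    thus ?thesis using general_surjective[of c] by blast
  qed
  thus ?thesis unfolding general_in_Hom_def maximal_rank_def by blast
qed

end

theorem theorem2p7:
  fixes n a b :: nat and d e s t :: "nat \<Rightarrow> nat"
  assumes "n \<ge> 1" and "a \<ge> 1" and "b \<ge> 1"
    and "strict_mono_on {1..a} d" and "d a < e 1" and "strict_mono_on {1..b} e"
    and "max (\<Sum>i=1..a. real (s i) * real ((d i + n) choose n))
             (\<Sum>j=1..b. real (t j) * real ((e j + n) choose n))
         \<ge> 1 / 4 * real ((d a + n) choose n) * real ((e b + n) choose n)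
             * (\<Sum>i=1..a. (real ((d i + n) choose n))\<^sup>2)"
  defines "V\<^sub>1 \<equiv> sum_of_twists n a d s" and "V\<^sub>2 \<equiv> sum_of_twists n b e t"
  shows "general_in_Hom n V\<^sub>1 V\<^sub>2
           (\<lambda>M. maximal_rank (on_global_sections n M)
                  (global_sections n V\<^sub>1) (global_sections n V\<^sub>2))"
proof -
  have mono: "f i \<le> f j" if "strict_mono_on {1..m} f" "i \<in> {1..m}" "j \<in> {1..m}" "i \<le> j"
    for f :: "nat \<Rightarrow> nat" and m i j
    using strict_mono_on_leD[OF that(1-4)] .
  \<comment> \<open>The monotone degrees enter through their extremes: \<open>d a\<close> is the
    largest in the source, \<open>e b\<close> the largest in the target, and all target degrees lie
    above \<open>d a\<close>.\<close>
  interpret twist_data n a b d e s t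
  proof
    show "d i \<le> d a" if "i \<in> {1..a}" for i using mono[OF assms(4) that, of a] that by auto
    show "d a < e j" if "j \<in> {1..b}" for j
      using mono[OF assms(6) _ that, of 1] that assms(3,5) by auto
    show "e j \<le> e b" if "j \<in> {1..b}" for j using mono[OF assms(6) that, of b] that by auto
  qed (use assms in auto)
  show ?thesis
    unfolding V\<^sub>1_def V\<^sub>2_def by (rule general_maximal_rank) (use assms(7) in \<open>simp only: card_exponents\<close>)
qed

end
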